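(* Exactly twenty oriented matroids (up to isomorphism) arise as the oriented matroid of the six lattice points of a lattice $3$-polytope of size $6$ and width one. For exactly eight of these oriented matroids there are infinitely many $\mathbb{Z}$-equivalence classes of lattice $3$-polytopes of size $6$ and width one whose six lattice points have that oriented matroid. For each of the other twelve oriented matroids there is exactly one such $\mathbb{Z}$-equivalence class.
   Context: A lattice $3$-polytope is the convex hull $P\subset\mathbb{R}^3$ of a finite set of points of $\mathbb{Z}^3$ containing four affinely independent points. Its size is $\#(P\cap\mathbb{Z}^3)$. The width of $P$ is the minimum of $\max_{x\in P} f(x)-\min_{x\in P} f(x)$ over all non-constant integer linear functionals $f:\mathbb{Z}^3\to\mathbb{Z}$; thus $P$ has width one if its vertices lie in two parallel and consecutive lattice planes. Two lattice polytopes $P,Q$ are $\mathbb{Z}$-equivalent if there is an affine map $t$ of $\mathbb{R}^3$ with $t(\mathbb{Z}^3)=\mathbb{Z}^3$ and $t(P)=Q$. The oriented matroid of six points $p_1,\dots,p_6\in\mathbb{R}^3$ is given by the signs in $\{-,0,+\}$ of the determinants $\det\begin{pmatrix}1&1&1&1\\ p_i&p_j&p_k&p_l\end{pmatrix}$ for $(i,j,k,l)\in\{1,\dots,6\}^4$; two such oriented matroids are isomorphic if, after a relabeling of the six points, all these signs agree up to one global change of sign. *)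

theory Defs
  imports "HOL-Analysis.Analysis"
begin

definition int_lattice :: "(real ^ 3) set" where
  "int_lattice = {x. \<forall>i. x $ i \<in> \<int>}"

definition lattice_3_polytope :: "(real ^ 3) set \<Rightarrow> bool" where
  "lattice_3_polytope P \<longleftrightarrow>
     (\<exists>S. finite S \<and> S \<subseteq> int_lattice \<and>
          (\<exists>T\<subseteq>S. card T = 4 \<and> \<not> affine_dependent T) \<and>
          P = convex hull S)"

definition lattice_size :: "(real ^ 3) set \<Rightarrow> nat" where
  "lattice_size P = card (P \<inter> int_lattice)"

text \<open>Linear functionals on the integer lattice are represented by their unique linear
  extensions to the whole space.\<close>

definition int_functionals :: "(real ^ 3 \<Rightarrow> real) set" where
  "int_functionals =
     {f. linear f \<and> f ` int_lattice \<subseteq> \<int> \<and> \<not> f constant_on int_lattice}"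

text \<open>For a lattice polytope the suprema and infima below are attained: the polytope is
  compact, and the extreme values of an integer functional on it are integers.\<close>

definition lattice_width :: "(real ^ 3) set \<Rightarrow> real" where
  "lattice_width P = (INF f\<in>int_functionals. (SUP x\<in>P. f x) - (INF x\<in>P. f x))"

definition Z_equivalence :: "((real ^ 3) set \<times> (real ^ 3) set) set" where
  "Z_equivalence =
     {(P, Q). \<exists>t L c. linear L \<and> t = (\<lambda>x. L x + c) \<and>
                      t ` int_lattice = int_lattice \<and> t ` P = Q}"

text \<open>Labels range over the six-element type \<^typ>\<open>6\<close>.\<close>

type_synonym sign_map = "6 \<Rightarrow> 6 \<Rightarrow> 6 \<Rightarrow> 6 \<Rightarrow> real"

definition oriented_matroid :: "(6 \<Rightarrow> real ^ 3) \<Rightarrow> sign_map" where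
  "oriented_matroid p = (\<lambda>i j k l. sgn (det (vector
     [vector [1, 1, 1, 1],
      vector [p i $ 1, p j $ 1, p k $ 1, p l $ 1],
      vector [p i $ 2, p j $ 2, p k $ 2, p l $ 2],
      vector [p i $ 3, p j $ 3, p k $ 3, p l $ 3]] :: real ^ 4 ^ 4)))"

definition om_isomorphism :: "(sign_map \<times> sign_map) set" where
  "om_isomorphism =
     {(X, Y). \<exists>\<pi> s. bij \<pi> \<and> s \<in> {1, -1} \<and>
        (\<forall>i j k l. Y i j k l = s * X (\<pi> i) (\<pi> j) (\<pi> k) (\<pi> l))}"

definition size6_width1_polytopes :: "(real ^ 3) set set" where
  "size6_width1_polytopes =
     {P. lattice_3_polytope P \<and> lattice_size P = 6 \<and> lattice_width P = 1}"

text \<open>The oriented matroids of the six lattice points, one for each labeling.\<close>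

definition point_oms :: "(real ^ 3) set \<Rightarrow> sign_map set" where
  "point_oms P = {oriented_matroid p | p. bij_betw p UNIV (P \<inter> int_lattice)}"

text \<open>An oriented matroid up to isomorphism is an equivalence class of sign maps.\<close>

definition size6_width1_oms :: "sign_map set set" where
  "size6_width1_oms = (\<Union>P\<in>size6_width1_polytopes. point_oms P) // om_isomorphism"

definition Z_classes_with_om :: "sign_map set \<Rightarrow> (real ^ 3) set set set" where
  "Z_classes_with_om M =
     {P \<in> size6_width1_polytopes. \<exists>X\<in>point_oms P. X \<in> M} // Z_equivalence"

end

theory Submission
  imports Defs
begin

text \<open>A lattice polytope is determined by its integer points, so the whole question is about sets
  \<open>A\<close> of six points of \<open>\<int>\<^sup>3\<close> that contain all integer points of their convex hull.  An integer
  functional of width one takes two consecutive values on \<open>A\<close>; it is primitive, hence part of a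
  coordinate system, and \<open>A\<close> becomes \<open>B \<times> {0} \<union> C \<times> {1}\<close> (written \<open>stack B C\<close>) with \<open>B\<close> and \<open>C\<close>
  lattice-convex sets in the plane with six points in total.

  In the plane the sets of three, four and five points have only finitely many shapes up to
  unimodular maps (\<open>planar3\<close>, \<open>planar4\<close>, \<open>planar5\<close>); the reason is that a lattice triangle with
  base one and height at least two has a lattice point at height one (\<open>height_one\<close>).  Since the
  upper level can be translated freely by a shear, what remains is the direction of a segment or
  the shape matrix of a unimodular triangle on the upper level, relative to the fixed lower level.
  For a segment on the upper level the determinants of four points are linear in its direction,
  and their signs change only at the directions of differences of lower points.  On such a
  special direction primitivity leaves one configuration, while every open sector between two of
  them contains infinitely many, all with the same signs.  For two triangles without parallel
  edges the same works because unimodularity forces all edges of one triangle into a single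
  sector of the other (\<open>unimodular_same_sector\<close>); triangles with parallel edges form two families
  with one parameter (\<open>corner_shared_edge\<close>).  The symmetries of the lower set reduce everything to
  the lists \<open>infinite_types\<close> (eight sign patterns) and \<open>finite_types\<close> (twelve configurations).
  This is \<open>classified_stack\<close>.

  It remains to see that nothing in the two lists coincides and that all of it occurs.  The twenty
  oriented matroids are told apart by one number, \<open>om_invariant\<close>, a sum of even powers of sums of
  signs and thus independent of labels and of the global sign.  Each type is realized by an
  explicit lattice-convex configuration, and for the eight infinite types there are such
  configurations with arbitrarily large determinants (\<open>unbounded_families\<close>); since equivalences
  preserve the absolute values of determinants, these fill infinitely many classes.\<close>

section \<open>Affine automorphisms of a lattice\<close>

text \<open>Preserving \<open>u + v - w\<close> makes a map affine over the integers without any reference to a matrix, so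
  closure under composition and inverses is immediate and one definition serves all dimensions.\<close>
definition lat_aut :: "('a::ab_group_add \<Rightarrow> 'a) \<Rightarrow> bool" where
  "lat_aut T \<longleftrightarrow> bij T \<and> (\<forall>u v w. T (u + v - w) = T u + T v - T w)"

definition lat_equiv :: "'a::ab_group_add set \<Rightarrow> 'a set \<Rightarrow> bool" where
  "lat_equiv A B \<longleftrightarrow> (\<exists>T. lat_aut T \<and> T ` A = B)"

lemma lat_aut_comp: "lat_aut S \<Longrightarrow> lat_aut T \<Longrightarrow> lat_aut (S \<circ> T)"
  by (auto simp: lat_aut_def bij_comp)

lemma lat_aut_inv:
  assumes "lat_aut T" shows "lat_aut (inv T)"
proof -
  have b: "bij T" and a: "\<And>u v w. T (u + v - w) = T u + T v - T w"
    using assms by (auto simp: lat_aut_def)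
  have "inv T (u + v - w) = inv T u + inv T v - inv T w" for u v w
    by (rule inv_f_eq[OF bij_is_inj[OF b]]) (simp add: a surj_f_inv_f[OF bij_is_surj[OF b]])
  then show ?thesis using bij_imp_bij_inv[OF b] by (simp add: lat_aut_def)
qed

lemma lat_equiv_refl: "lat_equiv A A"
  unfolding lat_equiv_def by (rule exI[of _ id]) (simp add: lat_aut_def)

lemma lat_equiv_sym: "lat_equiv A B \<Longrightarrow> lat_equiv B A"
  unfolding lat_equiv_def
  by (metis bij_is_inj image_inv_f_f lat_aut_def lat_aut_inv)

lemma lat_equiv_trans [trans]: "lat_equiv A B \<Longrightarrow> lat_equiv B C \<Longrightarrow> lat_equiv A C"
  unfolding lat_equiv_def by (metis image_comp lat_aut_comp)

lemma lat_equiv_card: "lat_equiv A B \<Longrightarrow> card A = card B"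
  unfolding lat_equiv_def lat_aut_def
  by (metis bij_is_inj card_image inj_on_subset subset_UNIV)

lemma lat_aut_add: 
  assumes "lat_aut T" shows "T (u + v) = T u + T v - T 0"
proof -
  have "T (u + v - 0) = T u + T v - T 0" using assms unfolding lat_aut_def by blast
  then show ?thesis by simp
qed

text \<open>The inverse is the adjugate times the determinant, which is its own inverse.\<close>
lemma lat_aut2:
  assumes "a*d - b*c = 1 \<or> a*d - b*c = (-1::int)"
  shows "lat_aut (\<lambda>(x,y). (a*x + b*y + e, c*x + d*y + f))" (is "lat_aut ?T")
proof -
  define D where "D = a*d - b*c"
  have D: "D * D = 1" using assms by (auto simp: D_def)
  let ?S = "\<lambda>(x,y). (D * (d*(x-e) - b*(y-f)), D * (a*(y-f) - c*(x-e)))"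
  have "?S (?T u) = u" for u
  proof (cases u)
    case (Pair x y)
    have "D * (d*(a*x + b*y) - b*(c*x + d*y)) = (D*D)*x" "D * (a*(c*x + d*y) - c*(a*x + b*y)) = (D*D)*y"
      by (simp_all add: D_def algebra_simps)
    then show ?thesis using Pair D by simp
  qed
  moreover have "?T (?S u) = u" for u
  proof (cases u)
    case (Pair x y)
    define x' y' where "x' = x - e" "y' = y - f"
    have "a * (D * (d*x' - b*y')) + b * (D * (a*y' - c*x')) = (D*D)*x'"
         "c * (D * (d*x' - b*y')) + d * (D * (a*y' - c*x')) = (D*D)*y'"
      by (simp_all add: D_def algebra_simps)
    then show ?thesis using Pair D by (simp add: x'_y'_def)
  qed
  ultimately have "bij ?T" by (intro o_bij[of ?S]) (auto simp: fun_eq_iff)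
  then show ?thesis by (auto simp: lat_aut_def algebra_simps)
qed

definition det3 :: "int \<Rightarrow> int \<Rightarrow> int \<Rightarrow> int \<Rightarrow> int \<Rightarrow> int \<Rightarrow> int \<Rightarrow> int \<Rightarrow> int \<Rightarrow> int" where
  "det3 a b c d e f g h i = a*(e*i - f*h) - b*(d*i - f*g) + c*(d*h - e*g)"

lemma lat_aut3:
  assumes "det3 a b c d e f g h i = 1 \<or> det3 a b c d e f g h i = -1"
  shows "lat_aut (\<lambda>(x,y,z). (a*x + b*y + c*z + r, d*x + e*y + f*z + s, g*x + h*y + i*z + t))"
    (is "lat_aut ?T")
proof -
  define D where "D = det3 a b c d e f g h i"
  have D: "D * D = 1" using assms by (auto simp: D_def)
  let ?S = "\<lambda>(x,y,z). (D * ((e*i-f*h)*(x-r) + (c*h-b*i)*(y-s) + (b*f-c*e)*(z-t)),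
     D * ((f*g-d*i)*(x-r) + (a*i-c*g)*(y-s) + (c*d-a*f)*(z-t)),
     D * ((d*h-e*g)*(x-r) + (b*g-a*h)*(y-s) + (a*e-b*d)*(z-t)))"
  have "?S (?T u) = u" for u
  proof (cases u)
    case (fields x y z)
    have "D * ((e*i-f*h)*(a*x+b*y+c*z) + (c*h-b*i)*(d*x+e*y+f*z) + (b*f-c*e)*(g*x+h*y+i*z)) = (D*D)*x"
     "D * ((f*g-d*i)*(a*x+b*y+c*z) + (a*i-c*g)*(d*x+e*y+f*z) + (c*d-a*f)*(g*x+h*y+i*z)) = (D*D)*y"
     "D * ((d*h-e*g)*(a*x+b*y+c*z) + (b*g-a*h)*(d*x+e*y+f*z) + (a*e-b*d)*(g*x+h*y+i*z)) = (D*D)*z"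
      unfolding mult.assoc D_def det3_def by (algebra)+
    then show ?thesis using fields D by simp
  qed
  moreover have "?T (?S u) = u" for u
  proof (cases u)
    case (fields x y z)
    define x' y' z' where "x' = x - r" "y' = y - s" "z' = z - t"
    define X Y Z where "X = (e*i-f*h)*x' + (c*h-b*i)*y' + (b*f-c*e)*z'"
     "Y = (f*g-d*i)*x' + (a*i-c*g)*y' + (c*d-a*f)*z'"
     "Z = (d*h-e*g)*x' + (b*g-a*h)*y' + (a*e-b*d)*z'"
    have "a*X+b*Y+c*Z = D*x'" "d*X+e*Y+f*Z = D*y'" "g*X+h*Y+i*Z = D*z'"
      unfolding X_Y_Z_def D_def det3_def by algebra+
    then have "D*(a*X+b*Y+c*Z) = (D*D)*x'" "D*(d*X+e*Y+f*Z) = (D*D)*y'" "D*(g*X+h*Y+i*Z) = (D*D)*z'"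
      by simp_all
    then have "a*(D*X)+b*(D*Y)+c*(D*Z) = x'" "d*(D*X)+e*(D*Y)+f*(D*Z) = y'" "g*(D*X)+h*(D*Y)+i*(D*Z) = z'"
      unfolding D by (simp_all add: algebra_simps)
    then show ?thesis using fields by (simp add: x'_y'_z'_def X_Y_Z_def)
  qed
  ultimately have "bij ?T" by (intro o_bij[of ?S]) (auto simp: fun_eq_iff)
  then show ?thesis by (auto simp: lat_aut_def algebra_simps)
qed

type_synonym pt2 = "int \<times> int"
type_synonym pt3 = "int \<times> int \<times> int"

fun det4 :: "pt3 \<Rightarrow> pt3 \<Rightarrow> pt3 \<Rightarrow> pt3 \<Rightarrow> int" where
  "det4 (x,y,z) (x1,y1,z1) (x2,y2,z2) (x3,y3,z3) =
    det3 (x1-x) (y1-y) (z1-z) (x2-x) (y2-y) (z2-z) (x3-x) (y3-y) (z3-z)"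

section \<open>Lattice-convex sets of at most five points in the plane\<close>

definition nmul :: "nat \<Rightarrow> 'a::ab_group_add \<Rightarrow> 'a" where
  "nmul n a = (\<Sum>_<n. a)"

text \<open>The part of convexity that the planar classification uses: a lattice point of a triangle spanned
  by the set, expressed with natural weights, belongs to the set.  Multiples are repeated sums so
  that the notion makes sense in, and transfers between, all abelian groups.\<close>
definition tri_closed :: "'a::ab_group_add set \<Rightarrow> bool" where
  "tri_closed B \<longleftrightarrow> (\<forall>a\<in>B. \<forall>b\<in>B. \<forall>c\<in>B. \<forall>i j k u. i + j + k > 0 \<longrightarrow>
      nmul i a + nmul j b + nmul k c = nmul (i + j + k) u \<longrightarrow> u \<in> B)"

lemma nmul_0 [simp]: "nmul 0 a = 0" and nmul_Suc [simp]: "nmul (Suc n) a = a + nmul n a"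
  by (simp_all add: nmul_def add.commute)

lemma nmul_add_left: "nmul (m + n) a = nmul m a + nmul n a"
  by (induction m) (simp_all add: algebra_simps)

lemma nmul_pair: "nmul n (x, y) = (int n * x, int n * y :: int)"
  by (induction n) (simp_all add: algebra_simps zero_prod_def)

lemma lat_aut_nmul:
  assumes "lat_aut T" shows "nmul n (T a) = T (nmul n a) - T 0 + nmul n (T 0)"
proof (induction n)
  case (Suc n)
  have "T (a + nmul n a) = T a + T (nmul n a) - T 0" by (rule lat_aut_add[OF assms])
  then show ?case by (simp add: Suc.IH)
qed auto

lemma tri_closed_equiv:
  assumes "lat_equiv B B'" "tri_closed B" shows "tri_closed B'"
proof -
  obtain T where T: "lat_aut T" and B': "B' = T ` B" using assms(1) by (auto simp: lat_equiv_def)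
  have inj: "inj T" and surj: "surj T" using T by (auto simp: lat_aut_def bij_def)
  have "T v \<in> B'" if abc: "a \<in> B" "b \<in> B" "c \<in> B" "i + j + k > 0"
    and eq: "nmul i (T a) + nmul j (T b) + nmul k (T c) = nmul (i + j + k) (T v)" for a b c i j k v
  proof -
    have "T (nmul i a + nmul j b + nmul k c) = T (nmul (i + j + k) v)"
    proof -
      have "T (nmul i a + nmul j b + nmul k c) = T (nmul i a) + T (nmul j b) + T (nmul k c) - T 0 - T 0"
        unfolding lat_aut_add[OF T, of "nmul i a + nmul j b"] lat_aut_add[OF T, of "nmul i a"]
        by (simp add: algebra_simps)
      also have "\<dots> = (nmul i (T a) + nmul j (T b) + nmul k (T c)) - nmul (i + j + k) (T 0) + T 0"
        unfolding lat_aut_nmul[OF T, of i a] lat_aut_nmul[OF T, of j b] lat_aut_nmul[OF T, of k c]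
            nmul_add_left by simp
      also have "\<dots> = T (nmul (i + j + k) v)"
        unfolding eq lat_aut_nmul[OF T, of "i + j + k" v] by simp
      finally show ?thesis .
    qed
    then have "nmul i a + nmul j b + nmul k c = nmul (i + j + k) v"
      using inj by (simp add: inj_eq)
    then have "v \<in> B" by (rule assms(2)[unfolded tri_closed_def, rule_format, OF abc])
    then show ?thesis using B' by simp
  qed
  note image_closed = this
  show ?thesis unfolding tri_closed_def
  proof (intro ballI allI impI)
    fix a' b' c' i j k u assume "a' \<in> B'" "b' \<in> B'" "c' \<in> B'" and pos: "i + j + k > 0"
      and eq: "nmul i a' + nmul j b' + nmul k c' = nmul (i + j + k) u"
    then obtain a b c where "a \<in> B" "a' = T a" "b \<in> B" "b' = T b" "c \<in> B" "c' = T c"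
      unfolding B' by blast
    moreover obtain v where "u = T v" using surj by (rule surjE)
    ultimately show "u \<in> B'" using image_closed[of a b c i j k v] pos eq by simp
  qed
qed

lemma tri_closedD:
  assumes B: "tri_closed B" "(x1,y1) \<in> B" "(x2,y2) \<in> B" "(x3,y3) \<in> B"
    and nonneg: "0 \<le> i" "0 \<le> j" "0 \<le> k" and pos: "0 < i + j + (k::int)"
    and eq: "i*x1 + j*x2 + k*x3 = (i+j+k)*x" "i*y1 + j*y2 + k*y3 = (i+j+k)*y"
  shows "(x,y) \<in> B"
proof -
  have e: "nmul (nat i) (x1,y1) + nmul (nat j) (x2,y2) + nmul (nat k) (x3,y3)
      = nmul (nat i + nat j + nat k) (x,y)"
    using nonneg eq by (simp add: nmul_pair)
  have p: "nat i + nat j + nat k > 0" using pos nonneg by linarith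
  show ?thesis
    by (rule B(1)[unfolded tri_closed_def, rule_format, OF B(2-4) p e])
qed

lemma segment_closed:
  assumes "tri_closed (B :: pt2 set)" "(p,0) \<in> B" "(r,0) \<in> B" "p \<le> q" "q \<le> r"
  shows "(q,0) \<in> B"
proof (cases "p = r")
  case False
  show ?thesis
    by (rule tri_closedD[OF assms(1) assms(2) assms(3) assms(3), where i = "r - q" and j = "q - p" and k = 0])
       (use assms False in \<open>auto simp: algebra_simps\<close>)
qed (use assms in auto)

text \<open>At height one a triangle with unit base and height \<open>y\<close> has a section of length
  \<open>1 - 1/y\<close> with ends in multiples of \<open>1/y\<close>.  Such a section contains \<open>y\<close> consecutive multiples
  of \<open>1/y\<close>, and one of them is an integer.  The bounds on that integer locate the point.\<close>
lemma height_one: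
  assumes "tri_closed (B :: pt2 set)" "(s,0) \<in> B" "(s+1,0) \<in> B" "(x,y) \<in> B" "y \<ge> 1"
  obtains k where "(k,1) \<in> B" "x \<le> s + (k - s) * y" "(k - s) * y + s \<le> x + y - 1"
proof -
  define k where "k = s - ((s - x) div y)"
  define r where "r = (s - x) mod y"
  have r: "0 \<le> r" "r < y" using assms(5) by (auto simp: r_def)
  have kr: "(k - s) * y = x - s + r"
    using minus_div_mult_eq_mod[of "s - x" y] by (simp add: k_def r_def algebra_simps)
  have "(k,1) \<in> B"
  proof (rule tri_closedD[OF assms(1-4), where i = "y - 1 - r" and j = r and k = 1])
    have "k * y = (k - s) * y + s * y" by (simp add: algebra_simps)
    then show "(y - 1 - r) * s + r * (s + 1) + 1 * x = (y - 1 - r + r + 1) * k"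
      using kr by (simp add: algebra_simps)
  qed (use r in \<open>auto\<close>)
  then show thesis using that[of k] kr r by simp
qed

lemma lat_equiv2:
  assumes "a*d - b*c = 1 \<or> a*d - b*c = (-1::int)" "(\<lambda>(x,y). (a*x + b*y + e, c*x + d*y + f)) ` B = B'"
  shows "lat_equiv B B'"
  using lat_aut2[OF assms(1)] assms(2) by (auto simp: lat_equiv_def)

lemma move_to_axis:
  assumes "(p::pt2) \<noteq> q"
  obtains T g where "lat_aut T" "T p = (0,0)" "T q = (g,0)" "g > 0"
proof -
  obtain px py qx qy where pq: "p = (px,py)" "q = (qx,qy)" by (metis surj_pair)
  define u v where "u = qx - px" "v = qy - py"
  define g where "g = gcd u v"
  have "u \<noteq> 0 \<or> v \<noteq> 0" using assms pq by (auto simp: u_v_def)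
  then have g: "g > 0" by (auto simp: g_def)
  obtain s t where st: "s * u + t * v = g" using bezout_int[of u v] g_def by auto
  obtain u' v' where uv: "u = g * u'" "v = g * v'" by (metis dvd_def g_def gcd_dvd1 gcd_dvd2)
  have "g * (s * u' + t * v') = g * 1" using st uv by (simp add: algebra_simps)
  then have one: "s * u' + t * v' = 1" using g by simp
  let ?T = "\<lambda>(x,y). (s * x + t * y + (- s * px - t * py), (- v') * x + u' * y + (v' * px - u' * py))"
  have "lat_aut ?T" by (rule lat_aut2) (use one in \<open>simp add: algebra_simps\<close>)
  moreover have "?T p = (0,0)" by (simp add: pq)
  moreover have "?T q = (g,0)"
  proof -
    have "s * qx + t * qy - s * px - t * py = g" using st by (simp add: u_v_def algebra_simps)
    moreover have "u' * v = v' * u" using uv by simp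
    then have "- v' * qx + u' * qy + v' * px - u' * py = 0" by (simp add: u_v_def algebra_simps)
    ultimately show ?thesis by (simp add: pq algebra_simps)
  qed
  ultimately show thesis using that g by blast
qed

text \<open>A reflection puts a point off the axis above it, \<open>height_one\<close> then gives a point at height one,
  and a shear moves that point to \<open>(0,1)\<close>.\<close>
lemma normalize_apex:
  assumes B: "tri_closed (B :: pt2 set)" "(0,0) \<in> B" "(1,0) \<in> B"
  obtains "B \<subseteq> {(x,y). y = 0}"
    | T where "lat_aut T" "\<And>x. T (x,0) = (x,0)" "(0,1) \<in> T ` B"
proof (cases "B \<subseteq> {(x,y). y = 0}")
  case False
  then obtain x y where xy: "(x,y) \<in> B" "y \<noteq> 0" by auto
  define e where "e = sgn y"
  have e: "e * e = 1" "e * y \<ge> 1" using xy by (auto simp: e_def sgn_if)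
  define R where "R = (\<lambda>(x,y). (1*x + 0*y + 0, 0*x + e*y + 0::int))"
  have R: "lat_aut R" unfolding R_def by (rule lat_aut2) (auto simp: e_def sgn_if xy)
  have "lat_equiv B (R ` B)" using R by (auto simp: lat_equiv_def)
  then have tc: "tri_closed (R ` B)" using B tri_closed_equiv by blast
  have "R (0,0) = (0,0)" "R (1,0) = (1,0)" "R (x,y) = (x, e*y)" by (auto simp: R_def)
  then have "(0,0) \<in> R ` B" "(0+1,0) \<in> R ` B" "(x, e*y) \<in> R ` B" using B xy by force+
  from height_one[OF tc this e(2)] obtain k where k: "(k,1) \<in> R ` B" by blast
  define S where "S = (\<lambda>(x,y). (1*x + (-k)*y + 0, 0*x + 1*y + 0::int))"
  have S: "lat_aut S" unfolding S_def by (rule lat_aut2) simp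
  have "S (k,1) = (0,1)" by (simp add: S_def)
  then have "(0,1) \<in> (S \<circ> R) ` B" using k by (metis image_comp image_eqI)
  moreover have "(S \<circ> R) (x,0) = (x,0)" for x by (simp add: S_def R_def)
  ultimately show thesis using that(2)[of "S \<circ> R"] lat_aut_comp[OF S R] by auto
qed (use that in blast)

lemma planar_normal:
  assumes B: "tri_closed (B :: pt2 set)" "card B \<ge> 2"
  obtains B' where "lat_equiv B B'" "(0,0) \<in> B'" "(1,0) \<in> B'" "B' \<subseteq> {(x,y). y = 0} \<or> (0,1) \<in> B'"
proof -
  obtain p q where pq: "p \<in> B" "q \<in> B" "p \<noteq> q"
  proof -
    have "finite B" using B(2) by (intro card_ge_0_finite) simp
    then show thesis using that B(2) card_le_Suc0_iff_eq[of B] by fastforce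
  qed
  obtain T g where T: "lat_aut T" "T p = (0,0)" "T q = (g,0)" "g > 0" using move_to_axis[OF pq(3)] .
  have eq1: "lat_equiv B (T ` B)" using T by (auto simp: lat_equiv_def)
  then have tc: "tri_closed (T ` B)" using B tri_closed_equiv by blast
  have z: "(0,0) \<in> T ` B" and g: "(g,0) \<in> T ` B" using imageI[OF pq(1), of T] imageI[OF pq(2), of T] T by simp_all
  have o: "(1,0) \<in> T ` B" by (rule segment_closed[OF tc z g]) (use T in auto)
  show thesis
  proof (rule normalize_apex[OF tc z o])
    assume "T ` B \<subseteq> {(x,y). y = 0}" then show thesis by (intro that[OF eq1 z o] disjI1)
  next
    fix S assume S: "lat_aut S" "\<And>x. S (x,0) = (x,0)" "(0,1) \<in> S ` T ` B"
    have eq2: "lat_equiv B (S ` T ` B)"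
      by (rule lat_equiv_trans[OF eq1]) (use S in \<open>auto simp: lat_equiv_def\<close>)
    have "(0,0) \<in> S ` T ` B" "(1,0) \<in> S ` T ` B"
      using imageI[OF z, of S] imageI[OF o, of S] by (simp_all only: S)
    then show thesis using that[OF eq2] S(3) by blast
  qed
qed

lemma axis_set:
  assumes B: "tri_closed (B :: pt2 set)" "finite B" "B \<subseteq> {(x,y). y = 0}" "B \<noteq> {}"
  obtains m where "B = (\<lambda>x. (x,0::int)) ` {m..<m + int (card B)}"
proof -
  define X where "X = fst ` B"
  have BX: "B = (\<lambda>x. (x,0::int)) ` X" using B(3) by (force simp: X_def)
  have fin: "finite X" "X \<noteq> {}" using B by (auto simp: X_def)
  have X: "X = {Min X..Max X}"
  proof
    show "{Min X..Max X} \<subseteq> X"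
    proof
      fix q assume q: "q \<in> {Min X..Max X}"
      have "(q,0) \<in> B"
      proof (rule segment_closed[OF B(1)])
        show "(Min X,0) \<in> B" by (subst BX) (rule imageI[OF Min_in[OF fin]])
        show "(Max X,0) \<in> B" by (subst BX) (rule imageI[OF Max_in[OF fin]])
      qed (use q in simp_all)
      then show "q \<in> X" by (force simp: X_def)
    qed
  qed (use fin in auto)
  have "card B = card X" unfolding BX by (rule card_image) (auto simp: inj_on_def)
  also have "\<dots> = card {Min X..Max X}" using X by simp
  finally have c: "int (card B) = Max X - Min X + 1" using Min_le[OF fin(1) Max_in[OF fin]] by simp
  have "{Min X..Max X} = {Min X..<Min X + int (card B)}" unfolding c by auto
  then have "X = {Min X..<Min X + int (card B)}" using X by (rule trans[rotated])
  then have "B = (\<lambda>x. (x,0::int)) ` {Min X..<Min X + int (card B)}" by (subst BX) (rule arg_cong)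
  then show thesis by (rule that)
qed

abbreviation tri :: "pt2 set" where "tri \<equiv> {(0,0),(1,0),(0,1)}"
abbreviation line3 :: "pt2 set" where "line3 \<equiv> {(-1,0),(0,0),(1,0)}"
abbreviation line4 :: "pt2 set" where "line4 \<equiv> {(0,0),(1,0),(2,0),(3,0)}"
abbreviation sq :: "pt2 set" where "sq \<equiv> {(0,0),(1,0),(0,1),(1,1)}"
abbreviation edge :: "pt2 set" where "edge \<equiv> {(-1,0),(0,0),(1,0),(0,1)}"
abbreviation cen :: "pt2 set" where "cen \<equiv> {(0,0),(1,0),(0,1),(-1,-1)}"

lemma card_rest1: "finite B \<Longrightarrow> card B = Suc (card F) \<Longrightarrow> F \<subseteq> B \<Longrightarrow> \<exists>w. w \<notin> F \<and> B = insert w F"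
proof -
  assume a: "finite B" "card B = Suc (card F)" "F \<subseteq> B"
  then have "card (B - F) = 1" by (simp add: card_Diff_subset finite_subset)
  then obtain w where "B - F = {w}" by (auto simp: card_1_singleton_iff)
  then show ?thesis using a by (intro exI[of _ w]) auto
qed

lemma axis_equiv:
  assumes B: "tri_closed (B :: pt2 set)" "B \<subseteq> {(x,y). y = 0}" "card B = n" "n > 0"
  shows "lat_equiv B ((\<lambda>x. (x,0::int)) ` {a..<a + int n})"
proof -
  have "finite B" using B by (auto intro: card_ge_0_finite)
  moreover have "B \<noteq> {}" using B by auto
  ultimately obtain m where m: "B = (\<lambda>x. (x,0::int)) ` {m..<m + int n}" using axis_set B by metis
  have im: "(\<lambda>x. x + (a - m)) ` {m..<m + int n} = {a..<a + int n}"
    by (simp only: image_add_atLeastLessThan') (simp add: add.commute)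
  have "lat_equiv ((\<lambda>x. (x,0::int)) ` {m..<m + int n}) ((\<lambda>x. (x,0::int)) ` (\<lambda>x. x + (a - m)) ` {m..<m + int n})"
    by (rule lat_equiv2[where a=1 and b=0 and c=0 and d=1 and e="a-m" and f=0])
       (simp, unfold image_image, rule image_cong, auto)
  then show ?thesis by (simp only: im m[symmetric])
qed

lemma axis_segments:
  "(\<lambda>x. (x,0::int)) ` {-1..<-1 + int 3} = line3" "(\<lambda>x. (x,0::int)) ` {0..<0 + int 4} = line4"
proof -
  have "{-1..<-1 + int 3} = {-1,0,1}" "{0..<0 + int 4} = {0,1,2,3}" by auto
  then show "(\<lambda>x. (x,0::int)) ` {-1..<-1 + int 3} = line3" "(\<lambda>x. (x,0::int)) ` {0..<0 + int 4} = line4"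
    by simp_all
qed

lemma planar3:
  assumes B: "tri_closed (B :: pt2 set)" "card B = 3"
  shows "lat_equiv B line3 \<or> lat_equiv B tri"
proof -
  have "card B \<ge> 2" using B(2) by simp
  then obtain B' where B': "lat_equiv B B'" "(0,0) \<in> B'" "(1,0) \<in> B'" "B' \<subseteq> {(x,y). y = 0} \<or> (0,1) \<in> B'"
    by (rule planar_normal[OF B(1)])
  have tc: "tri_closed B'" "card B' = 3" using B B' tri_closed_equiv lat_equiv_card by metis+
  from B'(4) show ?thesis
  proof
    assume "B' \<subseteq> {(x,y). y = 0}"
    then have "lat_equiv B' line3" using axis_equiv[OF tc(1) _ tc(2), of "-1"] unfolding axis_segments by simp
    then show ?thesis using B' lat_equiv_trans by blast
  next
    assume "(0,1) \<in> B'"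
    then have "tri \<subseteq> B'" using B' by auto
    then have "tri = B'" by (intro card_subset_eq) (use tc in \<open>auto intro: card_ge_0_finite\<close>)
    then show ?thesis using B' by auto
  qed
qed

text \<open>A point too far below the base would create a further point at height \<open>-1\<close>; if it is high
  above, the only candidate for the point at height one is \<open>(0,1)\<close>, which restricts \<open>x\<close>.\<close>
lemma barycentric_bound:
  assumes B: "tri_closed (insert (x,y) tri)"
  shows "y \<ge> -1 \<and> (y \<ge> 2 \<longrightarrow> x \<le> 0 \<and> x + y \<ge> 1)"
proof (intro conjI impI)
  have "tri_closed (insert (x,-y) {(0,0),(1,0),(0,-1)})"
    by (rule tri_closed_equiv[OF lat_equiv2[where a=1 and b=0 and c=0 and d="-1" and e=0 and f=0] B]) auto
  from height_one[OF this, of 0 x "-y"] show "y \<ge> -1" by fastforce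
next
  assume y: "y \<ge> 2"
  obtain k where "(k,1) \<in> insert (x,y) tri" "x \<le> 0 + (k - 0) * y" "(k - 0) * y + 0 \<le> x + y - 1"
    using height_one[OF B, of 0 x y] y by auto
  then show "x \<le> 0" "x + y \<ge> 1" using y by auto
qed

text \<open>The fourth point has integer barycentric coordinates \<open>1 - x - y\<close>, \<open>x\<close>, \<open>y\<close> with respect to a
  unimodular triangle.  Applying \<open>barycentric_bound\<close> to the three edges leaves the permutations of
  \<open>(1,1,-1)\<close> (parallelogram), \<open>(2,-1,0)\<close> (point on an edge) and \<open>(3,-1,-1)\<close> (interior point).\<close>
lemma planar4:
  assumes B: "tri_closed (B :: pt2 set)" "card B = 4"
  shows "lat_equiv B line4 \<or> lat_equiv B sq \<or> lat_equiv B edge \<or> lat_equiv B cen"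
proof -
  have "card B \<ge> 2" using B(2) by simp
  then obtain B' where B': "lat_equiv B B'" "(0,0) \<in> B'" "(1,0) \<in> B'" "B' \<subseteq> {(x,y). y = 0} \<or> (0,1) \<in> B'"
    by (rule planar_normal[OF B(1)])
  have tc: "tri_closed B'" "card B' = 4" using B B' tri_closed_equiv lat_equiv_card by metis+
  have "lat_equiv B' line4 \<or> lat_equiv B' sq \<or> lat_equiv B' edge \<or> lat_equiv B' cen"
    using B'(4)
  proof
    assume "B' \<subseteq> {(x,y). y = 0}"
    then show ?thesis using axis_equiv[OF tc(1) _ tc(2), of 0] unfolding axis_segments by simp
  next
    assume "(0,1) \<in> B'"
    then have sub: "tri \<subseteq> B'" using B' by auto
    have "finite B'" "card B' = Suc (card tri)" using tc(2) by (auto intro: card_ge_0_finite)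
    from card_rest1[OF this sub] obtain w where w: "w \<notin> tri" "B' = insert w tri" by (elim exE conjE)
    obtain x y where xy: "w = (x,y)" by force
    have 0: "tri_closed (insert (x,y) tri)" using tc(1) unfolding w(2) xy .
    have 1: "tri_closed (insert (y,x) tri)"
      by (rule tri_closed_equiv[OF lat_equiv2[where a=0 and b=1 and c=1 and d=0 and e=0 and f=0] 0]) auto
    have 2: "tri_closed (insert (x,1-x-y) tri)"
      by (rule tri_closed_equiv[OF lat_equiv2[where a=1 and b=0 and c="-1" and d="-1" and e=0 and f=1] 0]) auto
    have bounds: "y \<ge> -1" "y \<ge> 2 \<longrightarrow> x \<le> 0 \<and> x + y \<ge> 1" "x \<ge> -1" "x \<ge> 2 \<longrightarrow> y \<le> 0 \<and> x + y \<ge> 1"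
       "1-x-y \<ge> -1" "1-x-y \<ge> 2 \<longrightarrow> x \<le> 0 \<and> y \<le> 0"
      using barycentric_bound[OF 0] barycentric_bound[OF 1] barycentric_bound[OF 2] by auto
    have "y \<le> 3" "x \<le> 3" using bounds by linarith+
    then have "x \<in> {-1,0,1,2,3}" "y \<in> {-1,0,1,2,3}" using bounds by auto
    then have "w = (-1,-1) \<or> w = (-1,0) \<or> w = (-1,1) \<or> w = (-1,2) \<or> w = (-1,3) \<or> w = (0,-1) \<or> w = (0,2) \<or> w = (1,-1) \<or> w = (1,1) \<or> w = (2,-1) \<or> w = (2,0) \<or> w = (3,-1)"
      by (elim insertE emptyE; use bounds w(1) in \<open>simp add: xy\<close>)
    then show ?thesis
    proof (elim disjE)
      assume "w = (-1,-1)"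
      then have "lat_equiv B' cen" unfolding w(2)
        by (intro lat_equiv2[where a=0 and b=1 and c=1 and d=0 and e=0 and f=0]) auto
      then show ?thesis by simp
    next
      assume "w = (-1,0)"
      then have "lat_equiv B' edge" unfolding w(2)
        by (intro lat_equiv2[where a="-1" and b=0 and c=0 and d=1 and e=0 and f=0]) auto
      then show ?thesis by simp
    next
      assume "w = (-1,1)"
      then have "lat_equiv B' sq" unfolding w(2)
        by (intro lat_equiv2[where a="-1" and b="-1" and c=0 and d="-1" and e=1 and f=1]) auto
      then show ?thesis by simp
    next
      assume "w = (-1,2)"
      then have "lat_equiv B' edge" unfolding w(2)
        by (intro lat_equiv2[where a="-1" and b=0 and c="-1" and d="-1" and e=0 and f=1]) auto
      then show ?thesis by simp
    next
      assume "w = (-1,3)"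
      then have "lat_equiv B' cen" unfolding w(2)
        by (intro lat_equiv2[where a="-1" and b="-1" and c=1 and d=0 and e=1 and f=0]) auto
      then show ?thesis by simp
    next
      assume "w = (0,-1)"
      then have "lat_equiv B' edge" unfolding w(2)
        by (intro lat_equiv2[where a=0 and b="-1" and c=1 and d=0 and e=0 and f=0]) auto
      then show ?thesis by simp
    next
      assume "w = (0,2)"
      then have "lat_equiv B' edge" unfolding w(2)
        by (intro lat_equiv2[where a="-1" and b="-1" and c=1 and d=0 and e=1 and f=0]) auto
      then show ?thesis by simp
    next
      assume "w = (1,-1)"
      then have "lat_equiv B' sq" unfolding w(2)
        by (intro lat_equiv2[where a="-1" and b="-1" and c="-1" and d=0 and e=1 and f=1]) auto
      then show ?thesis by simp
    next
      assume "w = (1,1)"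
      then have "lat_equiv B' sq" unfolding w(2)
        by (intro lat_equiv2[where a="-1" and b=0 and c=0 and d="-1" and e=1 and f=1]) auto
      then show ?thesis by simp
    next
      assume "w = (2,-1)"
      then have "lat_equiv B' edge" unfolding w(2)
        by (intro lat_equiv2[where a=0 and b="-1" and c="-1" and d="-1" and e=0 and f=1]) auto
      then show ?thesis by simp
    next
      assume "w = (2,0)"
      then have "lat_equiv B' edge" unfolding w(2)
        by (intro lat_equiv2[where a="-1" and b="-1" and c=0 and d=1 and e=1 and f=0]) auto
      then show ?thesis by simp
    next
      assume "w = (3,-1)"
      then have "lat_equiv B' cen" unfolding w(2)
        by (intro lat_equiv2[where a="-1" and b="-1" and c=0 and d=1 and e=1 and f=0]) auto
      then show ?thesis by simp
    qed
  qed
  then show ?thesis using B'(1) lat_equiv_trans by blast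
qed

text \<open>Among five points two agree modulo two, so their midpoint belongs to the set.  With three
  consecutive points on the axis and \<open>(0,1)\<close> given, only the position of the fifth point is open.\<close>
lemma planar5:
  assumes B: "tri_closed (B :: pt2 set)" "card B = 5"
  obtains B' where "lat_equiv B B'" "B' \<subseteq> {(x,y). y = 0}"
    | w where "w \<in> {(2,0),(1,1),(0,-1),(1,-1),(2,-1),(3,-1)}" "lat_equiv B (insert w edge)"
proof -
  define par where "par = (\<lambda>(x,y). (x mod 2, y mod (2::int)) :: pt2)"
  have "par ` B \<subseteq> {0,1} \<times> {0,1}" by (auto simp: par_def)
  then have "card (par ` B) \<le> card ({0,1} \<times> {0,1} :: pt2 set)" by (intro card_mono) auto
  also have "\<dots> = 4" by (simp add: card_cartesian_product)
  finally have "\<not> inj_on par B" using B(2) by (auto dest!: card_image)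
  then obtain a b where ab: "a \<in> B" "b \<in> B" "a \<noteq> b" "par a = par b" by (auto simp: inj_on_def)
  define m where "m = ((fst a + fst b) div 2, (snd a + snd b) div 2)"
  have m: "m + m - a = b"
  proof -
    have "(fst a + fst b) mod 2 = 0" "(snd a + snd b) mod 2 = 0"
      using ab(4) by (auto simp: par_def split: prod.splits) presburger+
    then have "2 * ((fst a + fst b) div 2) = fst a + fst b" "2 * ((snd a + snd b) div 2) = snd a + snd b" by auto
    then show ?thesis by (simp add: m_def prod_eq_iff)
  qed
  obtain T g where T: "lat_aut T" "T a = (0,0)" "T b = (g,0)" "g > 0" using move_to_axis[OF ab(3)] .
  have "T b = T m + T m - T a" using T(1) m unfolding lat_aut_def by metis
  then have "g = 2 * fst (T m)" using T by (simp add: prod_eq_iff)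
  then have g: "g \<ge> 2" using T(4) by presburger
  define S where "S = (\<lambda>(x,y). (1*x + 0*y + (-1), 0*x + 1*y + 0::int))"
  have S: "lat_aut S" unfolding S_def by (rule lat_aut2) simp
  define B1 where "B1 = (S \<circ> T) ` B"
  have B1: "lat_equiv B B1" unfolding B1_def lat_equiv_def using lat_aut_comp[OF S T(1)] by blast
  then have tc1: "tri_closed B1" using B tri_closed_equiv by blast
  have l: "(-1,0) \<in> B1" using imageI[OF ab(1), of "S \<circ> T"] T by (simp add: B1_def S_def)
  have r: "(g-1,0) \<in> B1" using imageI[OF ab(2), of "S \<circ> T"] T by (simp add: B1_def S_def)
  have z: "(0,0) \<in> B1" and o: "(1,0) \<in> B1" by (rule segment_closed[OF tc1 l r]; use g in simp)+
  show thesis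
  proof (rule normalize_apex[OF tc1 z o])
    assume "B1 \<subseteq> {(x,y). y = 0}" then show thesis by (rule that(1)[OF B1])
  next
    fix R assume R: "lat_aut R" "\<And>x. R (x,0) = (x,0)" "(0,1) \<in> R ` B1"
    define B' where "B' = R ` B1"
    have "lat_equiv B1 B'" using R by (auto simp: lat_equiv_def B'_def)
    then have B': "lat_equiv B B'" using B1 lat_equiv_trans by blast
    have tc: "tri_closed B'" "card B' = 5" using B B' tri_closed_equiv lat_equiv_card by metis+
    have sub: "edge \<subseteq> B'" using imageI[OF l, of R] imageI[OF z, of R] imageI[OF o, of R] R by (simp add: B'_def)
    have "finite B'" "card B' = Suc (card edge)" using tc(2) by (auto intro: card_ge_0_finite)
    from card_rest1[OF this sub] obtain w where w: "w \<notin> edge" "B' = insert w edge" by (elim exE conjE)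
    obtain x y where xy: "w = (x,y)" by force
    have cl: "tri_closed (insert (x,y) edge)" using tc(1) unfolding w(2) xy .
    have cl': "tri_closed (insert (x,-y) {(-1,0),(0,0),(1,0),(0,-1)})"
      by (rule tri_closed_equiv[OF lat_equiv2[where a=1 and b=0 and c=0 and d="-1" and e=0 and f=0] cl]) auto
    have "y \<ge> -1" using height_one[OF cl', of 0 x "-y"] by fastforce
    then consider "y = -1" | "y = 0" | "y = 1" | "y \<ge> 2" by linarith
    then have "(x,y) \<in> {(2,0),(-2,0),(1,1),(-1,1),(0,2),(-3,-1),(-2,-1),(-1,-1),(0,-1),(1,-1),(2,-1),(3,-1)}"
    proof cases
      case 1
      have "x \<le> 3"
      proof (rule ccontr)
        assume "\<not> x \<le> 3"
        then have "(2,0) \<in> insert (x,y) edge" using 1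
          by - (rule tri_closedD[OF cl, of 0 1 x y 1 0 1 1 "x - 4"], auto)
        then show False using 1 by simp
      qed
      moreover have "-3 \<le> x"
      proof (rule ccontr)
        assume "\<not> -3 \<le> x"
        then have "(-2,0) \<in> insert (x,y) edge" using 1
          by - (rule tri_closedD[OF cl, of 0 1 x y "-1" 0 1 1 "-x - 4"], auto)
        then show False using 1 by simp
      qed
      ultimately have "x \<in> {-3,-2,-1,0,1,2,3}" by auto
      then show ?thesis using 1 by auto
    next
      case 2
      have "x \<le> 2"
      proof (rule ccontr)
        assume "\<not> x \<le> 2"
        then have "(2,0) \<in> insert (x,y) edge" using 2 by - (rule segment_closed[OF cl, of 0 x], auto)
        then show False using \<open>\<not> x \<le> 2\<close> by simp
      qed
      moreover have "-2 \<le> x"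
      proof (rule ccontr)
        assume "\<not> -2 \<le> x"
        then have "(-2,0) \<in> insert (x,y) edge" using 2 by - (rule segment_closed[OF cl, of x 0], auto)
        then show False using \<open>\<not> -2 \<le> x\<close> by simp
      qed
      ultimately have "x \<in> {-2,-1,0,1,2}" by auto
      then show ?thesis using 2 w(1) xy by auto
    next
      case 3
      have "x \<le> 1"
      proof (rule ccontr)
        assume "\<not> x \<le> 1"
        then have "(1,1) \<in> insert (x,y) edge" using 3
          by - (rule tri_closedD[OF cl, of 0 1 x y x y "x - 1" 1 0], auto)
        then show False using \<open>\<not> x \<le> 1\<close> by simp
      qed
      moreover have "-1 \<le> x"
      proof (rule ccontr)
        assume "\<not> -1 \<le> x"
        then have "(-1,1) \<in> insert (x,y) edge" using 3
          by - (rule tri_closedD[OF cl, of 0 1 x y x y "- x - 1" 1 0], auto)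
        then show False using \<open>\<not> -1 \<le> x\<close> by simp
      qed
      ultimately have "x \<in> {-1,0,1}" by auto
      then show ?thesis using 3 w(1) xy by auto
    next
      case 4
      obtain k where k: "(k,1) \<in> insert (x,y) edge" "x \<le> 0 + (k - 0) * y"
        using height_one[OF cl, of 0 x y] 4 by auto
      obtain j where j: "(j,1) \<in> insert (x,y) edge" "(j - (-1)) * y + (-1) \<le> x + y - 1"
        using height_one[OF cl, of "-1" x y] 4 by auto
      have x: "x = 0" using k j 4 by auto
      have "y \<le> 2"
      proof (rule ccontr)
        assume "\<not> y \<le> 2"
        then have "(0,2) \<in> insert (x,y) edge" using x
          by - (rule tri_closedD[OF cl, of 0 1 x y x y "y - 2" 1 0], auto)
        then show False using \<open>\<not> y \<le> 2\<close> by simp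
      qed
      then show ?thesis using x 4 by simp
    qed
    then consider "(x,y) \<in> {(2,0),(1,1),(0,-1),(1,-1),(2,-1),(3,-1)}" | "x = 0" "y = 2"
        | "(-x,y) \<in> {(2,0),(1,1),(0,-1),(1,-1),(2,-1),(3,-1)}"
      by (elim insertE emptyE) simp_all
    moreover have eqw: "lat_equiv B (insert (x,y) edge)" using B' unfolding w(2) xy .
    ultimately show thesis
    proof cases
      case 1
      then show thesis by (rule that(2)[OF _ eqw])
    next
      case 2
      have "lat_equiv (insert (0,2) edge) (insert (2,-1) edge)"
        by (rule lat_equiv2[where a="-1" and b="-1" and c=1 and d=0 and e=1 and f=0]) auto
      then have "lat_equiv B (insert (2,-1) edge)" using eqw unfolding 2 by (rule lat_equiv_trans[rotated])
      then show thesis by (rule that(2)[rotated]) simp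
    next
      case 3
      have "lat_equiv (insert (x,y) edge) (insert (-x,y) edge)"
        by (rule lat_equiv2[where a="-1" and b=0 and c=0 and d=1 and e=0 and f=0]) auto
      then have "lat_equiv B (insert (-x,y) edge)" by (rule lat_equiv_trans[OF eqw])
      then show thesis by (rule that(2)[OF 3])
    qed
  qed
qed

section \<open>Point sets of width one, up to equivalence or up to signs\<close>

lemma additive_int: "(\<And>x y. g (x + y) = g x + g y) \<Longrightarrow> g (x::int) = x * (g 1 :: int)"
proof -
  assume a: "\<And>x y. g (x + y) = g x + g y"
  have "g 0 = 0" using a[of 0 0] by simp
  moreover have "g (- 1) = - g 1" using a[of "-1" 1] \<open>g 0 = 0\<close> by simp
  ultimately show ?thesis
    by (induction x rule: int_induct[where k = 0]) (simp_all add: a a[of _ "-1", simplified] algebra_simps)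
qed

lemma lat_aut2_form:
  assumes "lat_aut (T :: pt2 \<Rightarrow> pt2)"
  obtains a b c d e f where "T = (\<lambda>(x,y). (a*x + b*y + e, c*x + d*y + f))"
proof -
  define f where "f u = T u - T 0" for u
  have add: "f (u + v) = f u + f v" for u v using lat_aut_add[OF assms, of u v] by (simp add: f_def)
  have 1: "fst (f (x,0)) = x * fst (f (1,0))" "snd (f (x,0)) = x * snd (f (1,0))" for x
    by (rule additive_int[where g = "\<lambda>x. fst (f (x,0))"] additive_int[where g = "\<lambda>x. snd (f (x,0))"],
        subst fst_add[symmetric] snd_add[symmetric], subst add[symmetric], simp)+
  have 2: "fst (f (0,y)) = y * fst (f (0,1))" "snd (f (0,y)) = y * snd (f (0,1))" for y
    by (rule additive_int[where g = "\<lambda>x. fst (f (0,x))"] additive_int[where g = "\<lambda>x. snd (f (0,x))"],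
        subst fst_add[symmetric] snd_add[symmetric], subst add[symmetric], simp)+
  have "T (x,y) = f (x,0) + f (0,y) + T 0" for x y
    unfolding add[symmetric] by (simp add: f_def)
  then have "T (x,y) = (fst (f (1,0)) * x + fst (f (0,1)) * y + fst (T 0), snd (f (1,0)) * x + snd (f (0,1)) * y + snd (T 0))" for x y
    by (simp add: prod_eq_iff 1[of x] 2[of y] mult.commute)
  then show thesis by (intro that) (auto simp: fun_eq_iff)
qed

lemma lat_aut2_det:
  assumes "lat_aut (\<lambda>(x,y). (a*x + b*y + e, c*x + d*y + f) :: pt2)"
  shows "a*d - b*c = 1 \<or> a*d - b*c = (-1)"
proof -
  let ?T = "\<lambda>(x,y). (a*x + b*y + e, c*x + d*y + f) :: pt2"
  have "surj ?T" using assms by (auto simp: lat_aut_def bij_def)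
  obtain u where u: "(1+e,f) = ?T u" using \<open>surj ?T\<close> by (rule surjE)
  obtain v where v: "(e,1+f) = ?T v" using \<open>surj ?T\<close> by (rule surjE)
  obtain x y x' y' where "u = (x,y)" "v = (x',y')" by (metis surj_pair)
  then have "a*x + b*y = 1" "c*x + d*y = 0" "a*x' + b*y' = 0" "c*x' + d*y' = 1" using u v by auto
  then have "(a*d - b*c) * (x*y' - y*x') = 1" by algebra
  then show ?thesis by (metis zmult_eq_1_iff)
qed

definition stack :: "pt2 set \<Rightarrow> pt2 set \<Rightarrow> pt3 set" where
  "stack B C = (\<lambda>(x,y). (x,y,0)) ` B \<union> (\<lambda>(x,y). (x,y,1)) ` C"

lemma stack_insert:
  "stack (insert (x,y) B) C = insert (x,y,0) (stack B C)"
  "stack {} (insert (x,y) C) = insert (x,y,1) (stack {} C)"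
  "stack {} {} = {}"
  by (auto simp: stack_def)

lemma lat_equiv3:
  assumes "det3 a b c d e f g h i = 1 \<or> det3 a b c d e f g h i = -1"
    "(\<lambda>(x,y,z). (a*x + b*y + c*z + r, d*x + e*y + f*z + s, g*x + h*y + i*z + t)) ` A = A'"
  shows "lat_equiv A A'"
  using lat_aut3[OF assms(1)] assms(2) by (auto simp: lat_equiv_def)

text \<open>A map of the plane acts on both levels, and a shear along the third direction makes the two
  translation parts independent of each other.\<close>
lemma stack_equiv:
  assumes det: "a*d - b*c = 1 \<or> a*d - b*c = (-1)"
    and B: "(\<lambda>(x,y). (a*x + b*y + e, c*x + d*y + f)) ` B = B'"
    and C: "(\<lambda>(x,y). (a*x + b*y + e', c*x + d*y + f')) ` C = C'"
  shows "lat_equiv (stack B C) (stack B' C')"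
proof (rule lat_equiv3)
  show "det3 a b (e'-e) c d (f'-f) 0 0 1 = 1 \<or> det3 a b (e'-e) c d (f'-f) 0 0 1 = -1"
    using det by (simp add: det3_def)
  show "(\<lambda>(x,y,z). (a*x + b*y + (e'-e)*z + e, c*x + d*y + (f'-f)*z + f, 0*x + 0*y + 1*z + 0)) ` stack B C = stack B' C'"
    unfolding stack_def B[symmetric] C[symmetric]
    by (simp add: image_Un image_image case_prod_unfold algebra_simps)
qed

lemma stack_swap: "lat_equiv (stack B C) (stack C B)"
proof (rule lat_equiv3)
  show "det3 1 0 0 0 1 0 0 0 (-1) = 1 \<or> det3 1 0 0 0 1 0 0 0 (-1) = -1"
    by (simp add: det3_def)
  show "(\<lambda>(x,y,z). (1*x + 0*y + 0*z + 0, 0*x + 1*y + 0*z + 0, 0*x + 0*y + (-1)*z + 1)) ` stack B C = stack C B"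
    unfolding stack_def by (auto simp: image_Un image_image case_prod_unfold)
qed

lemma stack_normalize:
  assumes "lat_equiv B B'"
  obtains C' where "lat_equiv (stack B C) (stack B' C')" "lat_equiv C C'"
proof -
  obtain T where T: "lat_aut T" "T ` B = B'" using assms by (auto simp: lat_equiv_def)
  obtain a b c d e f where form: "T = (\<lambda>(x,y). (a*x + b*y + e, c*x + d*y + f))" using lat_aut2_form[OF T(1)] .
  have "a*d - b*c = 1 \<or> a*d - b*c = (-1)" using lat_aut2_det T(1) form by simp
  then have "lat_equiv (stack B C) (stack B' (T ` C))"
    by (rule stack_equiv) (use T form in simp_all)
  moreover have "lat_equiv C (T ` C)" using T by (auto simp: lat_equiv_def)
  ultimately show thesis using that by blast
qed

definition stackl :: "pt2 list \<Rightarrow> pt2 list \<Rightarrow> pt3 list" where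
  "stackl bs cs = map (\<lambda>(x,y). (x,y,0)) bs @ map (\<lambda>(x,y). (x,y,1)) cs"

lemma length_stackl [simp]: "length (stackl bs cs) = length bs + length cs"
  by (simp add: stackl_def)

lemma set_stackl: "set (stackl bs cs) = stack (set bs) (set cs)"
  by (auto simp: stackl_def stack_def)

text \<open>The signs of the fifteen increasing quadruples; by antisymmetry they determine all the others.\<close>
fun signs :: "pt3 list \<Rightarrow> int list" where
  "signs [a,b,c,d,e,f] = map sgn
     [det4 a b c d, det4 a b c e, det4 a b c f, det4 a b d e, det4 a b d f,
      det4 a b e f, det4 a c d e, det4 a c d f, det4 a c e f, det4 a d e f,
      det4 b c d e, det4 b c d f, det4 b c e f, det4 b d e f, det4 c d e f]"
| "signs _ = []"

definition finite_types :: "pt3 list list" where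
  "finite_types =
    [stackl [(-1,0),(0,0),(1,0),(0,1),(1,1)] [(0,0)],
     stackl [(-1,0),(0,0),(1,0),(0,1),(0,-1)] [(0,0)],
     stackl [(-1,0),(0,0),(1,0),(0,1),(1,-1)] [(0,0)],
     stackl [(-1,0),(0,0),(1,0),(0,1),(2,-1)] [(0,0)],
     stackl [(-1,0),(0,0),(1,0),(0,1),(3,-1)] [(0,0)],
     stackl [(0,0),(1,0),(0,1),(1,1)] [(0,0),(1,0)],
     stackl [(0,0),(1,0),(0,1),(1,1)] [(0,0),(1,1)],
     stackl [(-1,0),(0,0),(1,0),(0,1)] [(0,0),(1,1)],
     stackl [(-1,0),(0,0),(1,0),(0,1)] [(0,0),(0,1)],
     stackl [(0,0),(1,0),(0,1),(-1,-1)] [(0,0),(1,0)],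
     stackl [(0,0),(1,0),(0,1),(-1,-1)] [(0,0),(2,1)],
     stackl [(0,0),(1,0),(0,1)] [(0,0),(1,0),(1,-1)]]"

definition infinite_types :: "pt3 list list" where
  "infinite_types =
    [stackl [(0,0),(1,0),(2,0),(3,0)] [(0,0),(0,1)],
     stackl [(-1,0),(0,0),(1,0)] [(0,-1),(0,0),(0,1)],
     stackl [(0,0),(1,0),(0,1)] [(0,0),(2,1),(3,2)],
     stackl [(0,0),(1,0),(0,1),(1,1)] [(0,0),(2,1)],
     stackl [(-1,0),(0,0),(1,0),(0,1)] [(0,0),(1,2)],
     stackl [(-1,0),(0,0),(1,0),(0,1)] [(0,0),(2,1)],
     stackl [(0,0),(1,0),(0,1),(-1,-1)] [(0,0),(3,1)],
     stackl [(0,0),(1,0),(0,1)] [(0,0),(1,0),(3,-1)]]"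

text \<open>For the twelve rigid types the set itself is pinned down, for the others only the signs of a
  suitable ordering of an equivalent set.\<close>
definition classified :: "pt3 set \<Rightarrow> bool" where
  "classified A \<longleftrightarrow> (\<exists>L\<in>set finite_types. lat_equiv A (set L)) \<or>
     (\<exists>L\<in>set infinite_types. \<exists>L'. length L' = 6 \<and> lat_equiv A (set L') \<and> signs L' = signs L)"

lemma classified_equiv: "lat_equiv A A' \<Longrightarrow> classified A' \<Longrightarrow> classified A"
  unfolding classified_def by (meson lat_equiv_trans)

lemma length_types: "length finite_types = 12" "length infinite_types = 8"
  by (simp_all add: finite_types_def infinite_types_def)

lemma classified_finite: "i < 12 \<Longrightarrow> A = set (finite_types ! i) \<Longrightarrow> classified A"
  unfolding classified_def
  by (rule disjI1, rule bexI[of _ "finite_types ! i"]) (simp_all add: lat_equiv_refl length_types)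

lemma classified_infinite:
  assumes "i < 8" "A = set L" "length L = 6" "signs L = signs (infinite_types ! i)" shows "classified A"
  unfolding classified_def
  by (rule disjI2, rule bexI[of _ "infinite_types ! i"], rule exI[of _ L])
     (use assms in \<open>simp_all add: lat_equiv_refl length_types\<close>)

lemma classified_stack_map:
  assumes "classified (stack B' C')" "a*d - b*c = 1 \<or> a*d - b*c = (-1)"
    "(\<lambda>(x,y). (a*x + b*y + e, c*x + d*y + f)) ` B = B'"
    "(\<lambda>(x,y). (a*x + b*y + e', c*x + d*y + f')) ` C = C'"
  shows "classified (stack B C)"
  using classified_equiv[OF stack_equiv[OF assms(2-4)] assms(1)] .

definition seg :: "int \<Rightarrow> int \<Rightarrow> pt2 set" where "seg p q = {(0,0),(p,q)}"

lemma seg_neg: "classified (stack B (seg (-p) (-q))) \<Longrightarrow> classified (stack B (seg p q))"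
  by (rule classified_stack_map[where a=1 and b=0 and c=0 and d=1 and e=0 and f=0 and e'="-p" and f'="-q"])
     (auto simp: seg_def insert_commute)

lemma seg_map:
  assumes "classified (stack B (seg (a*p + b*q) (c*p + d*q)))" "a*d - b*c = 1 \<or> a*d - b*c = (-1)"
    "(\<lambda>(x,y). (a*x + b*y + e, c*x + d*y + f)) ` B = B"
  shows "classified (stack B (seg p q))"
  by (rule classified_stack_map[OF assms, where e'=0 and f'=0]) (auto simp: seg_def)

lemmas type_defs = finite_types_def infinite_types_def stackl_def
lemmas sign_simps = stackl_def det3_def sgn_if

text \<open>The symmetries of the square reduce the direction to \<open>0 \<le> q \<le> p\<close>; primitivity makes the two
  boundary rays single points.\<close>
lemma classified_sq:
  assumes "coprime p q" shows "classified (stack sq (seg p q))"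
proof -
  have main: "classified (stack sq (seg p q))" if "coprime p q" "0 \<le> q" "q \<le> p" for p q
  proof -
    have "q = 0 \<Longrightarrow> p = 1" "q = p \<Longrightarrow> p = 1" using that by auto
    moreover have "q = 0 \<or> q = p \<or> 0 < q \<and> q < p" using that by linarith
    ultimately consider "p = 1" "q = 0" | "p = 1" "q = 1" | "0 < q" "q < p" by metis
    then show ?thesis
    proof cases
      case 1 then show ?thesis by (intro classified_finite[of 5]) (simp_all add: type_defs seg_def stack_insert)
    next
      case 2 then show ?thesis by (intro classified_finite[of 6]) (simp_all add: type_defs seg_def stack_insert)
    next
      case 3 then show ?thesis
        by (intro classified_infinite[of 3
              _ "stackl [(0,0),(1,0),(0,1),(1,1)] [(0,0),(p,q)]"])
           (simp_all add: infinite_types_def set_stackl seg_def, simp add: sign_simps)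
    qed
  qed
  have nonneg: "classified (stack sq (seg p q))" if "coprime p q" "0 \<le> p" "0 \<le> q" for p q
  proof (cases "q \<le> p")
    case False
    show ?thesis
      by (rule seg_map[where a=0 and b=1 and c=1 and d=0 and e=0 and f=0])
         (use main[of q p] that False in \<open>auto simp: coprime_commute\<close>)
  qed (use that main in auto)
  have qnonneg: "classified (stack sq (seg p q))" if "coprime p q" "0 \<le> q" for p q
  proof (cases "0 \<le> p")
    case False
    show ?thesis
      by (rule seg_map[where a="-1" and b=0 and c=0 and d=1 and e=1 and f=0])
         (use nonneg[of "-p" q] that False in auto)
  qed (use that nonneg in auto)
  show ?thesis
  proof (cases "0 \<le> q")
    case False
    show ?thesis by (rule seg_neg) (use qnonneg[of "-p" "-q"] assms False in auto)
  qed (use assms qnonneg in auto)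
qed

text \<open>The base has only one reflection, so both sides of the diagonal survive as separate types.
  The direction of the long edge gives a pyramid over a trapezoid in another coordinate system.\<close>
lemma classified_edge:
  assumes "coprime p q" shows "classified (stack edge (seg p q))"
proof -
  have nonneg: "classified (stack edge (seg p q))" if "coprime p q" "0 \<le> p" "0 \<le> q" for p q
  proof -
    have "q = 0 \<Longrightarrow> p = 1" "p = 0 \<Longrightarrow> q = 1" "q = p \<Longrightarrow> p = 1" using that by auto
    moreover have "q = 0 \<or> p = 0 \<or> q = p \<or> 0 < q \<and> q < p \<or> 0 < p \<and> p < q" using that by linarith
    ultimately consider "p = 1" "q = 0" | "p = 0" "q = 1" | "p = 1" "q = 1" | "0 < q" "q < p" | "0 < p" "p < q"
      by metis
    then show ?thesis
    proof cases
      case 1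
      have "lat_equiv (stack edge (seg p q)) (set (finite_types ! 0))"
        by (rule lat_equiv3[where a=1 and b=0 and c=0 and d=0 and e=0 and f=1 and g=0 and h=1 and i=0 and r=0 and s=0 and t=0])
           (use 1 in \<open>auto simp: type_defs seg_def stack_insert det3_def\<close>)
      moreover have "classified (set (finite_types ! 0))" by (rule classified_finite[of 0]) simp_all
      ultimately show ?thesis by (rule classified_equiv)
    next
      case 2 then show ?thesis by (intro classified_finite[of 8]) (simp_all add: type_defs seg_def stack_insert)
    next
      case 3 then show ?thesis by (intro classified_finite[of 7]) (simp_all add: type_defs seg_def stack_insert)
    next
      case 4 then show ?thesis
        by (intro classified_infinite[of 5
              _ "stackl [(-1,0),(0,0),(1,0),(0,1)] [(0,0),(p,q)]"])
           (simp_all add: infinite_types_def set_stackl seg_def, simp add: sign_simps)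
    next
      case 5 then show ?thesis
        by (intro classified_infinite[of 4
              _ "stackl [(-1,0),(0,0),(1,0),(0,1)] [(0,0),(p,q)]"])
           (simp_all add: infinite_types_def set_stackl seg_def, simp add: sign_simps)
    qed
  qed
  have qnonneg: "classified (stack edge (seg p q))" if "coprime p q" "0 \<le> q" for p q
  proof (cases "0 \<le> p")
    case False
    show ?thesis
      by (rule seg_map[where a="-1" and b=0 and c=0 and d=1 and e=0 and f=0])
         (use nonneg[of "-p" q] that False in auto)
  qed (use that nonneg in auto)
  show ?thesis
  proof (cases "0 \<le> q")
    case False
    show ?thesis by (rule seg_neg) (use qnonneg[of "-p" "-q"] assms False in auto)
  qed (use assms qnonneg in auto)
qed

text \<open>The base is the orbit of a vertex under a group of order six together with its fixed point.  With
  the exchange of the two upper points this leaves one open sector, bounded by a vertex direction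
  and an edge direction.\<close>
lemma classified_cen:
  assumes "coprime p q" shows "classified (stack cen (seg p q))"
proof -
  define Q where "Q p q = classified (stack cen (seg p q))" for p q
  have rot: "Q (-q) (p-q) \<Longrightarrow> Q p q" for p q
    unfolding Q_def by (rule seg_map[where a=0 and b="-1" and c=1 and d="-1" and e=0 and f=0]) auto
  have swap: "Q q p \<Longrightarrow> Q p q" for p q
    unfolding Q_def by (rule seg_map[where a=0 and b=1 and c=1 and d=0 and e=0 and f=0]) auto
  have neg: "Q (-p) (-q) \<Longrightarrow> Q p q" for p q
    unfolding Q_def by (rule seg_neg)
  have base: "Q 1 0" unfolding Q_def
    by (rule classified_finite[of 9]) (simp_all add: type_defs seg_def stack_insert)
  have generic: "Q p q" if "0 < q" "2 * q < p" for p q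
    unfolding Q_def using that
    by (intro classified_infinite[of 6 _ "stackl [(0,0),(1,0),(0,1),(-1,-1)] [(0,0),(p,q)]"])
       (simp_all add: infinite_types_def set_stackl seg_def, simp add: sign_simps)
  have sorted: "Q p q" if "coprime p q" "0 \<le> q" "q \<le> p" for p q
  proof -
    have "q = 0 \<Longrightarrow> p = 1" "q = p \<Longrightarrow> p = 1" using that by auto
    moreover have "p = 2 * q \<Longrightarrow> q = 1" using that by auto
    moreover have "q = 0 \<or> q = p \<or> p = 2 * q \<or> 0 < q \<and> 2 * q < p \<or> 0 < p - q \<and> 2 * (p - q) < p"
      using that by presburger
    ultimately consider "p = 1" "q = 0" | "p = 1" "q = 1" | "p = 2" "q = 1" | "0 < q" "2 * q < p"
      | "0 < p - q" "2 * (p - q) < p" by fastforce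
    then show ?thesis
    proof cases
      case 1 then show ?thesis using base by simp
    next
      case 2 show ?thesis by (rule neg, rule rot) (use base 2 in simp)
    next
      case 3 then show ?thesis unfolding Q_def
        by (intro classified_finite[of 10]) (simp_all add: type_defs seg_def stack_insert)
    next
      case 4 then show ?thesis by (rule generic)
    next
      case 5
      show ?thesis by (rule neg, rule rot, rule swap, rule rot, rule rot) (use generic[OF 5] in simp)
    qed
  qed
  \<comment> \<open>The direction is the triple \<open>(p, q, 0)\<close> modulo \<open>(1, 1, 1)\<close>, and the symmetries permute it.\<close>
  have min2: "Q p q" if "coprime p q" "0 \<le> p" "0 \<le> q" for p q
    using sorted[of p q] swap[OF sorted[of q p]] that by (cases "q \<le> p") (auto simp: coprime_commute)
  have cop: "coprime (-q) (p-q)" if "coprime p q" for p q :: int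
  proof (rule coprimeI)
    fix k assume "k dvd -q" "k dvd p - q"
    then have "k dvd q" "k dvd p" using dvd_add[of k "p - q" q] by auto
    then show "is_unit k" using coprime_common_divisor[OF that] by blast
  qed
  have "p \<ge> 0 \<and> q \<ge> 0 \<or> -q \<ge> 0 \<and> p - q \<ge> 0 \<or> q - p \<ge> 0 \<and> - p \<ge> 0" by linarith
  then have "Q p q"
  proof (elim disjE conjE)
    assume "p \<ge> 0" "q \<ge> 0" then show ?thesis using min2 assms by blast
  next
    assume "-q \<ge> 0" "p - q \<ge> 0" then have "Q (-q) (p-q)" by (intro min2 cop assms)
    then show ?thesis by (rule rot)
  next
    assume "q - p \<ge> 0" "- p \<ge> 0"
    then have "Q (- (p - q)) (- q - (p - q))" by (intro min2 cop assms) simp_all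
    then show ?thesis by (rule rot[OF rot])
  qed
  then show ?thesis by (simp add: Q_def)
qed

lemma classified_line4:
  assumes "q \<noteq> 0" shows "classified (stack line4 (seg p q))"
proof -
  have pos: "classified (stack line4 (seg p q))" if "q > 0" for p q
    using that by (intro classified_infinite[of 0 _ "stackl [(0,0),(1,0),(2,0),(3,0)] [(0,0),(p,q)]"])
       (simp_all add: infinite_types_def set_stackl seg_def, simp add: sign_simps)
  show ?thesis
  proof (cases "q > 0")
    case False
    show ?thesis by (rule seg_neg, rule pos) (use assms False in simp)
  qed (rule pos)
qed

definition seg3 :: "int \<Rightarrow> int \<Rightarrow> pt2 set" where "seg3 p q = {(-p,-q),(0,0),(p,q)}"

lemma seg3_neg: "seg3 (-p) (-q) = seg3 p q" by (auto simp: seg3_def)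

lemma seg3_map:
  assumes "classified (stack B (seg3 (a*p + b*q) (c*p + d*q)))" "a*d - b*c = 1 \<or> a*d - b*c = (-1)"
    "(\<lambda>(x,y). (a*x + b*y + e, c*x + d*y + f)) ` B = B"
  shows "classified (stack B (seg3 p q))"
  by (rule classified_stack_map[OF assms, where e'=0 and f'=0]) (auto simp: seg3_def)

lemma classified_line3_line3:
  assumes "q \<noteq> 0" shows "classified (stack line3 (seg3 p q))"
proof -
  have pos: "classified (stack line3 (seg3 p q))" if "q > 0" for p q
    using that by (intro classified_infinite[of 1 _ "stackl [(-1,0),(0,0),(1,0)] [(-p,-q),(0,0),(p,q)]"])
       (simp_all add: infinite_types_def set_stackl seg3_def, simp add: sign_simps algebra_simps)
  show ?thesis
  proof (cases "q > 0")
    case False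
    show ?thesis by (subst seg3_neg[symmetric], rule pos) (use assms False in simp)
  qed (rule pos)
qed

lemma tri_rotation:
  "(\<lambda>(x,y). ((-1)*x + (-1)*y + 1, 1*x + 0*y + 0::int)) ` tri = tri"
  by auto

text \<open>In a generic direction the signs are those of a segment above a triangle with a point on an
  edge: the three collinear upper points play the part of that edge, and listing all points in
  reverse makes the signs agree.\<close>
lemma classified_tri_line3:
  assumes "coprime p q" shows "classified (stack tri (seg3 p q))"
proof -
  define Q where "Q p q = classified (stack tri (seg3 p q))" for p q
  have rot: "Q (-p-q) p \<Longrightarrow> Q p q" for p q
    unfolding Q_def by (rule seg3_map[OF _ _ tri_rotation]) simp_all
  have neg: "Q (-p) (-q) \<Longrightarrow> Q p q" for p q
    unfolding Q_def by (simp only: seg3_neg)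
  have base: "Q 1 0"
  proof -
    have "lat_equiv (stack tri (seg3 1 0)) (set (finite_types ! 0))"
      by (rule lat_equiv3[where a=1 and b=0 and c=0 and d=0 and e="-1" and f="-1" and g=0 and h=1 and i=0 and r=0 and s=1 and t=0])
         (auto simp: type_defs seg3_def stack_insert det3_def)
    moreover have "classified (set (finite_types ! 0))" by (rule classified_finite[of 0]) simp_all
    ultimately show ?thesis unfolding Q_def by (rule classified_equiv)
  qed
  have pos: "Q p q" if "p > 0" "q > 0" for p q
  proof -
    have "set [(p,q,1),(0,0,1),(-p,-q,1),(0,1,0),(1,0,0),(0,0,0)] = stack tri (seg3 p q)"
      by (auto simp: seg3_def stack_insert)
    then show ?thesis unfolding Q_def using that
      by (intro classified_infinite[of 5 _ "[(p,q,1),(0,0,1),(-p,-q,1),(0,1,0),(1,0,0),(0,0,0)]"])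
         (simp_all add: infinite_types_def, simp add: sign_simps algebra_simps)
  qed
  have axis: "Q p 0" if "\<bar>p\<bar> = 1" for p
  proof -
    have "p = 1 \<or> p = -1" using that by linarith
    then show ?thesis using base neg[of "-1" 0] by auto
  qed
  have same: "Q p q" if "0 < p * q" for p q
    using that pos[of p q] neg[OF pos[of "-p" "-q"]] by (auto simp: zero_less_mult_iff)
  have "q = 0 \<or> p + q = 0 \<or> p = 0 \<or> 0 < p * q \<or> 0 < (-p-q) * p \<or> 0 < q * (-p-q)"
    by (auto simp: zero_less_mult_iff)
  then have "Q p q"
  proof (elim disjE)
    assume "q = 0" then show ?thesis using axis assms by simp
  next
    assume "p + q = 0"
    then have q: "q = -p" by linarith
    then have "\<bar>p\<bar> = 1" using assms by simp
    then have "Q (-(-p-q)-p) (-p-q)" using axis[of "-p"] q by simp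
    then show ?thesis by (rule rot[OF rot])
  next
    assume "p = 0"
    then have "Q (-p-q) p" using axis[of "-q"] assms by simp
    then show ?thesis by (rule rot)
  next
    assume "0 < p * q" then show ?thesis by (rule same)
  next
    assume "0 < (-p-q) * p" then have "Q (-p-q) p" by (rule same)
    then show ?thesis by (rule rot)
  next
    assume "0 < q * (-p-q)" then have "Q (-(-p-q)-p) (-p-q)" by (intro same) simp
    then show ?thesis by (rule rot[OF rot])
  qed
  then show ?thesis by (simp add: Q_def)
qed

definition corner :: "int \<Rightarrow> int \<Rightarrow> int \<Rightarrow> int \<Rightarrow> pt2 set" where
  "corner a b c d = {(0,0),(a,b),(c,d)}"

definition tri_corner :: "int \<Rightarrow> int \<Rightarrow> int \<Rightarrow> int \<Rightarrow> bool" where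
  "tri_corner a b c d = classified (stack tri (corner a b c d))"

lemma corner_flip: "tri_corner c d a b \<Longrightarrow> tri_corner a b c d"
  by (simp add: tri_corner_def corner_def insert_commute)

lemma corner_origin: "tri_corner (c-a) (d-b) (-a) (-b) \<Longrightarrow> tri_corner a b c d"
  unfolding tri_corner_def
  by (rule classified_stack_map[where a=1 and b=0 and c=0 and d=1 and e=0 and f=0 and e'="-a" and f'="-b"])
     (auto simp: corner_def insert_commute)

lemma corner_map:
  assumes "tri_corner (k*a + l*b) (m*a + n*b) (k*c + l*d) (m*c + n*d)" "k*n - l*m = 1 \<or> k*n - l*m = (-1)"
    "(\<lambda>(x,y). (k*x + l*y + e, m*x + n*y + f)) ` tri = tri"
  shows "tri_corner a b c d"
  unfolding tri_corner_def
  by (rule classified_stack_map[OF assms(1)[unfolded tri_corner_def] assms(2,3), where e'=0 and f'=0])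
     (simp add: corner_def)

lemma corner_rot: "tri_corner (-a-b) a (-c-d) c \<Longrightarrow> tri_corner a b c d"
  by (rule corner_map[OF _ _ tri_rotation]) simp_all

lemma corner_transpose: "tri_corner b a d c \<Longrightarrow> tri_corner a b c d"
  by (rule corner_map[where k=0 and l=1 and m=1 and n=0 and e=0 and f=0]) auto

lemma corner_reflect: "tri_corner (-a-b) b (-c-d) d \<Longrightarrow> tri_corner a b c d"
  by (rule corner_map[where k="-1" and l="-1" and m=0 and n=1 and e=1 and f=0]) auto

text \<open>For opposite orientations the sixth point \<open>(k,-1)\<close> moves along a line and the type depends on \<open>k\<close>
  only near the symmetric position \<open>k = 1\<close>.\<close>
lemma corner_shared_edge:
  assumes "\<bar>s\<bar> = 1" shows "tri_corner 1 0 k s"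
proof -
  have large: "tri_corner 1 0 k (-1)" if "k \<ge> 3" for k
    unfolding tri_corner_def using that
    by (intro classified_infinite[of 7 _ "stackl [(0,0),(1,0),(0,1)] [(0,0),(1,0),(k,-1)]"])
       (simp_all add: infinite_types_def set_stackl corner_def, simp add: sign_simps algebra_simps)
  have one: "tri_corner 1 0 1 (-1)"
    unfolding tri_corner_def
    by (rule classified_finite[of 11]) (simp_all add: type_defs corner_def stack_insert)
  have zero: "tri_corner 1 0 0 (-1)"
  proof -
    have "lat_equiv (stack tri (corner 1 0 0 (-1))) (set (finite_types ! 6))"
      by (rule lat_equiv3[where a=0 and b=1 and c=1 and d=0 and e=0 and f=1 and g=1 and h=0 and i=0 and r=0 and s=0 and t=0])
         (auto simp: type_defs corner_def stack_insert det3_def)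
    moreover have "classified (set (finite_types ! 6))" by (rule classified_finite[of 6]) simp_all
    ultimately show ?thesis unfolding tri_corner_def by (rule classified_equiv)
  qed
  have mirror: "tri_corner 1 0 (2-k) (-1) \<Longrightarrow> tri_corner 1 0 k (-1)" for k
    by (rule corner_reflect, rule corner_origin, rule corner_flip) simp
  have minus: "tri_corner 1 0 k (-1)" for k
  proof -
    consider "k \<ge> 3" | "k = 2" | "k = 1" | "k = 0" | "2 - k \<ge> 3" by linarith
    then show ?thesis
    proof cases
      case 2
      have "tri_corner 1 0 (2-k) (-1)" using zero 2 by simp
      then show ?thesis by (rule mirror)
    next
      case 5
      then have "tri_corner 1 0 (2-k) (-1)" by (rule large)
      then show ?thesis by (rule mirror)
    qed (use large one zero in simp_all)
  qed
  \<comment> \<open>With equal orientations the two parallel edges span a unit square, and the other two points are a segment above it.\<close>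
  have plus: "tri_corner 1 0 k 1" for k
  proof -
    have "lat_equiv (stack tri (corner 1 0 k 1)) (stack sq (seg k 1))"
      by (rule lat_equiv3[where a=1 and b=0 and c=0 and d=0 and e=0 and f=1 and g=0 and h=1 and i=0 and r=0 and s=0 and t=0])
         (auto simp: corner_def seg_def stack_insert det3_def)
    moreover have "classified (stack sq (seg k 1))" by (rule classified_sq) simp
    ultimately show ?thesis unfolding tri_corner_def by (rule classified_equiv)
  qed
  have "s = 1 \<or> s = -1" using assms by linarith
  then show ?thesis using minus plus by auto
qed

lemma corner_parallel:
  assumes "\<bar>a*d - b*c\<bar> = 1" "a = 0 \<or> b = 0 \<or> a + b = 0"
  shows "tri_corner a b c d"
proof -
  have 1: "tri_corner a b c d" if "\<bar>a*d - b*c\<bar> = 1" "b = 0" for a b c d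
  proof -
    have "\<bar>a * d\<bar> = 1" using that by simp
    then have ad: "\<bar>a\<bar> = 1" "\<bar>d\<bar> = 1" using abs_zmult_eq_1[of a d] abs_zmult_eq_1[of d a] by (simp_all add: mult.commute)
    then have "a = 1 \<or> a = -1" by linarith
    then show ?thesis
    proof
      assume "a = 1" then show ?thesis using corner_shared_edge[OF ad(2)] that by simp
    next
      assume "a = -1"
      then have "tri_corner (-a) (-b) (c-a) (d-b)" using corner_shared_edge[OF ad(2)] that by simp
      then show ?thesis by (intro corner_origin[of c a d b] corner_flip[of "-a" "-b"])
    qed
  qed
  have 2: "tri_corner a b c d" if "\<bar>a*d - b*c\<bar> = 1" "a = 0" for a b c d
    by (rule corner_rot, rule 1) (use that in \<open>auto simp: algebra_simps\<close>)
  have 3: "tri_corner a b c d" if "\<bar>a*d - b*c\<bar> = 1" "a + b = 0" for a b c d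
    by (rule corner_rot, rule 2) (use that in \<open>auto simp: algebra_simps\<close>)
  show ?thesis using assms 1 2 3 by blast
qed

text \<open>If the nonzero integers \<open>c\<close>, \<open>d\<close> had opposite signs, then \<open>a * d\<close> and \<open>b * c\<close> would have opposite
  signs too and their difference would be at least two in absolute value.\<close>
lemma unimodular_same_sector:
  assumes "\<bar>a*d - b*c\<bar> = (1::int)" "0 < a*b" "c \<noteq> 0" "d \<noteq> 0" shows "0 < c*d"
proof (rule ccontr)
  assume "\<not> 0 < c*d"
  then have "c*d < 0" using assms by (simp add: linorder_not_less order_less_le)
  then have "(a*b)*(c*d) < 0" using assms by (simp add: mult_pos_neg)
  then have "(a*d)*(b*c) < 0" by (simp add: algebra_simps)
  then have "a*d > 0 \<and> b*c < 0 \<or> a*d < 0 \<and> b*c > 0" by (simp add: mult_less_0_iff)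
  then show False using assms(1) by linarith
qed

lemma corner_generic:
  assumes det: "\<bar>a*d - b*c\<bar> = 1" and pos: "0 < a*b" and np: "c \<noteq> 0" "d \<noteq> 0" "a \<noteq> c" "b \<noteq> d"
  shows "tri_corner a b c d"
proof -
  have oriented: "tri_corner a b c d" if "a*d - b*c = 1" "0 < a" "a < c" "0 < b" "b < d" for a b c d
  proof -
    have "a * d = 1 + b * c" using that by simp
    then show ?thesis
    unfolding tri_corner_def using that
    by (intro classified_infinite[of 2 _ "stackl [(0,0),(1,0),(0,1)] [(0,0),(a,b),(c,d)]"])
       (simp_all add: infinite_types_def set_stackl corner_def, simp add: sign_simps algebra_simps)
  qed
  have chain: "tri_corner a b c d" if "\<bar>a*d - b*c\<bar> = 1" "0 < a" "a < c" "0 < b" "b < d" for a b c d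
  proof (cases "a*d - b*c = 1")
    case False
    then have "b*c - a*d = 1" using that(1) by linarith
    then show ?thesis using that by (intro corner_transpose[of b a] oriented)
  qed (use that oriented in simp)
  have cd: "0 < c*d" by (rule unimodular_same_sector[OF det pos np(1,2)])
  have "0 < (c-a)*(d-b)"
    by (rule unimodular_same_sector[OF _ pos]) (use det np in \<open>simp_all add: algebra_simps\<close>)
  then have s: "a < c \<and> b < d \<or> c < a \<and> d < b" by (auto simp: zero_less_mult_iff)
  have ab: "0 < a \<and> 0 < b \<or> a < 0 \<and> b < 0" using pos by (auto simp: zero_less_mult_iff)
  have cd: "0 < c \<and> 0 < d \<or> c < 0 \<and> d < 0" using cd by (auto simp: zero_less_mult_iff)
  have dets: "\<bar>c*b - d*a\<bar> = 1" "\<bar>(c-a)*(-b) - (d-b)*(-a)\<bar> = 1" "\<bar>(-a)*(d-b) - (-b)*(c-a)\<bar> = 1"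
    "\<bar>(a-c)*(-d) - (b-d)*(-c)\<bar> = 1" "\<bar>(-c)*(b-d) - (-d)*(a-c)\<bar> = 1"
    using det by (simp_all add: algebra_simps abs_minus_commute)
  \<comment> \<open>The three points are totally ordered; the least one becomes the origin.\<close>
  consider (u) "0 < a" "0 < b" "a < c" "b < d" | (v) "0 < c" "0 < d" "c < a" "d < b"
    | (uv) "a < 0" "b < 0" "a < c" "b < d" "c < 0" "d < 0" | (u0) "a < 0" "b < 0" "0 < c" "0 < d"
    | (vu) "c < 0" "d < 0" "c < a" "d < b" "a < 0" "b < 0" | (v0) "c < 0" "d < 0" "0 < a" "0 < b"
    using s ab cd by linarith
  then show ?thesis
  proof cases
    case u then show ?thesis using det by (intro chain)
  next
    case v then show ?thesis using dets by (intro corner_flip[of c d] chain)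
  next
    case uv then show ?thesis using dets by (intro corner_origin[of c a d b] chain) simp_all
  next
    case u0
    then have "tri_corner (-a) (-b) (c-a) (d-b)" using dets by (intro chain) simp_all
    then show ?thesis by (intro corner_origin[of c a d b] corner_flip[of "-a" "-b"])
  next
    case vu
    then have "tri_corner (a-c) (b-d) (-c) (-d)" using dets by (intro chain) simp_all
    then show ?thesis by (intro corner_flip[of c d] corner_origin[of a c b d])
  next
    case v0
    then have "tri_corner (-c) (-d) (a-c) (b-d)" using dets by (intro chain) simp_all
    then show ?thesis by (intro corner_flip[of c d] corner_origin[of a c b d] corner_flip[of "-c" "-d"])
  qed
qed

lemma classified_tri_tri:
  assumes det: "\<bar>a*d - b*c\<bar> = 1" shows "classified (stack tri (corner a b c d))"
proof -
  have dets: "\<bar>c*b - d*a\<bar> = 1" "\<bar>(c-a)*(-b) - (d-b)*(-a)\<bar> = 1"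
    "\<bar>(-a-b)*c - a*(-c-d)\<bar> = 1" "\<bar>(-(-a-b)-a)*(-c-d) - (-a-b)*(-(-c-d)-c)\<bar> = 1"
    using det by (simp_all add: algebra_simps abs_minus_commute)
  consider "a = 0 \<or> b = 0 \<or> a + b = 0" | "c = 0 \<or> d = 0 \<or> c + d = 0"
    | "c - a = 0 \<or> d - b = 0 \<or> (c - a) + (d - b) = 0"
    | (np) "a \<noteq> 0" "b \<noteq> 0" "a + b \<noteq> 0" "c \<noteq> 0" "d \<noteq> 0" "c + d \<noteq> 0" "a \<noteq> c" "b \<noteq> d" "a + b \<noteq> c + d"
    by linarith
  then have "tri_corner a b c d"
  proof cases
    case 1 then show ?thesis by (rule corner_parallel[OF det])
  next
    case 2 then have "tri_corner c d a b" by (rule corner_parallel[OF dets(1)])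
    then show ?thesis by (rule corner_flip)
  next
    case 3 then have "tri_corner (c-a) (d-b) (-a) (-b)" by (rule corner_parallel[OF dets(2)])
    then show ?thesis by (rule corner_origin)
  next
    case np
    have "0 < a \<and> 0 < b \<or> a < 0 \<and> b < 0 \<or> 0 < -a-b \<and> 0 < a \<or> -a-b < 0 \<and> a < 0
        \<or> 0 < -(-a-b)-a \<and> 0 < -a-b \<or> -(-a-b)-a < 0 \<and> -a-b < 0"
      using np(1-3) by linarith
    then have "0 < a*b \<or> 0 < (-a-b)*a \<or> 0 < (-(-a-b)-a)*(-a-b)"
      by (elim disjE conjE) (simp_all only: mult_pos_pos mult_neg_neg simp_thms)
    then show ?thesis
    proof (elim disjE)
      assume "0 < a*b" then show ?thesis by (rule corner_generic[OF det]) (use np in simp_all)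
    next
      assume "0 < (-a-b)*a"
      then have "tri_corner (-a-b) a (-c-d) c" by (rule corner_generic[OF dets(3)]) (use np in simp_all)
      then show ?thesis by (rule corner_rot)
    next
      assume "0 < (-(-a-b)-a)*(-a-b)"
      then have "tri_corner (-(-a-b)-a) (-a-b) (-(-c-d)-c) (-c-d)"
        by (rule corner_generic[OF dets(4)]) (use np in simp_all)
      then show ?thesis by (rule corner_rot[OF corner_rot])
    qed
  qed
  then show ?thesis by (simp add: tri_corner_def)
qed

lemma det3_mult:
  "det3 (a*x1+b*y1+c*z1) (d*x1+e*y1+f*z1) (g*x1+h*y1+i*z1)
        (a*x2+b*y2+c*z2) (d*x2+e*y2+f*z2) (g*x2+h*y2+i*z2)
        (a*x3+b*y3+c*z3) (d*x3+e*y3+f*z3) (g*x3+h*y3+i*z3)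
   = det3 a b c d e f g h i * det3 x1 y1 z1 x2 y2 z2 x3 y3 z3"
  unfolding det3_def by algebra

lemma lat_aut3_form:
  assumes "lat_aut (T :: pt3 \<Rightarrow> pt3)"
  obtains a b c d e f g h i r s t
  where "T = (\<lambda>(x,y,z). (a*x + b*y + c*z + r, d*x + e*y + f*z + s, g*x + h*y + i*z + t))"
proof -
  define f where "f u = T u - T 0" for u
  have add: "f (u + v) = f u + f v" for u v using lat_aut_add[OF assms, of u v] by (simp add: f_def)
  have lin: "P (f (m * x, m * y, m * z)) = m * P (f (x,y,z))"
    if P: "\<And>u v. P (u + v) = P u + (P v :: int)" for P m x y z
  proof -
    have "P (f ((m + n) * x, (m + n) * y, (m + n) * z)) = P (f (m*x,m*y,m*z)) + P (f (n*x,n*y,n*z))" for m n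
      unfolding P[symmetric] add[symmetric] by (simp add: algebra_simps)
    from additive_int[of "\<lambda>m. P (f (m*x,m*y,m*z))", OF this] show ?thesis by simp
  qed
  have lins: "fst (f (m * x, m * y, m * z)) = m * fst (f (x,y,z))"
    "fst (snd (f (m * x, m * y, m * z))) = m * fst (snd (f (x,y,z)))"
    "snd (snd (f (m * x, m * y, m * z))) = m * snd (snd (f (x,y,z)))" for m x y z
    by (rule lin[of fst] lin[of "\<lambda>u. fst (snd u)"] lin[of "\<lambda>u. snd (snd u)"], simp)+
  have "T (x,y,z) = f (x*1,x*0,x*0) + f (y*0,y*1,y*0) + f (z*0,z*0,z*1) + T 0" for x y z
    unfolding add[symmetric] by (simp add: f_def)
  then have "T (x,y,z) = (fst (f (1,0,0)) * x + fst (f (0,1,0)) * y + fst (f (0,0,1)) * z + fst (T 0),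
     fst (snd (f (1,0,0))) * x + fst (snd (f (0,1,0))) * y + fst (snd (f (0,0,1))) * z + fst (snd (T 0)),
     snd (snd (f (1,0,0))) * x + snd (snd (f (0,1,0))) * y + snd (snd (f (0,0,1))) * z + snd (snd (T 0)))" for x y z
    by (simp only: prod_eq_iff fst_add snd_add lins fst_conv snd_conv) (simp add: mult.commute)
  then show thesis by (intro that) (auto simp: fun_eq_iff)
qed

lemma lat_aut_det4:
  assumes T: "lat_aut T"
  obtains s where "s = 1 \<or> s = -1" "\<And>u v w x. det4 (T u) (T v) (T w) (T x) = s * det4 u v w x"
proof -
  obtain a b c d e f g h i r s t
    where form: "T = (\<lambda>(x,y,z). (a*x + b*y + c*z + r, d*x + e*y + f*z + s, g*x + h*y + i*z + t))"
    using lat_aut3_form[OF T] .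
  define D where "D = det3 a b c d e f g h i"
  have mult: "det4 (T u) (T v) (T w) (T x) = D * det4 u v w x" for u v w x
  proof -
    obtain u1 u2 u3 v1 v2 v3 w1 w2 w3 x1 x2 x3
      where "u = (u1,u2,u3)" "v = (v1,v2,v3)" "w = (w1,w2,w3)" "x = (x1,x2,x3)" by (metis surj_pair)
    then show ?thesis
      using det3_mult[of a "v1-u1" b "v2-u2" c "v3-u3" d e f g h i "w1-u1" "w2-u2" "w3-u3" "x1-u1" "x2-u2" "x3-u3"]
      by (simp add: form D_def algebra_simps)
  qed
  have surj: "surj T" using T by (auto simp: lat_aut_def bij_def)
  have TT: "T (inv T u) = u" for u by (rule surj_f_inv_f[OF surj])
  have "D * det4 (inv T (0,0,0)) (inv T (1,0,0)) (inv T (0,1,0)) (inv T (0,0,1)) = 1"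
    unfolding mult[symmetric] TT by (simp add: det3_def)
  then have "D = 1 \<or> D = -1" by (metis zmult_eq_1_iff)
  then show thesis using that mult by blast
qed

definition spans :: "pt3 set \<Rightarrow> bool" where
  "spans A \<longleftrightarrow> (\<exists>a\<in>A. \<exists>b\<in>A. \<exists>c\<in>A. \<exists>d\<in>A. det4 a b c d \<noteq> 0)"

lemma spans_equiv:
  assumes "lat_equiv A A'" "spans A" shows "spans A'"
proof -
  obtain T where T: "lat_aut T" "A' = T ` A" using assms by (auto simp: lat_equiv_def)
  obtain s where s: "s = 1 \<or> s = -1" "\<And>u v w x. det4 (T u) (T v) (T w) (T x) = s * det4 u v w x"
    using lat_aut_det4[OF T(1)] by blast
  obtain a b c d where "a \<in> A" "b \<in> A" "c \<in> A" "d \<in> A" "det4 a b c d \<noteq> 0"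
    using assms by (auto simp: spans_def)
  moreover have "det4 (T a) (T b) (T c) (T d) \<noteq> 0" using calculation s by auto
  ultimately show ?thesis unfolding spans_def T by blast
qed

text \<open>Multiplying the three equations by cofactors (Cramer's rule).\<close>
lemma det3_kernel:
  assumes "k*a + l*b + m*c = 0" "k*d + l*e + m*f = 0" "k*g + l*h + m*i = 0"
  shows "det3 a b c d e f g h i * k = 0" "det3 a b c d e f g h i * l = 0" "det3 a b c d e f g h i * m = 0"
proof -
  have "det3 a b c d e f g h i * k = (e*i - f*h) * (k*a + l*b + m*c) + (c*h - b*i) * (k*d + l*e + m*f)
      + (b*f - c*e) * (k*g + l*h + m*i)"
    "det3 a b c d e f g h i * l = (f*g - d*i) * (k*a + l*b + m*c) + (a*i - c*g) * (k*d + l*e + m*f)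
      + (c*d - a*f) * (k*g + l*h + m*i)"
    "det3 a b c d e f g h i * m = (d*h - e*g) * (k*a + l*b + m*c) + (b*g - a*h) * (k*d + l*e + m*f)
      + (a*e - b*d) * (k*g + l*h + m*i)"
    unfolding det3_def by (simp_all add: algebra_simps)
  then show "det3 a b c d e f g h i * k = 0" "det3 a b c d e f g h i * l = 0" "det3 a b c d e f g h i * m = 0"
    unfolding assms by simp_all
qed

lemma not_spans_plane:
  assumes "\<And>x y z. (x,y,z) \<in> A \<Longrightarrow> k*x + l*y + m*z = n" "(k,l,m) \<noteq> (0,0,0)"
  shows "\<not> spans A"
proof
  assume "spans A"
  then obtain a b c d where A: "a \<in> A" "b \<in> A" "c \<in> A" "d \<in> A" and D: "det4 a b c d \<noteq> 0"
    by (auto simp: spans_def)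
  obtain u1 u2 u3 v1 v2 v3 w1 w2 w3 x1 x2 x3
    where p: "a = (u1,u2,u3)" "b = (v1,v2,v3)" "c = (w1,w2,w3)" "d = (x1,x2,x3)" by (metis surj_pair)
  have e: "k * u1 + l * u2 + m * u3 = n" "k * v1 + l * v2 + m * v3 = n" "k*w1 + l*w2 + m*w3 = n" "k*x1 + l*x2 + m*x3 = n"
    using A assms(1) p by auto
  have "k * (v1 - u1) + l * (v2 - u2) + m * (v3 - u3) = 0" "k * (w1 - u1) + l * (w2 - u2) + m * (w3 - u3) = 0"
    "k * (x1 - u1) + l * (x2 - u2) + m * (x3 - u3) = 0"
    using e by (simp_all add: algebra_simps)
  from det3_kernel[OF this]
  have "det4 a b c d * k = 0" "det4 a b c d * l = 0" "det4 a b c d * m = 0"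
    unfolding p det4.simps .
  then show False using D assms(2) by simp
qed

lemma card_two_equiv:
  assumes "tri_closed (C :: pt2 set)" "card C = 2" shows "lat_equiv C {(0,0),(1,0)}"
proof -
  have "card C \<ge> 2" using assms by simp
  then obtain C' where C': "lat_equiv C C'" "(0,0) \<in> C'" "(1,0) \<in> C'" by (rule planar_normal[OF assms(1)])
  have "card C' = 2" using lat_equiv_card[OF C'(1)] assms by simp
  then have "{(0,0),(1,0)} = C'"
    by (intro card_subset_eq) (use C' in \<open>auto intro: card_ge_0_finite\<close>)
  then show ?thesis using C'(1) by simp
qed

lemma linear_image:
  assumes "lat_equiv C (S :: pt2 set)"
  obtains a b c d e f where "a*d - b*c = 1 \<or> a*d - b*c = (-1)" "C = (\<lambda>(x,y). (a*x + b*y + e, c*x + d*y + f)) ` S"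
proof -
  obtain T where T: "lat_aut T" "T ` S = C"
    using lat_equiv_sym[OF assms] by (auto simp: lat_equiv_def)
  obtain a b c d e f where form: "T = (\<lambda>(x,y). (a*x + b*y + e, c*x + d*y + f))" using lat_aut2_form[OF T(1)] .
  then show thesis using that T lat_aut2_det by blast
qed

lemma unimodular_coprime:
  assumes "a*d - b*c = 1 \<or> a*d - b*c = (-1::int)" shows "coprime a c"
proof (rule coprimeI)
  fix k assume k: "k dvd a" "k dvd c"
  then have "k dvd a*d - b*c" by simp
  then show "is_unit k" using assms by auto
qed

lemma stack_translate:
  "lat_equiv (stack B C) (stack B ((\<lambda>(x,y). (x - e, y - f)) ` C))"
  by (rule stack_equiv[where a=1 and b=0 and c=0 and d=1 and e=0 and f=0 and e'="-e" and f'="-f"]) simp_all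

lemma stack_seg:
  assumes "lat_equiv C {(0,0),(1,0)}"
  obtains p q where "coprime p q" "lat_equiv (stack B C) (stack B (seg p q))"
proof -
  obtain a b c d e f where det: "a*d - b*c = 1 \<or> a*d - b*c = (-1)"
    and C: "C = (\<lambda>(x,y). (a*x + b*y + e, c*x + d*y + f)) ` {(0,0),(1,0)}"
    using linear_image[OF assms] .
  have "(\<lambda>(x,y). (x - e, y - f)) ` C = seg a c" unfolding C by (simp add: seg_def)
  then show thesis using that[OF unimodular_coprime[OF det]] stack_translate[of B C e f] by simp
qed

lemma stack_seg3:
  assumes "lat_equiv C line3"
  obtains p q where "coprime p q" "lat_equiv (stack B C) (stack B (seg3 p q))"
proof -
  obtain a b c d e f where det: "a*d - b*c = 1 \<or> a*d - b*c = (-1)"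
    and C: "C = (\<lambda>(x,y). (a*x + b*y + e, c*x + d*y + f)) ` line3"
    using linear_image[OF assms] .
  have "(\<lambda>(x,y). (x - e, y - f)) ` C = seg3 a c" unfolding C by (simp add: seg3_def)
  then show thesis using that[OF unimodular_coprime[OF det]] stack_translate[of B C e f] by simp
qed

lemma stack_corner:
  assumes "lat_equiv C tri"
  obtains a b c d where "\<bar>a*d - b*c\<bar> = 1" "lat_equiv (stack B C) (stack B (corner a b c d))"
proof -
  obtain a b c d e f where det: "a*d - b*c = 1 \<or> a*d - b*c = (-1)"
    and C: "C = (\<lambda>(x,y). (a*x + b*y + e, c*x + d*y + f)) ` tri"
    using linear_image[OF assms] .
  have "(\<lambda>(x,y). (x - e, y - f)) ` C = corner a c b d" unfolding C by (simp add: corner_def)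
  moreover have "\<bar>a*d - c*b\<bar> = 1" using det by (auto simp: algebra_simps)
  ultimately show thesis using that stack_translate[of B C e f] by metis
qed

lemma classified_5_1:
  assumes B: "tri_closed B" "card B = 5" and C: "card C = 1" and spans: "spans (stack B C)"
  shows "classified (stack B C)"
proof (rule planar5[OF B])
  fix B' assume B': "lat_equiv B B'" "B' \<subseteq> {(x,y). y = 0}"
  obtain C' where C': "lat_equiv (stack B C) (stack B' C')" "lat_equiv C C'" using stack_normalize[OF B'(1)] .
  have "card C' = 1" using lat_equiv_card[OF C'(2)] C by simp
  then obtain r s where rs: "C' = {(r,s)}" by (metis card_1_singletonE surj_pair)
  have "\<not> spans (stack B' C')"
    by (rule not_spans_plane[where k=0 and l=1 and m="-s" and n=0]) (use B'(2) rs in \<open>auto simp: stack_def\<close>)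
  then show ?thesis using spans_equiv[OF C'(1) spans] by simp
next
  fix w assume w: "w \<in> {(2,0),(1,1),(0,-1),(1,-1),(2,-1),(3,-1)}" and B': "lat_equiv B (insert w edge)"
  obtain C' where C': "lat_equiv (stack B C) (stack (insert w edge) C')" "lat_equiv C C'" using stack_normalize[OF B'] .
  have "card C' = 1" using lat_equiv_card[OF C'(2)] C by simp
  then obtain r s where rs: "C' = {(r,s)}" by (metis card_1_singletonE surj_pair)
  have eq: "lat_equiv (stack B C) (stack (insert w edge) {(0,0)})"
    using lat_equiv_trans[OF C'(1) stack_translate[of _ _ r s]] by (simp add: rs)
  have "w = (2,0) \<or> (\<exists>i<5. set (finite_types ! i) = stack (insert w edge) {(0,0)})"
    using w
  proof (elim insertE emptyE)
    assume "w = (1,1)" then show ?thesis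
      by (intro disjI2 exI[of _ 0]) (simp add: type_defs stack_insert insert_commute)
  next
    assume "w = (0,-1)" then show ?thesis
      by (intro disjI2 exI[of _ 1]) (simp add: type_defs stack_insert insert_commute)
  next
    assume "w = (1,-1)" then show ?thesis
      by (intro disjI2 exI[of _ 2]) (simp add: type_defs stack_insert insert_commute)
  next
    assume "w = (2,-1)" then show ?thesis
      by (intro disjI2 exI[of _ 3]) (simp add: type_defs stack_insert insert_commute)
  next
    assume "w = (3,-1)" then show ?thesis
      by (intro disjI2 exI[of _ 4]) (simp add: type_defs stack_insert insert_commute)
  qed simp
  then show ?thesis
  proof (elim disjE exE conjE)
    \<comment> \<open>Four collinear points and two more, also seen as a segment of four points below a segment.\<close>
    assume w: "w = (2,0)"
    have "classified (stack (insert w edge) {(0,0)})"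
      by (rule classified_infinite[of 0 _ "[(-1,0,0),(0,0,0),(1,0,0),(2,0,0),(0,0,1),(0,1,0)]"])
         (simp_all add: w stack_insert insert_commute infinite_types_def stackl_def det3_def)
    then show ?thesis by (rule classified_equiv[OF eq])
  next
    fix i :: nat assume "i < 5" "set (finite_types ! i) = stack (insert w edge) {(0,0)}"
    then have "classified (stack (insert w edge) {(0,0)})" by (intro classified_finite[of i]) simp_all
    then show ?thesis by (rule classified_equiv[OF eq])
  qed
qed

lemma classified_4_2:
  assumes B: "tri_closed B" "card B = 4" and C: "tri_closed C" "card C = 2" and spans: "spans (stack B C)"
  shows "classified (stack B C)"
proof -
  have seg: "\<exists>p q. coprime p q \<and> lat_equiv (stack B C) (stack B' (seg p q))" if B': "lat_equiv B B'" for B'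
  proof -
    obtain C' where C': "lat_equiv (stack B C) (stack B' C')" "lat_equiv C C'" using stack_normalize[OF B'] .
    have "lat_equiv C' {(0,0),(1,0)}" using lat_equiv_trans[OF lat_equiv_sym[OF C'(2)] card_two_equiv[OF C]] .
    then obtain p q where "coprime p q" "lat_equiv (stack B' C') (stack B' (seg p q))" by (rule stack_seg)
    then show ?thesis using lat_equiv_trans[OF C'(1)] by blast
  qed
  show ?thesis using planar4[OF B]
  proof (elim disjE)
    assume "lat_equiv B line4"
    from seg[OF this] obtain p q where eq: "lat_equiv (stack B C) (stack line4 (seg p q))" by blast
    have "q \<noteq> 0"
    proof
      assume "q = 0"
      then have "\<not> spans (stack line4 (seg p q))"
        by (intro not_spans_plane[where k=0 and l=1 and m=0 and n=0]) (auto simp: stack_def seg_def)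
      then show False using spans_equiv[OF eq spans] by simp
    qed
    then show ?thesis by (rule classified_equiv[OF eq classified_line4])
  next
    assume "lat_equiv B sq"
    from seg[OF this] show ?thesis using classified_equiv classified_sq by blast
  next
    assume "lat_equiv B edge"
    from seg[OF this] show ?thesis using classified_equiv classified_edge by blast
  next
    assume "lat_equiv B cen"
    from seg[OF this] show ?thesis using classified_equiv classified_cen by blast
  qed
qed

lemma classified_3_3:
  assumes B: "tri_closed B" "card B = 3" and C: "tri_closed C" "card C = 3" and spans: "spans (stack B C)"
  shows "classified (stack B C)"
proof -
  have over_tri: "classified (stack B C)" if B': "lat_equiv B tri" and C: "tri_closed C" "card C = 3" for B C
  proof -
    obtain C' where C': "lat_equiv (stack B C) (stack tri C')" "lat_equiv C C'" using stack_normalize[OF B'] .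
    have "tri_closed C'" "card C' = 3" using tri_closed_equiv[OF C'(2)] lat_equiv_card[OF C'(2)] C by simp_all
    from planar3[OF this] have "classified (stack tri C')"
    proof
      assume "lat_equiv C' line3"
      then obtain p q where "coprime p q" "lat_equiv (stack tri C') (stack tri (seg3 p q))" by (rule stack_seg3)
      then show ?thesis using classified_equiv classified_tri_line3 by blast
    next
      assume "lat_equiv C' tri"
      then obtain a b c d where "\<bar>a*d - b*c\<bar> = 1" "lat_equiv (stack tri C') (stack tri (corner a b c d))"
        by (rule stack_corner)
      then show ?thesis using classified_equiv classified_tri_tri by blast
    qed
    then show ?thesis by (rule classified_equiv[OF C'(1)])
  qed
  consider "lat_equiv B tri" | "lat_equiv C tri" | "lat_equiv B line3" "lat_equiv C line3"
    using planar3[OF B] planar3[OF C] by blast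
  then show ?thesis
  proof cases
    case 1 then show ?thesis using C by (rule over_tri)
  next
    case 2 then have "classified (stack C B)" using B by (rule over_tri)
    then show ?thesis by (rule classified_equiv[OF stack_swap])
  next
    case 3
    obtain C' where C': "lat_equiv (stack B C) (stack line3 C')" "lat_equiv C C'" using stack_normalize[OF 3(1)] .
    have "lat_equiv C' line3" using lat_equiv_trans[OF lat_equiv_sym[OF C'(2)] 3(2)] .
    then obtain p q where "coprime p q" and eq': "lat_equiv (stack line3 C') (stack line3 (seg3 p q))"
      by (rule stack_seg3)
    have eq: "lat_equiv (stack B C) (stack line3 (seg3 p q))" using lat_equiv_trans[OF C'(1) eq'] .
    have "q \<noteq> 0"
    proof
      assume "q = 0"
      then have "\<not> spans (stack line3 (seg3 p q))"
        by (intro not_spans_plane[where k=0 and l=1 and m=0 and n=0]) (auto simp: stack_def seg3_def)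
      then show False using spans_equiv[OF eq spans] by simp
    qed
    then show ?thesis by (rule classified_equiv[OF eq classified_line3_line3])
  qed
qed

text \<open>The larger level goes below.  An upper level without points is impossible, because six points on
  one level do not span.\<close>
lemma classified_stack:
  assumes B: "tri_closed B" "finite B" and C: "tri_closed C" "finite C" and card: "card B + card C = 6"
    and spans: "spans (stack B C)"
  shows "classified (stack B C)"
proof -
  have larger_first: "classified (stack B C)"
    if h: "tri_closed B" "finite B" "tri_closed C" "finite C" "card B + card C = 6" "spans (stack B C)" "card C \<le> card B"
    for B C
  proof -
    have "card C \<noteq> 0"
    proof
      assume "card C = 0"
      then have "C = {}" using h by simp
      then have "\<not> spans (stack B C)"
        by (intro not_spans_plane[where k=0 and l=0 and m=1 and n=0]) (auto simp: stack_def)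
      then show False using h by simp
    qed
    then consider "card B = 5" "card C = 1" | "card B = 4" "card C = 2" | "card B = 3" "card C = 3"
      using h(5,7) by linarith
    then show ?thesis
    proof cases
      case 1 then show ?thesis using h by (intro classified_5_1)
    next
      case 2 then show ?thesis using h by (intro classified_4_2)
    next
      case 3 then show ?thesis using h by (intro classified_3_3)
    qed
  qed
  show ?thesis
  proof (cases "card C \<le> card B")
    case False
    have "classified (stack C B)"
      by (rule larger_first) (use assms False spans_equiv[OF stack_swap spans] in simp_all)
    then show ?thesis by (rule classified_equiv[OF stack_swap])
  qed (rule larger_first[OF assms])
qed

section \<open>Lattice points of convex hulls\<close>

text \<open>Lattice convexity by integer half-planes; for explicit polygons it reduces to integer
  arithmetic with the facet inequalities.\<close>
definition half_closed :: "pt2 set \<Rightarrow> bool" where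
  "half_closed B \<longleftrightarrow> (\<forall>x y. (\<forall>k l n. (\<forall>x' y'. (x',y') \<in> B \<longrightarrow> k * x' + l * y' \<le> n) \<longrightarrow> k * x + l * y \<le> n)
     \<longrightarrow> (x,y) \<in> B)"

lemma half_closedI:
  assumes "\<And>x y. (\<And>k l n. (\<And>x' y'. (x',y') \<in> B \<Longrightarrow> k * x' + l * y' \<le> n) \<Longrightarrow> k * x + l * y \<le> n) \<Longrightarrow> (x,y) \<in> B"
  shows "half_closed B"
  using assms unfolding half_closed_def by blast

lemma half_closedD:
  assumes "half_closed B"
    "\<And>k l n. (\<And>x' y'. (x',y') \<in> B \<Longrightarrow> k * x' + l * y' \<le> n) \<Longrightarrow> k * x + l * y \<le> n"
  shows "(x,y) \<in> B"
  using assms unfolding half_closed_def by simp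

lemma half_closed_equiv:
  assumes B: "half_closed B" and eq: "lat_equiv B B'" shows "half_closed B'"
proof (rule half_closedI)
  fix x y :: int assume H: "\<And>k l n. (\<And>x' y'. (x',y') \<in> B' \<Longrightarrow> k * x' + l * y' \<le> n) \<Longrightarrow> k * x + l * y \<le> n"
  obtain S where S: "lat_aut S" "S ` B' = B" using lat_equiv_sym[OF eq] by (auto simp: lat_equiv_def)
  obtain a b c d e f where form: "S = (\<lambda>(x,y). (a*x + b*y + e, c*x + d*y + f))" using lat_aut2_form[OF S(1)] .
  have valid_S: "k * (a*x + b*y + e) + l * (c*x + d*y + f) \<le> n"
    if valid: "\<And>x y. (x,y) \<in> B \<Longrightarrow> k * x + l * y \<le> n" for k l n
  proof -
    have "(k*a + l*c) * x' + (k*b + l*d) * y' \<le> n - k*e - l*f" if "(x',y') \<in> B'" for x' y'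
    proof -
      have "(a*x' + b*y' + e, c*x' + d*y' + f) \<in> B" using imageI[OF that, of S] S(2) by (simp add: form)
      from valid[OF this] show ?thesis by (simp add: algebra_simps)
    qed
    then have "(k*a + l*c) * x + (k*b + l*d) * y \<le> n - k*e - l*f" by (rule H)
    then show ?thesis by (simp add: algebra_simps)
  qed
  have "(a*x + b*y + e, c*x + d*y + f) \<in> B" by (rule half_closedD[OF B valid_S])
  then have "S (x,y) \<in> B" by (simp add: form)
  then have "S (x,y) \<in> S ` B'" using S by simp
  then show "(x,y) \<in> B'" using S(1) by (auto simp: lat_aut_def bij_def inj_eq)
qed

lemma half_closed_point: "half_closed {(0,0)}"
proof (rule half_closedI)
  fix x y :: int assume H: "\<And>k l n. (\<And>x' y'. (x',y') \<in> {(0,0)} \<Longrightarrow> k * x' + l * y' \<le> n) \<Longrightarrow> k * x + l * y \<le> (n::int)"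
  have "1 * x + 0 * y \<le> 0" "-1 * x + 0 * y \<le> 0" "0 * x + 1 * y \<le> 0" "0 * x + -1 * y \<le> 0"
    by (rule H; auto)+
  then show "(x,y) \<in> {(0,0)}" by simp
qed

lemma half_closed_line2: "half_closed {(0,0),(1,0)}"
proof (rule half_closedI)
  fix x y :: int assume H: "\<And>k l n. (\<And>x' y'. (x',y') \<in> {(0,0),(1,0)} \<Longrightarrow> k * x' + l * y' \<le> n) \<Longrightarrow> k * x + l * y \<le> n"
  have "-1 * x + 0 * y \<le> 0" "0 * x + -1 * y \<le> 0" "0 * x + 1 * y \<le> 0" "1 * x + 0 * y \<le> 1"
    by (rule H; auto)+
  then show "(x,y) \<in> {(0,0),(1,0)}" by simp presburger
qed

lemma half_closed_line3: "half_closed line3"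
proof (rule half_closedI)
  fix x y :: int assume H: "\<And>k l n. (\<And>x' y'. (x',y') \<in> line3 \<Longrightarrow> k * x' + l * y' \<le> n) \<Longrightarrow> k * x + l * y \<le> n"
  have "-1 * x + 0 * y \<le> 1" "0 * x + -1 * y \<le> 0" "0 * x + 1 * y \<le> 0" "1 * x + 0 * y \<le> 1"
    by (rule H; auto)+
  then show "(x,y) \<in> line3" by simp presburger
qed

lemma half_closed_line4: "half_closed line4"
proof (rule half_closedI)
  fix x y :: int assume H: "\<And>k l n. (\<And>x' y'. (x',y') \<in> line4 \<Longrightarrow> k * x' + l * y' \<le> n) \<Longrightarrow> k * x + l * y \<le> n"
  have "-1 * x + 0 * y \<le> 0" "0 * x + -1 * y \<le> 0" "0 * x + 1 * y \<le> 0" "1 * x + 0 * y \<le> 3"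
    by (rule H; auto)+
  then show "(x,y) \<in> line4" by simp presburger
qed

lemma half_closed_tri: "half_closed tri"
proof (rule half_closedI)
  fix x y :: int assume H: "\<And>k l n. (\<And>x' y'. (x',y') \<in> tri \<Longrightarrow> k * x' + l * y' \<le> n) \<Longrightarrow> k * x + l * y \<le> n"
  have "-1 * x + 0 * y \<le> 0" "0 * x + -1 * y \<le> 0" "1 * x + 1 * y \<le> 1"
    by (rule H; auto)+
  then show "(x,y) \<in> tri" by simp presburger
qed

lemma half_closed_sq: "half_closed sq"
proof (rule half_closedI)
  fix x y :: int assume H: "\<And>k l n. (\<And>x' y'. (x',y') \<in> sq \<Longrightarrow> k * x' + l * y' \<le> n) \<Longrightarrow> k * x + l * y \<le> n"
  have "-1 * x + 0 * y \<le> 0" "0 * x + -1 * y \<le> 0" "0 * x + 1 * y \<le> 1" "1 * x + 0 * y \<le> 1"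
    by (rule H; auto)+
  then show "(x,y) \<in> sq" by simp presburger
qed

lemma half_closed_edge: "half_closed edge"
proof (rule half_closedI)
  fix x y :: int assume H: "\<And>k l n. (\<And>x' y'. (x',y') \<in> edge \<Longrightarrow> k * x' + l * y' \<le> n) \<Longrightarrow> k * x + l * y \<le> n"
  have "-1 * x + 1 * y \<le> 1" "0 * x + -1 * y \<le> 0" "1 * x + 1 * y \<le> 1"
    by (rule H; auto)+
  then show "(x,y) \<in> edge" by simp presburger
qed

lemma half_closed_cen: "half_closed cen"
proof (rule half_closedI)
  fix x y :: int assume H: "\<And>k l n. (\<And>x' y'. (x',y') \<in> cen \<Longrightarrow> k * x' + l * y' \<le> n) \<Longrightarrow> k * x + l * y \<le> n"
  have "-2 * x + 1 * y \<le> 1" "1 * x + -2 * y \<le> 1" "1 * x + 1 * y \<le> 1"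
    by (rule H; auto)+
  then show "(x,y) \<in> cen" by simp presburger
qed

lemma half_closed_five0: "half_closed {(-1,0),(0,0),(1,0),(0,1),(1,1)}"
proof (rule half_closedI)
  fix x y :: int assume H: "\<And>k l n. (\<And>x' y'. (x',y') \<in> {(-1,0),(0,0),(1,0),(0,1),(1,1)} \<Longrightarrow> k * x' + l * y' \<le> n) \<Longrightarrow> k * x + l * y \<le> n"
  have "-1 * x + 1 * y \<le> 1" "0 * x + -1 * y \<le> 0" "0 * x + 1 * y \<le> 1" "1 * x + 0 * y \<le> 1"
    by (rule H; auto)+
  then show "(x,y) \<in> {(-1,0),(0,0),(1,0),(0,1),(1,1)}" by simp presburger
qed

lemma half_closed_five1: "half_closed {(-1,0),(0,0),(1,0),(0,1),(0,-1)}"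
proof (rule half_closedI)
  fix x y :: int assume H: "\<And>k l n. (\<And>x' y'. (x',y') \<in> {(-1,0),(0,0),(1,0),(0,1),(0,-1)} \<Longrightarrow> k * x' + l * y' \<le> n) \<Longrightarrow> k * x + l * y \<le> n"
  have "-1 * x + -1 * y \<le> 1" "-1 * x + 1 * y \<le> 1" "1 * x + -1 * y \<le> 1" "1 * x + 1 * y \<le> 1"
    by (rule H; auto)+
  then show "(x,y) \<in> {(-1,0),(0,0),(1,0),(0,1),(0,-1)}" by simp presburger
qed

lemma half_closed_five2: "half_closed {(-1,0),(0,0),(1,0),(0,1),(1,-1)}"
proof (rule half_closedI)
  fix x y :: int assume H: "\<And>k l n. (\<And>x' y'. (x',y') \<in> {(-1,0),(0,0),(1,0),(0,1),(1,-1)} \<Longrightarrow> k * x' + l * y' \<le> n) \<Longrightarrow> k * x + l * y \<le> n"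
  have "-1 * x + -2 * y \<le> 1" "-1 * x + 1 * y \<le> 1" "1 * x + 0 * y \<le> 1" "1 * x + 1 * y \<le> 1"
    by (rule H; auto)+
  then show "(x,y) \<in> {(-1,0),(0,0),(1,0),(0,1),(1,-1)}" by simp presburger
qed

lemma half_closed_five3: "half_closed {(-1,0),(0,0),(1,0),(0,1),(2,-1)}"
proof (rule half_closedI)
  fix x y :: int assume H: "\<And>k l n. (\<And>x' y'. (x',y') \<in> {(-1,0),(0,0),(1,0),(0,1),(2,-1)} \<Longrightarrow> k * x' + l * y' \<le> n) \<Longrightarrow> k * x + l * y \<le> n"
  have "-1 * x + -3 * y \<le> 1" "-1 * x + 1 * y \<le> 1" "1 * x + 1 * y \<le> 1"
    by (rule H; auto)+
  then show "(x,y) \<in> {(-1,0),(0,0),(1,0),(0,1),(2,-1)}" by simp presburger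
qed

lemma half_closed_five4: "half_closed {(-1,0),(0,0),(1,0),(0,1),(3,-1)}"
proof (rule half_closedI)
  fix x y :: int assume H: "\<And>k l n. (\<And>x' y'. (x',y') \<in> {(-1,0),(0,0),(1,0),(0,1),(3,-1)} \<Longrightarrow> k * x' + l * y' \<le> n) \<Longrightarrow> k * x + l * y \<le> n"
  have "-1 * x + -4 * y \<le> 1" "-1 * x + 1 * y \<le> 1" "2 * x + 3 * y \<le> 3"
    by (rule H; auto)+
  then show "(x,y) \<in> {(-1,0),(0,0),(1,0),(0,1),(3,-1)}" by simp presburger
qed

lemma half_closed_seg:
  assumes "coprime p q" shows "half_closed (seg p q)"
proof -
  obtain s t where st: "s * p + t * q = 1" using bezout_int[of p q] assms by auto
  have "lat_equiv {(0,0),(1,0)} (seg p q)"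
    by (rule lat_equiv2[where a=p and b="-t" and c=q and d=s and e=0 and f=0])
       (use st in \<open>auto simp: seg_def algebra_simps\<close>)
  then show ?thesis by (rule half_closed_equiv[OF half_closed_line2])
qed

lemma half_closed_seg3:
  assumes "coprime p q" shows "half_closed (seg3 p q)"
proof -
  obtain s t where st: "s * p + t * q = 1" using bezout_int[of p q] assms by auto
  have "lat_equiv line3 (seg3 p q)"
    by (rule lat_equiv2[where a=p and b="-t" and c=q and d=s and e=0 and f=0])
       (use st in \<open>auto simp: seg3_def algebra_simps\<close>)
  then show ?thesis by (rule half_closed_equiv[OF half_closed_line3])
qed

lemma half_closed_corner:
  assumes "a*d - b*c = 1 \<or> a*d - b*c = -1" shows "half_closed (corner a b c d)"
proof -
  have "lat_equiv tri (corner a b c d)"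
    by (rule lat_equiv2[where a=a and b=c and c=b and d=d and e=0 and f=0])
       (use assms in \<open>auto simp: corner_def algebra_simps\<close>)
  then show ?thesis by (rule half_closed_equiv[OF half_closed_tri])
qed

definition pt :: "pt3 \<Rightarrow> real^3" where
  "pt = (\<lambda>(x,y,z). vector [of_int x, of_int y, of_int z])"

lemma pt_nth [simp]:
  "pt (x,y,z) $ 1 = of_int x" "pt (x,y,z) $ 2 = of_int y" "pt (x,y,z) $ 3 = of_int z"
  by (simp_all add: pt_def)

lemma pt_eq_iff [simp]: "pt u = pt v \<longleftrightarrow> u = v"
  by (cases u; cases v) (auto simp: vec_eq_iff forall_3)

lemma inj_pt: "inj pt" by (simp add: inj_def)

lemma pt_add: "pt (u + v) = pt u + pt v" and pt_diff: "pt (u - v) = pt u - pt v"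
  by (cases u; cases v; simp add: vec_eq_iff forall_3)+

lemma range_pt: "range pt = int_lattice"
proof
  show "range pt \<subseteq> int_lattice" by (auto simp: int_lattice_def forall_3)
  show "int_lattice \<subseteq> range pt"
  proof
    fix v assume "v \<in> int_lattice"
    then obtain x y z where "v $ 1 = of_int x" "v $ 2 = of_int y" "v $ 3 = of_int z"
      unfolding int_lattice_def forall_3 by (auto elim!: Ints_cases)
    then have "v = pt (x,y,z)" by (simp add: vec_eq_iff forall_3)
    then show "v \<in> range pt" by simp
  qed
qed

definition hull_closed :: "pt3 set \<Rightarrow> bool" where
  "hull_closed A \<longleftrightarrow> (\<forall>u. pt u \<in> convex hull (pt ` A) \<longrightarrow> u \<in> A)"

lemma hull_halfspace:
  assumes "pt (x,y,z) \<in> convex hull (pt ` A)"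
    "\<And>x' y' z'. (x',y',z') \<in> A \<Longrightarrow> k * x' + l * y' + m * z' \<le> n"
  shows "k * x + l * y + m * z \<le> n"
proof -
  have "convex hull (pt ` A) \<subseteq> {v. pt (k,l,m) \<bullet> v \<le> of_int n}"
  proof (rule hull_minimal)
    show "pt ` A \<subseteq> {v. pt (k,l,m) \<bullet> v \<le> of_int n}"
    proof clarsimp
      fix x' y' z' assume "(x',y',z') \<in> A"
      from assms(2)[OF this] have "of_int (k * x' + l * y' + m * z') \<le> (of_int n :: real)"
        by (simp only: of_int_le_iff)
      then show "pt (k,l,m) \<bullet> pt (x',y',z') \<le> of_int n" by (simp add: inner_vec_def sum_3)
    qed
  qed (rule convex_halfspace_le)
  then have "pt (k,l,m) \<bullet> pt (x,y,z) \<le> of_int n" using assms(1) by auto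
  then have "of_int (k * x + l * y + m * z) \<le> (of_int n :: real)" by (simp add: inner_vec_def sum_3)
  then show ?thesis by (simp only: of_int_le_iff)
qed

lemma finite_bound:
  assumes "finite (C :: pt2 set)" obtains N :: int where "\<And>x y. (x,y) \<in> C \<Longrightarrow> k * x + l * y \<le> N"
proof
  fix x y assume "(x,y) \<in> C"
  then show "k * x + l * y \<le> Max ((\<lambda>(x,y). k * x + l * y) ` C)"
    using assms by (intro Max_ge) force+
qed

lemma hull_closed_stack:
  assumes B: "half_closed B" "finite B" and C: "half_closed C" "finite C"
  shows "hull_closed (stack B C)"
  unfolding hull_closed_def
proof (intro allI impI)
  fix u assume u: "pt u \<in> convex hull (pt ` stack B C)"
  obtain x y z where xyz: "u = (x,y,z)" by (metis surj_pair)
  note hull = hull_halfspace[OF u[unfolded xyz]]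
  have "0 * x + 0 * y + 1 * z \<le> 1" "0 * x + 0 * y + (-1) * z \<le> 0"
    by (rule hull; auto simp: stack_def)+
  then consider "z = 0" | "z = 1" by linarith
  then show "u \<in> stack B C"
  proof cases
    case 1
    have "(x,y) \<in> B"
    proof (rule half_closedD[OF B(1)])
      fix k l n assume valid: "\<And>x' y'. (x',y') \<in> B \<Longrightarrow> k * x' + l * y' \<le> n"
      obtain N where N: "\<And>x y. (x,y) \<in> C \<Longrightarrow> k * x + l * y \<le> N" using finite_bound[OF C(2), of k l] by blast
      \<comment> \<open>A steep slope in the third direction makes the inequality valid on the other level too.\<close>
      have "k * x + l * y + (n - N) * z \<le> n"
        by (rule hull) (use valid N in \<open>fastforce simp: stack_def\<close>)
      then show "k * x + l * y \<le> n" using 1 by simp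
    qed
    then show ?thesis using 1 xyz by (force simp: stack_def)
  next
    case 2
    have "(x,y) \<in> C"
    proof (rule half_closedD[OF C(1)])
      fix k l n assume valid: "\<And>x' y'. (x',y') \<in> C \<Longrightarrow> k * x' + l * y' \<le> n"
      obtain N where N: "\<And>x y. (x,y) \<in> B \<Longrightarrow> k * x + l * y \<le> N" using finite_bound[OF B(2), of k l] by blast
      have "k * x + l * y + (N - n) * z \<le> N"
        by (rule hull) (use valid N in \<open>fastforce simp: stack_def\<close>)
      then show "k * x + l * y \<le> n" using 2 by simp
    qed
    then show ?thesis using 2 xyz by (force simp: stack_def)
  qed
qed

text \<open>Dividing the integer weights by their sum gives a convex combination.\<close>
lemma tri_closed_level:
  assumes A: "hull_closed A"
  shows "tri_closed {(x,y). (x,y,z) \<in> A}"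
  unfolding tri_closed_def
proof (intro ballI allI impI)
  fix a b c :: pt2 and i j k :: nat and u
  assume abc: "a \<in> {(x,y). (x,y,z) \<in> A}" "b \<in> {(x,y). (x,y,z) \<in> A}" "c \<in> {(x,y). (x,y,z) \<in> A}"
    and pos: "0 < i + j + k" and eq: "nmul i a + nmul j b + nmul k c = nmul (i + j + k) u"
  obtain a1 a2 b1 b2 c1 c2 x y where p: "a = (a1,a2)" "b = (b1,b2)" "c = (c1,c2)" "u = (x,y)" by (metis surj_pair)
  define s where "s = real (i + j + k)"
  have s: "s > 0" using pos unfolding s_def of_nat_0_less_iff .
  have "int i * a1 + int j * b1 + int k * c1 = int (i + j + k) * x"
       "int i * a2 + int j * b2 + int k * c2 = int (i + j + k) * y"
    using eq by (simp_all add: p nmul_pair)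
  then have "real_of_int (int i * a1 + int j * b1 + int k * c1) = real_of_int (int (i + j + k) * x)"
     "real_of_int (int i * a2 + int j * b2 + int k * c2) = real_of_int (int (i + j + k) * y)" by presburger+
  then have e: "real i * a1 + real j * b1 + real k * c1 = s * x" "real i * a2 + real j * b2 + real k * c2 = s * y"
    by (simp_all add: s_def)
  have "pt (x,y,z) = (real i / s) *\<^sub>R pt (a1,a2,z) + (real j / s) *\<^sub>R pt (b1,b2,z) + (real k / s) *\<^sub>R pt (c1,c2,z)"
  proof -
    have "real i / s + real j / s + real k / s = 1" using s by (simp add: s_def add_divide_distrib[symmetric])
    then have "real i / s * z + real j / s * z + real k / s * z = z"
      by (simp only: distrib_right[symmetric] mult_1)
    moreover have "(real i * a1 + real j * b1 + real k * c1) / s = x" "(real i * a2 + real j * b2 + real k * c2) / s = y"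
      unfolding e using s by simp_all
    ultimately show ?thesis by (simp add: vec_eq_iff forall_3 add_divide_distrib)
  qed
  moreover have "real i / s + real j / s + real k / s = 1" using s by (simp add: s_def add_divide_distrib[symmetric])
  ultimately have "pt (x,y,z) \<in> convex hull {pt (a1,a2,z), pt (b1,b2,z), pt (c1,c2,z)}"
    unfolding convex_hull_3 using s by (intro CollectI exI[of _ "real i / s"] exI[of _ "real j / s"] exI[of _ "real k / s"]) simp
  moreover have "{pt (a1,a2,z), pt (b1,b2,z), pt (c1,c2,z)} \<subseteq> pt ` A" using abc p by auto
  ultimately have "pt (x,y,z) \<in> convex hull (pt ` A)" using hull_mono by blast
  then show "u \<in> {(x,y). (x,y,z) \<in> A}" using A p by (simp add: hull_closed_def)
qed

definition admissible :: "pt3 set \<Rightarrow> bool" where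
  "admissible A \<longleftrightarrow> card A = 6 \<and> hull_closed A \<and> spans A \<and>
     (\<exists>k l m n. (\<lambda>(x,y,z). k * x + l * y + m * z) ` A = {n, n + 1})"

lemma spans_signs:
  assumes "length L = 6" "\<exists>s\<in>set (signs L). s \<noteq> 0" shows "spans (set L)"
proof -
  obtain a b c d e f where L: "L = [a,b,c,d,e,f]"
    using assms(1) by (auto simp: eval_nat_numeral length_Suc_conv)
  show ?thesis
  proof (rule ccontr)
    assume "\<not> spans (set L)"
    then have "det4 w x y z = 0" if "w \<in> set L" "x \<in> set L" "y \<in> set L" "z \<in> set L" for w x y z
      using that unfolding spans_def by blast
    then show False using assms(2) unfolding L by (simp del: det4.simps)
  qed
qed

lemma admissible_stackl:
  assumes "half_closed (set bs)" "half_closed (set cs)" "bs \<noteq> []" "cs \<noteq> []"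
    "distinct bs" "distinct cs" "length bs + length cs = 6" "\<exists>s\<in>set (signs (stackl bs cs)). s \<noteq> 0"
  shows "admissible (set (stackl bs cs))"
proof -
  have "distinct (stackl bs cs)" using assms(5,6) by (auto simp: stackl_def distinct_map inj_on_def)
  then have "card (set (stackl bs cs)) = 6" using assms(7) by (simp add: distinct_card)
  moreover have "hull_closed (set (stackl bs cs))"
    unfolding set_stackl by (rule hull_closed_stack[OF assms(1) _ assms(2)]) simp_all
  moreover have "spans (set (stackl bs cs))" by (rule spans_signs) (use assms in simp_all)
  moreover have "(\<lambda>(x,y,z). 0 * x + 0 * y + 1 * z) ` set (stackl bs cs) = {0, 0 + 1}"
    using assms(3,4) by (cases bs; cases cs) (auto simp: stackl_def)
  ultimately show ?thesis unfolding admissible_def by blast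
qed

section \<open>Realizing the twenty types\<close>

lemma all_less_12: "(\<forall>i<12. P i) \<longleftrightarrow> P 0 \<and> P 1 \<and> P 2 \<and> P 3 \<and> P 4 \<and> P 5 \<and> P 6 \<and> P 7 \<and> P 8 \<and> P 9 \<and> P 10 \<and> P (11::nat)"
  by (simp add: eval_nat_numeral All_less_Suc conj_ac)

lemma all_less_8: "(\<forall>i<8. P i) \<longleftrightarrow> P 0 \<and> P 1 \<and> P 2 \<and> P 3 \<and> P 4 \<and> P 5 \<and> P 6 \<and> P (7::nat)"
  by (simp add: eval_nat_numeral All_less_Suc conj_ac)

lemma admissible_finite_types: "\<forall>i<12. admissible (set (finite_types ! i))"
  unfolding all_less_12
proof (intro conjI)
  have "finite_types ! 0 = stackl [(-1,0),(0,0),(1,0),(0,1),(1,1)] [(0,0)]"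
    by (simp add: finite_types_def)
  moreover have "admissible (set (stackl [(-1,0),(0,0),(1,0),(0,1),(1,1)] [(0,0)]))"
    by (rule admissible_stackl) (use half_closed_five0 half_closed_point in \<open>simp_all add: stackl_def det3_def\<close>)
  ultimately show "admissible (set (finite_types ! 0))" by simp
  have "finite_types ! 1 = stackl [(-1,0),(0,0),(1,0),(0,1),(0,-1)] [(0,0)]"
    by (simp add: finite_types_def)
  moreover have "admissible (set (stackl [(-1,0),(0,0),(1,0),(0,1),(0,-1)] [(0,0)]))"
    by (rule admissible_stackl) (use half_closed_five1 half_closed_point in \<open>simp_all add: stackl_def det3_def\<close>)
  ultimately show "admissible (set (finite_types ! 1))" by simp
  have "finite_types ! 2 = stackl [(-1,0),(0,0),(1,0),(0,1),(1,-1)] [(0,0)]"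
    by (simp add: finite_types_def)
  moreover have "admissible (set (stackl [(-1,0),(0,0),(1,0),(0,1),(1,-1)] [(0,0)]))"
    by (rule admissible_stackl) (use half_closed_five2 half_closed_point in \<open>simp_all add: stackl_def det3_def\<close>)
  ultimately show "admissible (set (finite_types ! 2))" by simp
  have "finite_types ! 3 = stackl [(-1,0),(0,0),(1,0),(0,1),(2,-1)] [(0,0)]"
    by (simp add: finite_types_def)
  moreover have "admissible (set (stackl [(-1,0),(0,0),(1,0),(0,1),(2,-1)] [(0,0)]))"
    by (rule admissible_stackl) (use half_closed_five3 half_closed_point in \<open>simp_all add: stackl_def det3_def\<close>)
  ultimately show "admissible (set (finite_types ! 3))" by simp
  have "finite_types ! 4 = stackl [(-1,0),(0,0),(1,0),(0,1),(3,-1)] [(0,0)]"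
    by (simp add: finite_types_def)
  moreover have "admissible (set (stackl [(-1,0),(0,0),(1,0),(0,1),(3,-1)] [(0,0)]))"
    by (rule admissible_stackl) (use half_closed_five4 half_closed_point in \<open>simp_all add: stackl_def det3_def\<close>)
  ultimately show "admissible (set (finite_types ! 4))" by simp
  have "finite_types ! 5 = stackl [(0,0),(1,0),(0,1),(1,1)] [(0,0),(1,0)]"
    by (simp add: finite_types_def)
  moreover have "admissible (set (stackl [(0,0),(1,0),(0,1),(1,1)] [(0,0),(1,0)]))"
    by (rule admissible_stackl) (use half_closed_sq half_closed_seg[of 1 0, unfolded seg_def] in \<open>simp_all add: stackl_def det3_def\<close>)
  ultimately show "admissible (set (finite_types ! 5))" by simp
  have "finite_types ! 6 = stackl [(0,0),(1,0),(0,1),(1,1)] [(0,0),(1,1)]"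
    by (simp add: finite_types_def)
  moreover have "admissible (set (stackl [(0,0),(1,0),(0,1),(1,1)] [(0,0),(1,1)]))"
    by (rule admissible_stackl) (use half_closed_sq half_closed_seg[of 1 1, unfolded seg_def] in \<open>simp_all add: stackl_def det3_def\<close>)
  ultimately show "admissible (set (finite_types ! 6))" by simp
  have "finite_types ! 7 = stackl [(-1,0),(0,0),(1,0),(0,1)] [(0,0),(1,1)]"
    by (simp add: finite_types_def)
  moreover have "admissible (set (stackl [(-1,0),(0,0),(1,0),(0,1)] [(0,0),(1,1)]))"
    by (rule admissible_stackl) (use half_closed_edge half_closed_seg[of 1 1, unfolded seg_def] in \<open>simp_all add: stackl_def det3_def\<close>)
  ultimately show "admissible (set (finite_types ! 7))" by simp
  have "finite_types ! 8 = stackl [(-1,0),(0,0),(1,0),(0,1)] [(0,0),(0,1)]"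
    by (simp add: finite_types_def)
  moreover have "admissible (set (stackl [(-1,0),(0,0),(1,0),(0,1)] [(0,0),(0,1)]))"
    by (rule admissible_stackl) (use half_closed_edge half_closed_seg[of 0 1, unfolded seg_def] in \<open>simp_all add: stackl_def det3_def\<close>)
  ultimately show "admissible (set (finite_types ! 8))" by simp
  have "finite_types ! 9 = stackl [(0,0),(1,0),(0,1),(-1,-1)] [(0,0),(1,0)]"
    by (simp add: finite_types_def)
  moreover have "admissible (set (stackl [(0,0),(1,0),(0,1),(-1,-1)] [(0,0),(1,0)]))"
    by (rule admissible_stackl) (use half_closed_cen half_closed_seg[of 1 0, unfolded seg_def] in \<open>simp_all add: stackl_def det3_def\<close>)
  ultimately show "admissible (set (finite_types ! 9))" by simp
  have "finite_types ! 10 = stackl [(0,0),(1,0),(0,1),(-1,-1)] [(0,0),(2,1)]"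
    by (simp add: finite_types_def)
  moreover have "admissible (set (stackl [(0,0),(1,0),(0,1),(-1,-1)] [(0,0),(2,1)]))"
    by (rule admissible_stackl) (use half_closed_cen half_closed_seg[of 2 1, unfolded seg_def] in \<open>simp_all add: stackl_def det3_def\<close>)
  ultimately show "admissible (set (finite_types ! 10))" by simp
  have "finite_types ! 11 = stackl [(0,0),(1,0),(0,1)] [(0,0),(1,0),(1,-1)]"
    by (simp add: finite_types_def)
  moreover have "admissible (set (stackl [(0,0),(1,0),(0,1)] [(0,0),(1,0),(1,-1)]))"
    by (rule admissible_stackl) (use half_closed_tri half_closed_corner[of 1 "-1" 0 1, unfolded corner_def] in \<open>simp_all add: stackl_def det3_def\<close>)
  ultimately show "admissible (set (finite_types ! 11))" by simp
qed

text \<open>One parameter moves to infinity without changing signs; a coordinate equal to one keeps an upper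
  segment primitive, and for the generic pair of triangles \<open>n * 2 - (2 * n - 1) = 1\<close> keeps the
  upper triangle unimodular.\<close>
lemma unbounded_families:
  assumes n: "n \<ge> 4"
  shows "\<forall>i<8. \<exists>L. length L = 6 \<and> signs L = signs (infinite_types ! i) \<and> admissible (set L) \<and>
    (\<exists>a\<in>set L. \<exists>b\<in>set L. \<exists>c\<in>set L. \<exists>d\<in>set L. n \<le> \<bar>det4 a b c d\<bar>)" (is "\<forall>i<8. ?P i")
proof -
  have family: "?P i"
    if "half_closed (set bs)" "half_closed (set cs)" "bs \<noteq> []" "cs \<noteq> []" "distinct bs" "distinct cs"
      "length bs + length cs = 6" and signs: "signs (stackl bs cs) = signs (infinite_types ! i)"
      and nonzero: "\<exists>s\<in>set (signs (infinite_types ! i)). s \<noteq> 0"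
      and vol: "{a,b,c,d} \<subseteq> set (stackl bs cs)" "n \<le> \<bar>det4 a b c d\<bar>"
    for bs cs i a b c d
  proof (intro exI[of _ "stackl bs cs"] conjI)
    show "admissible (set (stackl bs cs))"
      by (rule admissible_stackl) (use that in simp_all)
    show "\<exists>a\<in>set (stackl bs cs). \<exists>b\<in>set (stackl bs cs). \<exists>c\<in>set (stackl bs cs). \<exists>d\<in>set (stackl bs cs).
        n \<le> \<bar>det4 a b c d\<bar>" using vol by blast
  qed (use that in simp_all)
  have coprime: "coprime 1 n" "coprime n 1" by simp_all
  show ?thesis
    unfolding all_less_8
  proof (intro conjI)
    show "?P 0"
      by (rule family[of "[(0,0),(1,0),(2,0),(3,0)]" "[(0,0),(1,n)]" 0 "(0,0,0)" "(1,0,0)" "(0,0,1)" "(1,n,1)"])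
         (use n half_closed_line4 half_closed_seg[OF coprime(1), unfolded seg_def] in \<open>simp_all add: infinite_types_def sign_simps algebra_simps\<close>)
    show "?P 1"
      by (rule family[of "[(-1,0),(0,0),(1,0)]" "[(-1,-n),(0,0),(1,n)]" 1 "(0,0,0)" "(1,0,0)" "(0,0,1)" "(1,n,1)"])
         (use n half_closed_line3 half_closed_seg3[OF coprime(1), unfolded seg3_def] in \<open>simp_all add: infinite_types_def sign_simps algebra_simps\<close>)
    show "?P 2"
      by (rule family[of "[(0,0),(1,0),(0,1)]" "[(0,0),(n,1),(2*n-1,2)]" 2 "(0,0,0)" "(0,1,0)" "(0,0,1)" "(n,1,1)"])
         (use n half_closed_tri half_closed_corner[of n 2 1 "2*n-1", unfolded corner_def] in \<open>simp_all add: infinite_types_def sign_simps algebra_simps\<close>)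
    show "?P 3"
      by (rule family[of "[(0,0),(1,0),(0,1),(1,1)]" "[(0,0),(n,1)]" 3 "(0,0,0)" "(0,1,0)" "(0,0,1)" "(n,1,1)"])
         (use n half_closed_sq half_closed_seg[OF coprime(2), unfolded seg_def] in \<open>simp_all add: infinite_types_def sign_simps algebra_simps\<close>)
    show "?P 4"
      by (rule family[of "[(-1,0),(0,0),(1,0),(0,1)]" "[(0,0),(1,n)]" 4 "(0,0,0)" "(1,0,0)" "(0,0,1)" "(1,n,1)"])
         (use n half_closed_edge half_closed_seg[OF coprime(1), unfolded seg_def] in \<open>simp_all add: infinite_types_def sign_simps algebra_simps\<close>)
    show "?P 5"
      by (rule family[of "[(-1,0),(0,0),(1,0),(0,1)]" "[(0,0),(n,1)]" 5 "(0,0,0)" "(0,1,0)" "(0,0,1)" "(n,1,1)"])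
         (use n half_closed_edge half_closed_seg[OF coprime(2), unfolded seg_def] in \<open>simp_all add: infinite_types_def sign_simps algebra_simps\<close>)
    show "?P 6"
      by (rule family[of "[(0,0),(1,0),(0,1),(-1,-1)]" "[(0,0),(n,1)]" 6 "(0,0,0)" "(0,1,0)" "(0,0,1)" "(n,1,1)"])
         (use n half_closed_cen half_closed_seg[OF coprime(2), unfolded seg_def] in \<open>simp_all add: infinite_types_def sign_simps algebra_simps\<close>)
    show "?P 7"
      by (rule family[of "[(0,0),(1,0),(0,1)]" "[(0,0),(1,0),(n,-1)]" 7 "(0,0,0)" "(0,1,0)" "(0,0,1)" "(n,-1,1)"])
         (use n half_closed_tri half_closed_corner[of 1 "-1" 0 n, unfolded corner_def] in \<open>simp_all add: infinite_types_def sign_simps algebra_simps\<close>)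
  qed
qed

section \<open>Oriented matroids of integer configurations\<close>

text \<open>Any numbering of the six labels serves; oriented matroids are considered up to relabeling.\<close>
definition idx :: "6 \<Rightarrow> nat" where "idx = (SOME f. bij_betw f UNIV {..<6})"

lemma bij_idx: "bij_betw idx UNIV {..<6}"
proof -
  have "\<exists>f. bij_betw f (UNIV :: 6 set) {..<6::nat}"
    by (rule finite_same_card_bij) simp_all
  then show ?thesis unfolding idx_def by (rule someI_ex)
qed

lemma idx_less: "idx i < 6" using bij_idx by (auto simp: bij_betw_def)

definition labeling :: "pt3 list \<Rightarrow> 6 \<Rightarrow> pt3" where "labeling L = (\<lambda>i. L ! idx i)"

definition int_om :: "(6 \<Rightarrow> pt3) \<Rightarrow> sign_map" where
  "int_om q = (\<lambda>i j k l. of_int (sgn (det4 (q i) (q j) (q k) (q l))))"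

lemma bij_labeling:
  assumes "length L = 6" "distinct L" shows "bij_betw (labeling L) UNIV (set L)"
proof -
  have "bij_betw (\<lambda>n. L ! n) {..<6} (set L)" using assms by (intro bij_betw_nth) auto
  then show ?thesis using bij_betw_trans[OF bij_idx] by (simp add: labeling_def comp_def)
qed

lemma det4_swap:
  "det4 b a c d = - det4 a b c d" "det4 a c b d = - det4 a b c d" "det4 a b d c = - det4 a b c d"
proof -
  obtain a1 a2 a3 b1 b2 b3 c1 c2 c3 d1 d2 d3
    where p: "a = (a1,a2,a3)" "b = (b1,b2,b3)" "c = (c1,c2,c3)" "d = (d1,d2,d3)" by (metis surj_pair)
  show "det4 b a c d = - det4 a b c d" unfolding p det4.simps det3_def by algebra
  show "det4 a c b d = - det4 a b c d" unfolding p det4.simps det3_def by algebra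
  show "det4 a b d c = - det4 a b c d" unfolding p det4.simps det3_def by algebra
qed

lemma det4_equal:
  "det4 u u v w = 0" "det4 u v v w = 0" "det4 u v w w = 0" "det4 u v u w = 0" "det4 v u w u = 0" "det4 u v w u = 0"
proof -
  have z: "det4 u u v w = 0" "det4 u v v w = 0" "det4 u v w w = 0" for u v w
    using det4_swap(1)[of u u v w] det4_swap(2)[of u v v w] det4_swap(3)[of u v w w] by simp_all
  show "det4 u u v w = 0" "det4 u v v w = 0" "det4 u v w w = 0" by (fact z)+
  show "det4 u v u w = 0" "det4 v u w u = 0"
    using det4_swap(2)[of u v u w] det4_swap(3)[of v u w u] by (simp_all only: z neg_equal_0_iff_equal)
  then show "det4 u v w u = 0"
    using det4_swap(3)[of u v w u] by (simp only: z neg_equal_0_iff_equal)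
qed

text \<open>Insertion sort: invariance under the three adjacent transpositions moves one index after the
  other into place.\<close>
lemma symmetric_from_sorted:
  fixes P :: "nat \<Rightarrow> nat \<Rightarrow> nat \<Rightarrow> nat \<Rightarrow> bool"
  assumes swap: "\<And>i j k l. P i j k l \<Longrightarrow> P j i k l" "\<And>i j k l. P i j k l \<Longrightarrow> P i k j l" "\<And>i j k l. P i j k l \<Longrightarrow> P i j l k"
    and sorted: "\<And>i j k l. i \<le> j \<Longrightarrow> j \<le> k \<Longrightarrow> k \<le> l \<Longrightarrow> l < n \<Longrightarrow> P i j k l"
    and "i < n" "j < n" "k < n" "l < n"
  shows "P i j k l"
proof -
  have sort3: "P i j k l" if "i \<le> j" "j \<le> k" "k < n" "l < n" for i j k l
  proof -
    consider "k \<le> l" | "j \<le> l" "l \<le> k" | "i \<le> l" "l \<le> j" | "l \<le> i" by linarith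
    then show ?thesis
    proof cases
      case 1 then show ?thesis using that by (intro sorted)
    next
      case 2 then have "P i j l k" using that by (intro sorted)
      then show ?thesis by (rule swap)
    next
      case 3 then have "P i l j k" using that by (intro sorted)
      then show ?thesis by (rule swap(3)[OF swap(2)])
    next
      case 4 then have "P l i j k" using that by (intro sorted)
      then show ?thesis by (rule swap(3)[OF swap(2)[OF swap(1)]])
    qed
  qed
  have sort2: "P i j k l" if "i \<le> j" "j < n" "k < n" "l < n" for i j k l
  proof -
    consider "j \<le> k" | "i \<le> k" "k \<le> j" | "k \<le> i" by linarith
    then show ?thesis
    proof cases
      case 1 then show ?thesis using that by (intro sort3)
    next
      case 2 then have "P i k j l" using that by (intro sort3)
      then show ?thesis by (rule swap)
    next
      case 3 then have "P k i j l" using that by (intro sort3) simp_all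
      then show ?thesis by (rule swap(2)[OF swap(1)])
    qed
  qed
  show ?thesis
  proof (cases "i \<le> j")
    case True then show ?thesis using assms(5-8) by (intro sort2)
  next
    case False then have "P j i k l" using assms(5-8) by (intro sort2) simp_all
    then show ?thesis by (rule swap)
  qed
qed

lemma int_om_signs:
  assumes L: "length L = 6" "length L' = 6" and eq: "signs L = signs L'"
  shows "int_om (labeling L) = int_om (labeling L')"
proof -
  define P where "P i j k l \<longleftrightarrow> sgn (det4 (L!i) (L!j) (L!k) (L!l)) = sgn (det4 (L'!i) (L'!j) (L'!k) (L'!l))" for i j k l
  obtain a b c d e f where La: "L = [a,b,c,d,e,f]" using L(1) by (auto simp: eval_nat_numeral length_Suc_conv)
  obtain a' b' c' d' e' f' where La': "L' = [a',b',c',d',e',f']" using L(2) by (auto simp: eval_nat_numeral length_Suc_conv)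
  have swap: "P j i k l" "P i k j l" "P i j l k" if "P i j k l" for i j k l
    using that unfolding P_def
    by (simp_all only: det4_swap(1)[of "_ ! j" "_ ! i"] det4_swap(2)[of _ "_ ! k" "_ ! j"] det4_swap(3)[of _ _ "_ ! l" "_ ! k"] idom_abs_sgn_class.sgn_minus)
  have nth6: "[u0,u1,u2,u3,u4,u5] ! 0 = u0" "[u0,u1,u2,u3,u4,u5] ! 1 = u1" "[u0,u1,u2,u3,u4,u5] ! 2 = u2"
    "[u0,u1,u2,u3,u4,u5] ! 3 = u3" "[u0,u1,u2,u3,u4,u5] ! 4 = u4" "[u0,u1,u2,u3,u4,u5] ! 5 = u5"
    for u0 u1 u2 u3 u4 u5 :: pt3 by simp_all
  note signs_eq = eq[unfolded La La' signs.simps list.map list.inject]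
  have strict: "P i j k l" if "i < j" "j < k" "k < l" "l < 6" for i j k l
  proof -
    have "i \<in> {0,1,2}" "j \<in> {1,2,3}" "k \<in> {2,3,4}" "l \<in> {3,4,5}" using that by auto
    then have "(i,j,k,l) \<in> {(0,1,2,3),(0,1,2,4),(0,1,2,5),(0,1,3,4),(0,1,3,5),(0,1,4,5),(0,2,3,4),(0,2,3,5),(0,2,4,5),(0,3,4,5),(1,2,3,4),(1,2,3,5),(1,2,4,5),(1,3,4,5),(2,3,4,5)}"
      by (elim insertE emptyE) (use that in simp_all)
    then show ?thesis
      by (elim insertE emptyE; simp only: prod.inject; elim conjE; simp only: P_def La La' nth6 signs_eq)
  qed
  have sorted: "P i j k l" if "i \<le> j" "j \<le> k" "k \<le> l" "l < 6" for i j k l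
  proof (cases "i < j \<and> j < k \<and> k < l")
    case False
    then have "i = j \<or> j = k \<or> k = l" using that by linarith
    then show ?thesis unfolding P_def by (elim disjE) (simp_all only: det4_equal)
  qed (use that strict in blast)
  have "P i j k l" if "i < 6" "j < 6" "k < 6" "l < 6" for i j k l
    by (rule symmetric_from_sorted[of P 6, OF swap(1) swap(2) swap(3) sorted]) (use that in simp_all)
  then have "P (idx i) (idx j) (idx k) (idx l)" for i j k l by (simp add: idx_less)
  then show ?thesis by (simp add: int_om_def labeling_def P_def fun_eq_iff)
qed

lemma equiv_om: "equiv UNIV om_isomorphism"
proof (rule equivI)
  show "om_isomorphism \<subseteq> UNIV \<times> UNIV" by simp
  show "refl om_isomorphism"
    unfolding refl_on_def om_isomorphism_def by (auto intro!: exI[of _ id])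
  show "sym om_isomorphism"
  proof (rule symI)
    fix X Y assume "(X, Y) \<in> om_isomorphism"
    then obtain \<pi> s where \<pi>: "bij \<pi>" and s: "s \<in> {1,-1}"
      and Y: "\<And>i j k l. Y i j k l = s * X (\<pi> i) (\<pi> j) (\<pi> k) (\<pi> l)" by (auto simp: om_isomorphism_def)
    have "X i j k l = s * Y (inv \<pi> i) (inv \<pi> j) (inv \<pi> k) (inv \<pi> l)" for i j k l
      using s by (auto simp: Y surj_f_inv_f[OF bij_is_surj[OF \<pi>]])
    then show "(Y, X) \<in> om_isomorphism"
      unfolding om_isomorphism_def using s bij_imp_bij_inv[OF \<pi>] by blast
  qed
  show "trans om_isomorphism"
  proof (rule transI)
    fix X Y Z assume XY: "(X, Y) \<in> om_isomorphism" and YZ: "(Y, Z) \<in> om_isomorphism"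
    obtain \<pi> s where \<pi>: "bij \<pi>" and s: "s \<in> {1,-1}"
      and Y: "\<And>i j k l. Y i j k l = s * X (\<pi> i) (\<pi> j) (\<pi> k) (\<pi> l)" using XY by (auto simp: om_isomorphism_def)
    obtain \<rho> t where \<rho>: "bij \<rho>" and t: "t \<in> {1,-1}"
      and Z: "\<And>i j k l. Z i j k l = t * Y (\<rho> i) (\<rho> j) (\<rho> k) (\<rho> l)" using YZ by (auto simp: om_isomorphism_def)
    have "Z i j k l = (t * s) * X ((\<pi> \<circ> \<rho>) i) ((\<pi> \<circ> \<rho>) j) ((\<pi> \<circ> \<rho>) k) ((\<pi> \<circ> \<rho>) l)" for i j k l
      by (simp add: Y Z)
    moreover have "t * s \<in> {1,-1}" using s t by auto
    ultimately show "(X, Z) \<in> om_isomorphism"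
      unfolding om_isomorphism_def using bij_comp[OF \<rho> \<pi>] by blast
  qed
qed


lemma int_om_relabel:
  assumes "bij_betw q UNIV A" "bij_betw q' UNIV A"
  shows "(int_om q, int_om q') \<in> om_isomorphism"
proof -
  define \<pi> where "\<pi> = inv_into UNIV q \<circ> q'"
  have "bij \<pi>" unfolding \<pi>_def by (rule bij_betw_trans[OF assms(2) bij_betw_inv_into[OF assms(1)]])
  moreover have "q (\<pi> i) = q' i" for i
    using assms by (auto simp: \<pi>_def bij_betw_def intro!: f_inv_into_f)
  ultimately show ?thesis
    unfolding om_isomorphism_def by (auto simp: int_om_def intro!: exI[of _ \<pi>] exI[of _ 1])
qed

lemma int_om_lat_aut:
  assumes "lat_aut T" shows "(int_om q, int_om (T \<circ> q)) \<in> om_isomorphism"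
proof -
  obtain s where s: "s = 1 \<or> s = -1" "\<And>u v w x. det4 (T u) (T v) (T w) (T x) = s * det4 u v w x"
    using lat_aut_det4[OF assms] by blast
  show ?thesis unfolding om_isomorphism_def
    by (rule CollectI, rule case_prodI, rule exI[of _ id], rule exI[of _ "of_int s"])
       (use s in \<open>auto simp: int_om_def sgn_mult simp del: det4.simps\<close>)
qed

text \<open>For a triple of points the inner sum is the balance of points on the two sides of its plane.
  Even powers remove the orientation of the triple and the global sign; grouping by pairs
  separates types whose triples alone have the same balances.\<close>
definition om_invariant :: "sign_map \<Rightarrow> real" where
  "om_invariant X = (\<Sum>i\<in>UNIV. \<Sum>j\<in>UNIV. (\<Sum>k\<in>UNIV. (\<Sum>l\<in>UNIV. X i j k l)^2)^2)"

text \<open>The invariant on integer data, in a form that can be evaluated by rewriting.\<close>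
definition list_invariant :: "pt3 list \<Rightarrow> int" where
  "list_invariant L = (\<Sum>a\<leftarrow>L. \<Sum>b\<leftarrow>L. (\<Sum>c\<leftarrow>L. (\<Sum>d\<leftarrow>L. sgn (det4 a b c d))^2)^2)"

lemma om_invariant_iso:
  assumes "(X, Y) \<in> om_isomorphism" shows "om_invariant Y = om_invariant X"
proof -
  obtain \<pi> s where \<pi>: "bij \<pi>" and s: "s \<in> {1,-1}"
    and Y: "\<And>i j k l. Y i j k l = s * X (\<pi> i) (\<pi> j) (\<pi> k) (\<pi> l)"
    using assms by (auto simp: om_isomorphism_def)
  have re: "(\<Sum>i\<in>UNIV. f (\<pi> i)) = (\<Sum>i\<in>UNIV. f i)" for f :: "6 \<Rightarrow> real"
    by (rule sum.reindex_bij_betw[OF \<pi>])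
  have "(\<Sum>l\<in>UNIV. Y i j k l)^2 = (\<Sum>l\<in>UNIV. X (\<pi> i) (\<pi> j) (\<pi> k) l)^2" for i j k
    using s by (auto simp: Y sum_negf re[of "X (\<pi> i) (\<pi> j) (\<pi> k)"])
  then show ?thesis unfolding om_invariant_def
    by (simp add: re[of "\<lambda>k. (\<Sum>l\<in>UNIV. X (\<pi> _) (\<pi> _) k l)^2"] re[of "\<lambda>j. (\<Sum>k\<in>UNIV. (\<Sum>l\<in>UNIV. X (\<pi> _) j k l)^2)^2"]
      re[of "\<lambda>i. \<Sum>j\<in>UNIV. (\<Sum>k\<in>UNIV. (\<Sum>l\<in>UNIV. X i j k l)^2)^2"])
qed

lemma sum_labeling:
  assumes "length L = 6"
  shows "(\<Sum>i\<in>UNIV. f (labeling L i)) = (\<Sum>a\<leftarrow>L. f a :: real)"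
proof -
  have "(\<Sum>i\<in>UNIV. f (L ! idx i)) = (\<Sum>n<6. f (L ! n))"
    by (rule sum.reindex_bij_betw[OF bij_idx])
  also have "\<dots> = (\<Sum>a\<leftarrow>L. f a)" using assms by (simp add: sum_list_sum_nth atLeast0LessThan)
  finally show ?thesis by (simp add: labeling_def)
qed

lemma of_int_sum_list: "of_int (\<Sum>a\<leftarrow>L. f a) = (\<Sum>a\<leftarrow>L. of_int (f a) :: real)"
  by (induction L) simp_all

lemma om_invariant_labeling:
  assumes "length L = 6" shows "om_invariant (int_om (labeling L)) = of_int (list_invariant L)"
  unfolding om_invariant_def int_om_def list_invariant_def
  by (simp only: of_int_sum_list of_int_power
     sum_labeling[OF assms, of "\<lambda>d. of_int (sgn (det4 (labeling L _) (labeling L _) (labeling L _) d))"]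
     sum_labeling[OF assms, of "\<lambda>c. (\<Sum>d\<leftarrow>L. of_int (sgn (det4 (labeling L _) (labeling L _) c d)))^2"]
     sum_labeling[OF assms, of "\<lambda>b. (\<Sum>c\<leftarrow>L. (\<Sum>d\<leftarrow>L. of_int (sgn (det4 (labeling L _) b c d)))^2)^2"]
     sum_labeling[OF assms, of "\<lambda>a. \<Sum>b\<leftarrow>L. (\<Sum>c\<leftarrow>L. (\<Sum>d\<leftarrow>L. of_int (sgn (det4 a b c d)))^2)^2"])

lemma finite_type_invariants:
  "map list_invariant finite_types = [4304, 3792, 4176, 2960, 3280, 6624, 8080, 5384, 5832, 6992, 6416, 7776]"
  by code_simp

lemma infinite_type_invariants:
  "map list_invariant infinite_types = [2128, 3328, 9696, 8656, 6312, 6440, 7440, 9168]"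
  by code_simp

section \<open>Determinants, affine independence and integer functionals\<close>

lemma vector_4:
  "(vector [w,x,y,z] :: 'a::zero^4) $ 1 = w" "(vector [w,x,y,z] :: 'a::zero^4) $ 2 = x"
  "(vector [w,x,y,z] :: 'a::zero^4) $ 3 = y" "(vector [w,x,y,z] :: 'a::zero^4) $ 4 = z"
  unfolding vector_def by simp_all

lemma det_4:
  "det (A::'a::comm_ring_1^4^4) =
     A$1$1 * (A$2$2 * (A$3$3 * A$4$4 - A$3$4 * A$4$3) - A$2$3 * (A$3$2 * A$4$4 - A$3$4 * A$4$2)
       + A$2$4 * (A$3$2 * A$4$3 - A$3$3 * A$4$2))
   - A$1$2 * (A$2$1 * (A$3$3 * A$4$4 - A$3$4 * A$4$3) - A$2$3 * (A$3$1 * A$4$4 - A$3$4 * A$4$1)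
       + A$2$4 * (A$3$1 * A$4$3 - A$3$3 * A$4$1))
   + A$1$3 * (A$2$1 * (A$3$2 * A$4$4 - A$3$4 * A$4$2) - A$2$2 * (A$3$1 * A$4$4 - A$3$4 * A$4$1)
       + A$2$4 * (A$3$1 * A$4$2 - A$3$2 * A$4$1))
   - A$1$4 * (A$2$1 * (A$3$2 * A$4$3 - A$3$3 * A$4$2) - A$2$2 * (A$3$1 * A$4$3 - A$3$3 * A$4$1)
       + A$2$3 * (A$3$1 * A$4$2 - A$3$2 * A$4$1))"
proof -
  have f1234: "finite {2::4, 3, 4}" "1 \<notin> {2::4, 3, 4}" by auto
  have f234: "finite {3::4, 4}" "2 \<notin> {3::4, 4}" by auto
  have f34: "finite {4::4}" "3 \<notin> {4::4}" by auto
  show ?thesis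
    unfolding det_def UNIV_4
    unfolding sum_over_permutations_insert[OF f1234]
    unfolding sum_over_permutations_insert[OF f234]
    unfolding sum_over_permutations_insert[OF f34]
    unfolding permutes_sing
    by (simp add: sign_swap_id permutation_swap_id permutation_compose sign_compose sign_id swap_id_eq algebra_simps)
qed

lemma oriented_matroid_pt: "oriented_matroid (pt \<circ> q) = int_om q"
proof -
  have "det (vector
     [vector [1, 1, 1, 1],
      vector [pt a $ 1, pt b $ 1, pt c $ 1, pt d $ 1],
      vector [pt a $ 2, pt b $ 2, pt c $ 2, pt d $ 2],
      vector [pt a $ 3, pt b $ 3, pt c $ 3, pt d $ 3]] :: real ^ 4 ^ 4) = of_int (det4 a b c d)" for a b c d
    by (cases a; cases b; cases c; cases d) (simp add: det_4 vector_4 det3_def algebra_simps)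
  moreover have "sgn (real_of_int n) = of_int (sgn n)" for n by (simp add: sgn_if)
  ultimately show ?thesis by (simp add: oriented_matroid_def int_om_def fun_eq_iff)
qed

lemma linear_pt:
  assumes "linear f" shows "f (pt (x,y,z)) = x *\<^sub>R f (pt (1,0,0)) + y *\<^sub>R f (pt (0,1,0)) + z *\<^sub>R f (pt (0,0,1))"
proof -
  have "pt (x,y,z) = of_int x *\<^sub>R pt (1,0,0) + of_int y *\<^sub>R pt (0,1,0) + of_int z *\<^sub>R pt (0,0,1)"
    by (simp add: vec_eq_iff forall_3)
  then show ?thesis by (simp add: linear_add[OF assms] linear_scale[OF assms])
qed

lemma functional_form:
  assumes "f \<in> int_functionals"
  obtains k l m where "\<And>x y z. f (pt (x,y,z)) = of_int (k * x + l * y + m * z)" "(k,l,m) \<noteq> (0,0,0)"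
proof -
  have f: "linear f" "f ` int_lattice \<subseteq> \<int>" "\<not> f constant_on int_lattice"
    using assms by (auto simp: int_functionals_def)
  have "f (pt u) \<in> \<int>" for u using f(2) range_pt by blast
  then obtain k l m where klm: "f (pt (1,0,0)) = of_int k" "f (pt (0,1,0)) = of_int l" "f (pt (0,0,1)) = of_int m"
    by (meson Ints_cases)
  have form: "f (pt (x,y,z)) = of_int (k * x + l * y + m * z)" for x y z
    unfolding linear_pt[OF f(1), of x y z] klm by (simp add: mult.commute)
  moreover have "(k,l,m) \<noteq> (0,0,0)"
  proof
    assume "(k,l,m) = (0,0,0)"
    then have z: "k = 0" "l = 0" "m = 0" by simp_all
    have "f v = 0" if "v \<in> int_lattice" for v
    proof -
      obtain u where "v = pt u" using \<open>v \<in> int_lattice\<close> unfolding range_pt[symmetric] by (rule rangeE)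
      then show ?thesis by (cases u) (simp add: form z)
    qed
    then show False using f(3) unfolding constant_on_def by blast
  qed
  ultimately show thesis using that by blast
qed

lemma functional_inner:
  assumes "(k,l,m) \<noteq> (0,0,0)" shows "(\<lambda>v. pt (k,l,m) \<bullet> v) \<in> int_functionals"
    and "pt (k,l,m) \<bullet> pt (x,y,z) = of_int (k * x + l * y + m * z)"
proof -
  show form: "pt (k,l,m) \<bullet> pt (x,y,z) = of_int (k * x + l * y + m * z)" for x y z
    by (simp add: inner_vec_def sum_3)
  have "linear (\<lambda>v. pt (k,l,m) \<bullet> v)" by (rule bounded_linear.linear[OF bounded_linear_inner_right])
  moreover have "(\<lambda>v. pt (k,l,m) \<bullet> v) ` int_lattice \<subseteq> \<int>"
    unfolding range_pt[symmetric] using form by force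
  moreover have "\<not> (\<lambda>v. pt (k,l,m) \<bullet> v) constant_on int_lattice"
  proof
    assume "(\<lambda>v. pt (k,l,m) \<bullet> v) constant_on int_lattice"
    then obtain c where c: "\<And>u. pt (k,l,m) \<bullet> pt u = c" unfolding constant_on_def range_pt[symmetric] by auto
    have "pt (k,l,m) \<bullet> pt u = pt (k,l,m) \<bullet> pt (0,0,0)" for u unfolding c ..
    from this[of "(1,0,0)"] this[of "(0,1,0)"] this[of "(0,0,1)"]
    have "k = 0" "l = 0" "m = 0" unfolding form by simp_all
    then show False using assms by simp
  qed
  ultimately show "(\<lambda>v. pt (k,l,m) \<bullet> v) \<in> int_functionals" by (simp add: int_functionals_def)
qed

lemma affine_independent_spans:
  assumes "T \<subseteq> pt ` A" "card T = 4" "\<not> affine_dependent T" shows "spans A"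
proof (rule ccontr)
  assume ns: "\<not> spans A"
  have fin: "finite T" using assms(2) by (intro card_ge_0_finite) simp
  obtain t1 t2 t3 t4 where T: "T = {t1,t2,t3,t4}" and dist: "distinct [t1,t2,t3,t4]"
  proof -
    obtain ts where "set ts = T" "distinct ts" using finite_distinct_list[OF fin] by blast
    then have "length ts = 4" using assms(2) distinct_card by force
    then obtain a b c d where "ts = [a,b,c,d]" by (auto simp: eval_nat_numeral length_Suc_conv)
    then show thesis using that \<open>set ts = T\<close> \<open>distinct ts\<close> by auto
  qed
  obtain a b c d where abcd: "t1 = pt a" "t2 = pt b" "t3 = pt c" "t4 = pt d" "a \<in> A" "b \<in> A" "c \<in> A" "d \<in> A"
    using assms(1) T by auto
  have zero: "det4 a b c d = 0" using ns abcd unfolding spans_def by blast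
  define M :: "real^3^3" where "M = vector [pt b - pt a, pt c - pt a, pt d - pt a]"
  have "det M = of_int (det4 a b c d)"
    by (cases a; cases b; cases c; cases d) (simp add: M_def det_3 det3_def algebra_simps)
  then have "\<not> invertible M" using zero by (simp add: invertible_det_nz)
  then have "\<not> (\<exists>B. M ** B = mat 1)" by (simp add: invertible_right_inverse)
  then obtain u where u: "(\<Sum>i\<in>UNIV. u i *s row i M) = 0" "\<exists>i. u i \<noteq> 0"
    unfolding matrix_right_invertible_independent_rows by blast
  have comb: "u 1 *\<^sub>R (pt b - pt a) + u 2 *\<^sub>R (pt c - pt a) + u 3 *\<^sub>R (pt d - pt a) = 0"
    using u(1) by (simp add: sum_3 row_def M_def vec_eq_iff forall_3 algebra_simps)
  define U where "U v = (if v = t1 then - (u 1 + u 2 + u 3) else if v = t2 then u 1 else if v = t3 then u 2 else u 3)" for v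
  have Uv: "U t1 = - (u 1 + u 2 + u 3)" "U t2 = u 1" "U t3 = u 2" "U t4 = u 3" using dist by (auto simp: U_def)
  have "sum U T = U t1 + (U t2 + (U t3 + U t4))" using dist unfolding T by simp
  then have "sum U T = 0" by (simp add: Uv)
  moreover have "(\<Sum>v\<in>T. U v *\<^sub>R v) = 0"
  proof -
    have "(\<Sum>v\<in>T. U v *\<^sub>R v) = U t1 *\<^sub>R t1 + (U t2 *\<^sub>R t2 + (U t3 *\<^sub>R t3 + U t4 *\<^sub>R t4))"
      using dist unfolding T by simp
    also have "\<dots> = - (u 1 + u 2 + u 3) *\<^sub>R t1 + (u 1 *\<^sub>R t2 + (u 2 *\<^sub>R t3 + u 3 *\<^sub>R t4))"
      by (simp only: Uv)
    also have "\<dots> = u 1 *\<^sub>R (pt b - pt a) + u 2 *\<^sub>R (pt c - pt a) + u 3 *\<^sub>R (pt d - pt a)"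
      unfolding abcd by (simp add: algebra_simps)
    finally show ?thesis using comb by simp
  qed
  moreover have "\<exists>v\<in>T. U v \<noteq> 0"
  proof -
    have "u 1 \<noteq> 0 \<or> u 2 \<noteq> 0 \<or> u 3 \<noteq> 0" using u(2) by (metis exhaust_3)
    then show ?thesis unfolding T using Uv by auto
  qed
  ultimately have "affine_dependent T" using affine_dependent_explicit_finite[OF fin] by blast
  then show False using assms(3) by simp
qed

lemma spans_affine_independent:
  assumes "spans A" obtains T where "T \<subseteq> pt ` A" "card T = 4" "\<not> affine_dependent T"
proof -
  obtain a b c d where abcd: "a \<in> A" "b \<in> A" "c \<in> A" "d \<in> A" and D: "det4 a b c d \<noteq> 0"
    using assms by (auto simp: spans_def)
  have dist: "distinct [a,b,c,d]" using D by (auto simp: det4_equal simp del: det4.simps)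
  define T where "T = {pt a, pt b, pt c, pt d}"
  have "card T = 4" using dist by (simp add: T_def)
  moreover have "\<not> affine_dependent T"
  proof
    assume "affine_dependent T"
    then obtain U where U: "sum U T = 0" "\<exists>v\<in>T. U v \<noteq> 0" "(\<Sum>v\<in>T. U v *\<^sub>R v) = 0"
      using affine_dependent_explicit_finite[of T] by (auto simp: T_def)
    define r s t where "r = U (pt b)" "s = U (pt c)" "t = U (pt d)"
    have "U (pt a) + (r + (s + t)) = 0" using U(1) dist by (simp add: T_def r_s_t_def)
    then have a: "U (pt a) = - r - s - t" by simp
    have "U (pt a) *\<^sub>R pt a + (r *\<^sub>R pt b + (s *\<^sub>R pt c + t *\<^sub>R pt d)) = 0"
      using U(3) dist by (simp add: T_def r_s_t_def)
    then have "r *\<^sub>R (pt b - pt a) + s *\<^sub>R (pt c - pt a) + t *\<^sub>R (pt d - pt a) = 0"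
      unfolding a by (simp add: algebra_simps)
    then have comb: "r * (pt b - pt a) $ i + s * (pt c - pt a) $ i + t * (pt d - pt a) $ i = 0" for i
      by (simp add: vec_eq_iff)
    define M :: "real^3^3" where "M = vector [pt b - pt a, pt c - pt a, pt d - pt a]"
    have "det M = of_int (det4 a b c d)"
      by (cases a; cases b; cases c; cases d) (simp add: M_def det_3 det3_def algebra_simps)
    then have "\<exists>B. M ** B = mat 1" using D by (simp add: invertible_det_nz invertible_right_inverse[symmetric])
    moreover have "(\<Sum>i\<in>UNIV. (if i = 1 then r else if i = 2 then s else t) *s row i M) = 0"
      using comb by (simp add: sum_3 row_def M_def vec_eq_iff forall_3 algebra_simps)
    ultimately have "(if i = 1 then r else if i = 2 then s else t) = 0" for i :: 3
      unfolding matrix_right_invertible_independent_rows by (elim allE[of _ "\<lambda>i. if i = 1 then r else if i = 2 then s else t"]) blast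
    from this[of 1] this[of 2] this[of 3] have "r = 0" "s = 0" "t = 0" by simp_all
    then show False using U(2) a by (auto simp: T_def r_s_t_def)
  qed
  ultimately show thesis using that[of T] abcd by (auto simp: T_def)
qed

section \<open>Polytopes and their lattice points\<close>

definition pt_hull :: "pt3 set \<Rightarrow> (real^3) set" where "pt_hull A = convex hull (pt ` A)"

definition lattice_points :: "(real^3) set \<Rightarrow> pt3 set" where "lattice_points P = {u. pt u \<in> P}"

lemma pt_image_lattice_points: "pt ` lattice_points P = P \<inter> int_lattice"
  unfolding range_pt[symmetric] lattice_points_def by auto

lemma lattice_points_pt_hull: "hull_closed A \<Longrightarrow> lattice_points (pt_hull A) = A"
  unfolding hull_closed_def lattice_points_def pt_hull_def by (auto intro: hull_inc)

text \<open>An integer functional that is constant on a spanning set vanishes; otherwise two of its integer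
  values differ by at least one, so no width is below one.\<close>
lemma functional_values:
  assumes f: "f \<in> int_functionals" and A: "spans A"
  obtains u v where "u \<in> A" "v \<in> A" "f (pt u) + 1 \<le> f (pt v)"
proof -
  obtain k l m where form: "\<And>x y z. f (pt (x,y,z)) = of_int (k * x + l * y + m * z)" and nz: "(k,l,m) \<noteq> (0,0,0)"
    using functional_form[OF f] by blast
  obtain g where g: "\<And>u. f (pt u) = of_int (g u)"
  proof
    show "f (pt u) = of_int (case u of (x,y,z) \<Rightarrow> k * x + l * y + m * z)" for u by (cases u) (simp add: form)
  qed
  have "\<exists>u\<in>A. \<exists>v\<in>A. g u < g v"
  proof (rule ccontr)
    assume "\<not> (\<exists>u\<in>A. \<exists>v\<in>A. g u < g v)"
    then have eq: "g u = g v" if "u \<in> A" "v \<in> A" for u v using that by (meson linorder_neqE)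
    obtain w where w: "w \<in> A" using A by (auto simp: spans_def)
    have "k * x + l * y + m * z = g w" if "(x,y,z) \<in> A" for x y z
    proof -
      have "real_of_int (k * x + l * y + m * z) = of_int (g w)" unfolding form[symmetric] g using eq[OF that w] by simp
      then show ?thesis by (simp only: of_int_eq_iff)
    qed
    from not_spans_plane[OF this nz] show False using A by simp
  qed
  then obtain u v where uv: "u \<in> A" "v \<in> A" "g u + 1 \<le> g v" by auto
  then have "real_of_int (g u + 1) \<le> of_int (g v)" by (simp only: of_int_le_iff)
  then show thesis using that uv g by simp
qed

lemma bounded_functional:
  assumes "finite S" "linear (f :: real^3 \<Rightarrow> real)"
  shows "bdd_above (f ` (convex hull S))" "bdd_below (f ` (convex hull S))"
proof -
  have "compact (f ` (convex hull S))"
    by (intro compact_continuous_image linear_continuous_on finite_imp_compact_convex_hull assms(1))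
       (use assms(2) in \<open>simp add: linear_conv_bounded_linear\<close>)
  then have "bounded (f ` (convex hull S))" by (rule compact_imp_bounded)
  then show "bdd_above (f ` (convex hull S))" "bdd_below (f ` (convex hull S))"
    by (auto intro: bounded_imp_bdd_above bounded_imp_bdd_below)
qed

lemma width_ge_difference:
  assumes "finite A" "linear (f :: real^3 \<Rightarrow> real)" "u \<in> A" "v \<in> A"
  shows "f (pt v) - f (pt u) \<le> (SUP x\<in>pt_hull A. f x) - (INF x\<in>pt_hull A. f x)"
proof -
  have in_hull: "pt u \<in> pt_hull A" "pt v \<in> pt_hull A" using assms(3,4) by (auto simp: pt_hull_def intro: hull_inc)
  have "bdd_above (f ` pt_hull A)" "bdd_below (f ` pt_hull A)"
    unfolding pt_hull_def using bounded_functional[OF finite_imageI[OF assms(1)] assms(2)] by auto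
  then have "f (pt v) \<le> (SUP x\<in>pt_hull A. f x)" "(INF x\<in>pt_hull A. f x) \<le> f (pt u)"
    using in_hull by (auto intro: cSUP_upper cINF_lower)
  then show ?thesis by linarith
qed

text \<open>An infimum of one need not be attained a priori, but it forces a functional of width below two;
  its values on the integer points are integers, hence exactly two consecutive ones.\<close>
lemma size6_width1_admissible:
  assumes P: "P \<in> size6_width1_polytopes"
  shows "admissible (lattice_points P)" "P = pt_hull (lattice_points P)"
proof -
  define A where "A = lattice_points P"
  have lp: "lattice_3_polytope P" and size: "lattice_size P = 6" and width: "lattice_width P = 1"
    using P by (auto simp: size6_width1_polytopes_def)
  obtain S T where S: "finite S" "S \<subseteq> int_lattice" "P = convex hull S"
    and T: "T \<subseteq> S" "card T = 4" "\<not> affine_dependent T"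
    using lp unfolding lattice_3_polytope_def by blast
  have SA: "S \<subseteq> pt ` A" unfolding A_def pt_image_lattice_points using S hull_subset[of S convex] by auto
  have card: "card A = 6"
    using size card_image[OF inj_on_subset[OF inj_pt subset_UNIV], of A]
    unfolding lattice_size_def A_def pt_image_lattice_points by simp
  then have fin: "finite A" by (intro card_ge_0_finite) simp
  have pt_hull: "P = pt_hull A"
  proof
    show "P \<subseteq> pt_hull A" unfolding S(3) pt_hull_def by (rule hull_mono[OF SA])
    have "pt ` A \<subseteq> P" unfolding A_def pt_image_lattice_points by simp
    then show "pt_hull A \<subseteq> P" unfolding pt_hull_def by (rule hull_minimal) (simp add: S(3) convex_convex_hull)
  qed
  then show "P = pt_hull (lattice_points P)" by (simp add: A_def)
  have closed: "hull_closed A" unfolding hull_closed_def pt_hull_def[symmetric] pt_hull[symmetric] by (simp add: A_def lattice_points_def)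
  have spans: "spans A" using affine_independent_spans[OF _ T(2,3)] T(1) SA by blast
  define w where "w f = (SUP x\<in>P. f x) - (INF x\<in>P. f x)" for f :: "real^3 \<Rightarrow> real"
  have "\<exists>f\<in>int_functionals. w f < 2"
  proof (rule ccontr)
    assume "\<not> (\<exists>f\<in>int_functionals. w f < 2)"
    moreover have "int_functionals \<noteq> {}" using functional_inner(1)[of 1 0 0] by auto
    ultimately have "2 \<le> (INF f\<in>int_functionals. w f)" by (intro cINF_greatest) (auto simp: not_less)
    then show False using width by (simp add: lattice_width_def w_def)
  qed
  then obtain f where f: "f \<in> int_functionals" "w f < 2" by blast
  obtain k l m where form: "\<And>x y z. f (pt (x,y,z)) = of_int (k * x + l * y + m * z)" and nz: "(k,l,m) \<noteq> (0,0,0)"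
    using functional_form[OF f(1)] by blast
  define g where "g = (\<lambda>(x,y,z). k * x + l * y + m * z)"
  have g: "f (pt u) = of_int (g u)" for u by (cases u) (simp add: form g_def)
  have lin: "linear f" using f(1) by (simp add: int_functionals_def)
  have close: "g v - g u \<le> 1" if "u \<in> A" "v \<in> A" for u v
  proof -
    have "f (pt v) - f (pt u) \<le> w f" unfolding w_def pt_hull by (rule width_ge_difference[OF fin lin that])
    then have "real_of_int (g v - g u) < of_int 2" using f(2) by (simp add: g)
    then show ?thesis by (simp only: of_int_less_iff)
  qed
  obtain u v where uv: "u \<in> A" "v \<in> A" "f (pt u) + 1 \<le> f (pt v)" using functional_values[OF f(1) spans] .
  then have "real_of_int (g u + 1) \<le> of_int (g v)" by (simp add: g)
  then have "g u + 1 \<le> g v" by (simp only: of_int_le_iff)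
  then have gv: "g v = g u + 1" using close[OF uv(1,2)] by linarith
  have "g ` A = {g u, g u + 1}"
  proof
    show "g ` A \<subseteq> {g u, g u + 1}"
    proof
      fix n assume "n \<in> g ` A"
      then obtain a where a: "a \<in> A" "n = g a" by blast
      then show "n \<in> {g u, g u + 1}" using close[OF uv(1) a(1)] close[OF a(1) uv(2)] gv by auto
    qed
    show "{g u, g u + 1} \<subseteq> g ` A" using uv(1,2) gv by (metis empty_subsetI image_eqI insert_subset)
  qed
  then show "admissible (lattice_points P)"
    unfolding A_def[symmetric] admissible_def using card closed spans unfolding g_def by blast
qed

lemma admissible_size6_width1:
  assumes A: "admissible A" shows "pt_hull A \<in> size6_width1_polytopes"
proof -
  have card: "card A = 6" and closed: "hull_closed A" and spans: "spans A" using A by (auto simp: admissible_def)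
  obtain k l m n where klm: "(\<lambda>(x,y,z). k * x + l * y + m * z) ` A = {n, n + 1}" using A by (auto simp: admissible_def)
  have fin: "finite A" using card by (intro card_ge_0_finite) simp
  obtain T where T: "T \<subseteq> pt ` A" "card T = 4" "\<not> affine_dependent T" using spans_affine_independent[OF spans] .
  have "pt ` A \<subseteq> int_lattice" using range_pt by blast
  then have "lattice_3_polytope (pt_hull A)"
    unfolding lattice_3_polytope_def pt_hull_def using T fin by blast
  moreover have "lattice_size (pt_hull A) = 6"
    unfolding lattice_size_def pt_image_lattice_points[symmetric] lattice_points_pt_hull[OF closed]
    using card card_image[OF inj_on_subset[OF inj_pt subset_UNIV], of A] by simp
  moreover have "lattice_width (pt_hull A) = 1"
  proof -
    define w where "w f = (SUP x\<in>pt_hull A. f x) - (INF x\<in>pt_hull A. f x)" for f :: "real^3 \<Rightarrow> real"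
    have ge: "1 \<le> w f" if f: "f \<in> int_functionals" for f
    proof -
      obtain u v where uv: "u \<in> A" "v \<in> A" "f (pt u) + 1 \<le> f (pt v)" using functional_values[OF f spans] .
      have "f (pt v) - f (pt u) \<le> w f" unfolding w_def
        by (rule width_ge_difference[OF fin _ uv(1,2)]) (use f in \<open>simp add: int_functionals_def\<close>)
      then show ?thesis using uv(3) by linarith
    qed
    have nz: "(k,l,m) \<noteq> (0,0,0)"
    proof
      assume z: "(k,l,m) = (0,0,0)"
      have "n \<in> (\<lambda>(x,y,z). k * x + l * y + m * z) ` A" "n + 1 \<in> (\<lambda>(x,y,z). k * x + l * y + m * z) ` A" using klm by auto
      then show False using z by auto
    qed
    define f where "f v = pt (k,l,m) \<bullet> v" for v
    have f: "f \<in> int_functionals" using functional_inner(1)[OF nz] by (simp add: f_def[abs_def])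
    have vals: "of_int n \<le> f (pt u) \<and> f (pt u) \<le> of_int n + 1" if "u \<in> A" for u
    proof -
      obtain x y z where u: "u = (x,y,z)" by (metis surj_pair)
      have "k * x + l * y + m * z \<in> {n, n + 1}" using klm that u by force
      then have "real_of_int n \<le> of_int (k * x + l * y + m * z)" "real_of_int (k * x + l * y + m * z) \<le> of_int (n + 1)"
        unfolding of_int_le_iff by auto
      then show ?thesis unfolding f_def u functional_inner(2)[OF nz] by simp
    qed
    have ne: "pt_hull A \<noteq> {}" using card by (auto simp: pt_hull_def)
    have "pt_hull A \<subseteq> {v. f v \<le> of_int n + 1}" unfolding pt_hull_def f_def
      by (rule hull_minimal) (use vals in \<open>auto simp: f_def convex_halfspace_le\<close>)
    then have "(SUP x\<in>pt_hull A. f x) \<le> of_int n + 1" using ne by (intro cSUP_least) auto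
    moreover have "pt_hull A \<subseteq> {v. f v \<ge> of_int n}" unfolding pt_hull_def f_def
      by (rule hull_minimal) (use vals in \<open>auto simp: f_def convex_halfspace_ge\<close>)
    then have "of_int n \<le> (INF x\<in>pt_hull A. f x)" using ne by (intro cINF_greatest) auto
    ultimately have "w f \<le> 1" unfolding w_def by linarith
    moreover have "(INF f\<in>int_functionals. w f) \<le> w f"
      by (rule cINF_lower[OF _ f]) (use ge in \<open>auto intro!: bdd_belowI2\<close>)
    moreover have "1 \<le> (INF f\<in>int_functionals. w f)" using f ge by (intro cINF_greatest) auto
    ultimately have "(INF f\<in>int_functionals. w f) = 1" by linarith
    then show ?thesis by (simp add: lattice_width_def w_def)
  qed
  ultimately show ?thesis by (simp add: size6_width1_polytopes_def)
qed

lemma Z_equivalence_translation_linear: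
  assumes L: "linear L" and lat: "(\<lambda>x. L x + c) ` int_lattice = int_lattice"
  shows "bij L"
proof -
  have "pt u \<in> range L" for u
  proof -
    have "pt u \<in> (\<lambda>x. L x + c) ` int_lattice" "pt 0 \<in> (\<lambda>x. L x + c) ` int_lattice"
      unfolding lat unfolding range_pt[symmetric] by simp_all
    then obtain v w where vw: "pt u = L v + c" "pt 0 = L w + c" by blast
    have "pt 0 = 0" by (simp add: zero_prod_def vec_eq_iff forall_3)
    then have "pt u = (L v + c) - (L w + c)" using vw by simp
    then have "pt u = L (v - w)" by (simp add: linear_diff[OF L])
    then show ?thesis by simp
  qed
  then obtain a b d where e: "pt (1,0,0) = L a" "pt (0,1,0) = L b" "pt (0,0,1) = L d" by (metis rangeE)
  have "v = L (v$1 *\<^sub>R a + v$2 *\<^sub>R b + v$3 *\<^sub>R d)" for v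
    by (simp add: linear_add[OF L] linear_scale[OF L] e[symmetric] vec_eq_iff forall_3)
  then have "surj L" unfolding surj_def by blast
  then show ?thesis using linear_surjective_imp_injective[OF L] by (auto simp: bij_def)
qed

text \<open>The equivalence restricts to an affine automorphism of the integer points.\<close>
lemma Z_equivalence_lattice_points:
  assumes "(P, Q) \<in> Z_equivalence" shows "lat_equiv (lattice_points P) (lattice_points Q)"
proof -
  obtain L c where L: "linear L" and lat: "(\<lambda>x. L x + c) ` int_lattice = int_lattice" and Q: "(\<lambda>x. L x + c) ` P = Q"
    using assms by (auto simp: Z_equivalence_def)
  define t where "t x = L x + c" for x
  have bij: "bij L" using Z_equivalence_translation_linear[OF L lat] .
  then have inj: "t x = t y \<longleftrightarrow> x = y" for x y by (simp add: t_def bij_def inj_eq)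
  have lat': "t ` int_lattice = int_lattice" using lat by (simp add: t_def[abs_def])
  define T where "T u = inv pt (t (pt u))" for u
  have T: "pt (T u) = t (pt u)" for u
  proof -
    have "t (pt u) \<in> range pt" using lat' unfolding range_pt[symmetric] by blast
    then show ?thesis unfolding T_def by (rule f_inv_into_f)
  qed
  have surjT: "\<exists>u. v = T u" for v
  proof -
    have "pt v \<in> t ` int_lattice" unfolding lat' unfolding range_pt[symmetric] by simp
    then obtain u where "pt v = t (pt u)" unfolding range_pt[symmetric] by blast
    then have "pt v = pt (T u)" by (simp only: T)
    then have "v = T u" by (simp only: pt_eq_iff)
    then show ?thesis ..
  qed
  have "T u = T v \<longleftrightarrow> u = v" for u v using inj[of "pt u" "pt v"] by (metis T pt_eq_iff)
  then have "bij T" using surjT unfolding bij_def inj_def surj_def by blast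
  moreover have "T (u + v - w) = T u + T v - T w" for u v w
  proof -
    have "pt (T (u + v - w)) = pt (T u + T v - T w)"
      by (simp add: T pt_add pt_diff t_def linear_add[OF L] linear_diff[OF L])
    then show ?thesis by simp
  qed
  ultimately have "lat_aut T" by (simp add: lat_aut_def)
  moreover have "T ` lattice_points P = lattice_points Q"
  proof
    show "T ` lattice_points P \<subseteq> lattice_points Q"
      using Q by (auto simp: lattice_points_def T t_def)
    show "lattice_points Q \<subseteq> T ` lattice_points P"
    proof
      fix v assume "v \<in> lattice_points Q"
      then have "pt v \<in> t ` P" using Q by (auto simp: lattice_points_def t_def[abs_def])
      then obtain x where x: "x \<in> P" "pt v = t x" by blast
      obtain u where u: "v = T u" using surjT by blast
      then have "x = pt u" using x T inj by metis
      then show "v \<in> T ` lattice_points P" using x u by (auto simp: lattice_points_def)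
    qed
  qed
  ultimately show ?thesis by (auto simp: lat_equiv_def)
qed

lemma lat_equiv_Z_equivalence:
  assumes "lat_equiv A B" shows "(pt_hull A, pt_hull B) \<in> Z_equivalence"
proof -
  obtain T where T: "lat_aut T" "T ` A = B" using assms by (auto simp: lat_equiv_def)
  obtain a b c d e f g h i r s t
    where form: "T = (\<lambda>(x,y,z). (a*x + b*y + c*z + r, d*x + e*y + f*z + s, g*x + h*y + i*z + t))"
    using lat_aut3_form[OF T(1)] .
  define M :: "real^3^3" where "M = vector [pt (a,b,c), pt (d,e,f), pt (g,h,i)]"
  define L where "L v = M *v v" for v
  have L: "linear L" unfolding L_def by (rule matrix_vector_mul_linear)
  define \<tau> where "\<tau> = (\<lambda>x. L x + pt (r,s,t))"
  have \<tau>: "\<tau> (pt u) = pt (T u)" for u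
    by (cases u) (simp add: \<tau>_def L_def M_def form vec_eq_iff forall_3 matrix_vector_mult_def sum_3)
  have "\<tau> ` int_lattice = range (pt \<circ> T)" unfolding range_pt[symmetric] by (simp add: image_image \<tau> comp_def)
  also have "\<dots> = int_lattice"
  proof -
    have "range T = UNIV" using T(1) by (simp add: lat_aut_def bij_def)
    then show ?thesis unfolding range_pt[symmetric] image_comp[symmetric] by simp
  qed
  finally have lat: "\<tau> ` int_lattice = int_lattice" .
  have "\<tau> ` pt_hull A = (\<lambda>x. pt (r,s,t) + x) ` L ` (convex hull (pt ` A))"
    by (simp add: \<tau>_def pt_hull_def image_image add.commute)
  also have "\<dots> = convex hull ((\<lambda>x. pt (r,s,t) + x) ` L ` pt ` A)"
    by (simp add: convex_hull_linear_image[OF L] convex_hull_translation)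
  also have "(\<lambda>x. pt (r,s,t) + x) ` L ` pt ` A = \<tau> ` pt ` A" by (simp add: \<tau>_def image_image add.commute)
  also have "\<dots> = pt ` B" unfolding T(2)[symmetric] image_image \<tau> ..
  finally have "\<tau> ` pt_hull A = pt_hull B" by (simp add: pt_hull_def)
  then show ?thesis unfolding Z_equivalence_def using L lat \<tau>_def by blast
qed

lemma equiv_Z: "equiv UNIV Z_equivalence"
proof (rule equivI)
  show "Z_equivalence \<subseteq> UNIV \<times> UNIV" by simp
  show "refl Z_equivalence"
    unfolding refl_on_def Z_equivalence_def
    by (auto intro!: exI[of _ "\<lambda>x. x"] exI[of _ 0] linear_ident)
  show "sym Z_equivalence"
  proof (rule symI)
    fix P Q assume "(P, Q) \<in> Z_equivalence"
    then obtain L c where L: "linear L" and lat: "(\<lambda>x. L x + c) ` int_lattice = int_lattice" and Q: "(\<lambda>x. L x + c) ` P = Q"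
      by (auto simp: Z_equivalence_def)
    have bij: "bij L" using Z_equivalence_translation_linear[OF L lat] .
    define K where "K = inv L"
    have KL: "K (L x) = x" for x by (simp add: K_def inv_f_f bij_is_inj[OF bij])
    have LK: "L (K x) = x" for x by (simp add: K_def surj_f_inv_f bij_is_surj[OF bij])
    have K: "linear K"
    proof (rule linearI)
      fix x y show "K (x + y) = K x + K y"
        by (metis KL LK linear_add[OF L])
    next
      fix r x show "K (r *\<^sub>R x) = r *\<^sub>R K x" by (metis KL LK linear_scale[OF L])
    qed
    have undo_map: "(\<lambda>x. K x + - K c) ` (\<lambda>x. L x + c) ` S = S" for S
      by (simp add: image_image linear_add[OF K] KL)
    have "(\<lambda>x. K x + - K c) ` int_lattice = int_lattice" using undo_map[of int_lattice] unfolding lat .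
    moreover have "(\<lambda>x. K x + - K c) ` Q = P" using undo_map[of P] unfolding Q .
    ultimately show "(Q, P) \<in> Z_equivalence" unfolding Z_equivalence_def using K by blast
  qed
  show "trans Z_equivalence"
  proof (rule transI)
    fix P Q R assume PQ: "(P, Q) \<in> Z_equivalence" and QR: "(Q, R) \<in> Z_equivalence"
    obtain L c where L: "linear L" "(\<lambda>x. L x + c) ` int_lattice = int_lattice" "(\<lambda>x. L x + c) ` P = Q"
      using PQ by (auto simp: Z_equivalence_def)
    obtain K d where K: "linear K" "(\<lambda>x. K x + d) ` int_lattice = int_lattice" "(\<lambda>x. K x + d) ` Q = R"
      using QR by (auto simp: Z_equivalence_def)
    have comp: "(\<lambda>x. (K \<circ> L) x + (K c + d)) ` S = (\<lambda>x. K x + d) ` (\<lambda>x. L x + c) ` S" for S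
      by (simp add: image_image linear_add[OF K(1)] add.assoc)
    have "(\<lambda>x. (K \<circ> L) x + (K c + d)) ` int_lattice = int_lattice" "(\<lambda>x. (K \<circ> L) x + (K c + d)) ` P = R"
      unfolding comp L K by simp_all
    then show "(P, R) \<in> Z_equivalence"
      unfolding Z_equivalence_def using linear_compose[OF L(1) K(1)] by blast
  qed
qed

section \<open>Counting\<close>

text \<open>The set \<open>A\<close> is equivalent both to \<open>A'\<close> and to the set of all integer points of the hull of \<open>A'\<close>, so
  these two have the same number of elements.\<close>
lemma hull_closed_equiv:
  assumes "hull_closed A" "finite A" "lat_equiv A A'" shows "hull_closed A'"
proof -
  have "lat_equiv A (lattice_points (pt_hull A'))"
    using Z_equivalence_lattice_points[OF lat_equiv_Z_equivalence[OF assms(3)]] lattice_points_pt_hull[OF assms(1)] by simp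
  then obtain T where T: "lattice_points (pt_hull A') = T ` A" by (auto simp: lat_equiv_def)
  then have fin: "finite (lattice_points (pt_hull A'))" using assms(2) by simp
  have "card (lattice_points (pt_hull A')) = card A'"
    using lat_equiv_card[OF \<open>lat_equiv A (lattice_points (pt_hull A'))\<close>] lat_equiv_card[OF assms(3)] by simp
  moreover have "A' \<subseteq> lattice_points (pt_hull A')"
    unfolding lattice_points_def pt_hull_def by (intro subsetI CollectI hull_inc imageI)
  ultimately have "A' = lattice_points (pt_hull A')" using card_subset_eq[OF fin] by simp
  then show ?thesis unfolding hull_closed_def pt_hull_def[symmetric] lattice_points_def by blast
qed

text \<open>A primitive covector is the last row of a unimodular matrix: Bezout coefficients for the first
  two entries and then for their greatest common divisor and the third.\<close>
lemma complete_functional: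
  assumes one: "k*x0 + l*y0 + m*z0 = (1::int)"
  obtains T where "lat_aut T" "\<And>x y z. snd (snd (T (x,y,z))) = k*x + l*y + m*z + n"
proof (cases "k = 0 \<and> l = 0")
  case True
  then have "m = 1 \<or> m = -1" using one by (metis add_0 mult_zero_left zmult_eq_1_iff)
  then have "lat_aut (\<lambda>(x,y,z). (1*x + 0*y + 0*z + 0, 0*x + 1*y + 0*z + 0, k*x + l*y + m*z + n))"
    using True by (intro lat_aut3) (simp add: det3_def)
  then show thesis by (rule that) simp
next
  case False
  define g where "g = gcd k l"
  have g: "g \<noteq> 0" using False by (auto simp: g_def)
  obtain s t where st: "s * k + t * l = g" using bezout_int[of k l] g_def by auto
  obtain k' l' where kl: "k = g * k'" "l = g * l'" by (metis dvd_def g_def gcd_dvd1 gcd_dvd2)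
  have "g * (s * k' + t * l') = g * 1" using st kl by (simp add: algebra_simps)
  then have st': "s * k' + t * l' = 1" using g by simp
  define p where "p = k' * x0 + l' * y0"
  have p: "p * g + z0 * m = 1" using one by (simp add: p_def kl algebra_simps)
  have "det3 (-t) s 0 (-(z0*k')) (-(z0*l')) p k l m = (s * k' + t * l') * (p * g + z0 * m)"
    by (simp add: det3_def kl algebra_simps)
  then have "det3 (-t) s 0 (-(z0*k')) (-(z0*l')) p k l m = 1" using st' p by simp
  then have "lat_aut (\<lambda>(x,y,z). ((-t)*x + s*y + 0*z + 0, (-(z0*k'))*x + (-(z0*l'))*y + p*z + 0, k*x + l*y + m*z + n))"
    by (intro lat_aut3) simp
  then show thesis by (rule that) simp
qed

lemma admissible_classified:
  assumes "admissible A" shows "classified A"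
proof -
  have card: "card A = 6" and closed: "hull_closed A" and spans: "spans A" using assms by (auto simp: admissible_def)
  have fin: "finite A" using card by (intro card_ge_0_finite) simp
  obtain k l m n where klm: "(\<lambda>(x,y,z). k*x + l*y + m*z) ` A = {n, n + 1}" using assms by (auto simp: admissible_def)
  have "n \<in> (\<lambda>(x,y,z). k*x + l*y + m*z) ` A" "n + 1 \<in> (\<lambda>(x,y,z). k*x + l*y + m*z) ` A" using klm by auto
  then obtain x1 y1 z1 x2 y2 z2 where "k*x1 + l*y1 + m*z1 = n" "k*x2 + l*y2 + m*z2 = n + 1" by auto
  then have "k*(x2-x1) + l*(y2-y1) + m*(z2-z1) = 1" by (simp add: algebra_simps)
  then obtain T where T: "lat_aut T" "\<And>x y z. snd (snd (T (x,y,z))) = k*x + l*y + m*z + (- n)"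
    using complete_functional[of k "x2-x1" l "y2-y1" m "z2-z1" "- n"] by blast
  define A' where "A' = T ` A"
  have eq: "lat_equiv A A'" using T(1) by (auto simp: lat_equiv_def A'_def)
  have closed': "hull_closed A'" using hull_closed_equiv[OF closed fin eq] .
  have level: "z = 0 \<or> z = 1" if h: "(x,y,z) \<in> A'" for x y z
  proof -
    obtain w where w: "w \<in> A" "(x,y,z) = T w" using h unfolding A'_def by blast
    obtain a b c where "w = (a,b,c)" by (metis surj_pair)
    then have abc: "(a,b,c) \<in> A" "(x,y,z) = T (a,b,c)" using w by simp_all
    then have "z = k*a + l*b + m*c + (- n)" using T(2)[of a b c] by (metis snd_conv)
    moreover have "k*a + l*b + m*c \<in> {n, n+1}" using klm abc(1) by force
    ultimately show ?thesis by auto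
  qed
  define B C where "B = {(x,y). (x,y,0) \<in> A'}" and "C = {(x,y). (x,y,1) \<in> A'}"
  have A': "A' = stack B C"
  proof
    show "A' \<subseteq> stack B C"
    proof
      fix u assume u: "u \<in> A'"
      obtain x y z where xyz: "u = (x,y,z)" by (metis surj_pair)
      then have "z = 0 \<or> z = 1" using level u by simp
      then show "u \<in> stack B C" using u xyz by (force simp: stack_def B_def C_def)
    qed
    show "stack B C \<subseteq> A'" by (auto simp: stack_def B_def C_def)
  qed
  have finA': "finite A'" using fin by (simp add: A'_def)
  then have finBC: "finite B" "finite C" unfolding A' stack_def
    by (auto elim!: finite_imageD simp: inj_on_def)
  have inj: "inj_on (\<lambda>(x,y). (x,y,z)) D" for z :: int and D :: "pt2 set" by (auto simp: inj_on_def)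
  have "card A' = card B + card C"
    unfolding A' stack_def card_image[OF inj, symmetric, of B 0] card_image[OF inj, symmetric, of C 1]
    by (rule card_Un_disjoint) (use finBC in auto)
  then have "card B + card C = 6" using lat_equiv_card[OF eq] card by simp
  moreover have "tri_closed B" "tri_closed C" unfolding B_def C_def by (rule tri_closed_level[OF closed'])+
  moreover have "spans (stack B C)" using spans_equiv[OF eq spans] A' by simp
  ultimately have "classified (stack B C)" using finBC by (intro classified_stack)
  then show ?thesis using classified_equiv[OF eq] A' by simp
qed

lemma point_oms_iff:
  "X \<in> point_oms P \<longleftrightarrow> (\<exists>q. bij_betw q UNIV (lattice_points P) \<and> X = int_om q)"
proof
  assume "X \<in> point_oms P"
  then obtain p where p: "X = oriented_matroid p" "bij_betw p UNIV (pt ` lattice_points P)"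
    by (auto simp: point_oms_def pt_image_lattice_points)
  define q where "q = inv_into (lattice_points P) pt \<circ> p"
  have inj: "inj_on pt (lattice_points P)" by (rule inj_on_subset[OF inj_pt subset_UNIV])
  have "bij_betw (inv_into (lattice_points P) pt) (pt ` lattice_points P) (lattice_points P)"
    by (rule bij_betw_inv_into) (simp add: bij_betw_def inj)
  then have "bij_betw q UNIV (lattice_points P)" unfolding q_def by (rule bij_betw_trans[OF p(2)])
  moreover have "pt (q i) = p i" for i
  proof -
    have "p i \<in> pt ` lattice_points P" using p(2) by (auto simp: bij_betw_def)
    then show ?thesis unfolding q_def comp_def by (rule f_inv_into_f)
  qed
  then have "p = pt \<circ> q" by auto
  then have "X = int_om q" using p(1) oriented_matroid_pt by simp
  ultimately show "\<exists>q. bij_betw q UNIV (lattice_points P) \<and> X = int_om q" by blast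
next
  assume "\<exists>q. bij_betw q UNIV (lattice_points P) \<and> X = int_om q"
  then obtain q where q: "bij_betw q UNIV (lattice_points P)" "X = int_om q" by blast
  have bij: "bij_betw (pt \<circ> q) UNIV (P \<inter> int_lattice)"
    unfolding pt_image_lattice_points[symmetric]
    by (rule bij_betw_trans[OF q(1)]) (simp add: bij_betw_def inj_on_subset[OF inj_pt])
  show "X \<in> point_oms P" unfolding point_oms_def
    by (intro CollectI exI[of _ "pt \<circ> q"] conjI bij) (simp add: q(2) oriented_matroid_pt)
qed

lemma om_refl: "(X, X) \<in> om_isomorphism"
  using equiv_om by (auto simp: equiv_def refl_on_def)

lemma om_trans: "(X, Y) \<in> om_isomorphism \<Longrightarrow> (Y, Z) \<in> om_isomorphism \<Longrightarrow> (X, Z) \<in> om_isomorphism"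
  using equiv_om by (auto simp: equiv_def dest: transD)

lemma labeling_transfer:
  assumes "lat_equiv A (set L)" "length L = 6" "card A = 6" "bij_betw q UNIV A"
  shows "(int_om (labeling L), int_om q) \<in> om_isomorphism"
proof -
  obtain T where T: "lat_aut T" "T ` set L = A" using lat_equiv_sym[OF assms(1)] by (auto simp: lat_equiv_def)
  have "card (set L) = length L" using lat_equiv_card[OF assms(1)] assms(2,3) by simp
  then have "bij_betw (labeling L) UNIV (set L)" using bij_labeling[OF assms(2)] card_distinct by blast
  moreover have "bij_betw T (set L) A"
    using T by (auto simp: bij_betw_def lat_aut_def bij_def intro: inj_on_subset)
  ultimately have "bij_betw (T \<circ> labeling L) UNIV A" by (rule bij_betw_trans)
  then have "(int_om (T \<circ> labeling L), int_om q) \<in> om_isomorphism" using int_om_relabel assms(4) by blast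
  then show ?thesis using int_om_lat_aut[OF T(1)] om_trans by blast
qed

text \<open>The indices below twelve are the types with a single class.\<close>
definition om_type :: "nat \<Rightarrow> pt3 list" where "om_type i = (finite_types @ infinite_types) ! i"

definition om_class :: "nat \<Rightarrow> sign_map set" where
  "om_class i = om_isomorphism `` {int_om (labeling (om_type i))}"

lemma om_type_simps:
  "i < 12 \<Longrightarrow> om_type i = finite_types ! i" "om_type (i + 12) = infinite_types ! i"
  by (simp_all add: om_type_def nth_append length_types)

lemma length_om_type: "i < 20 \<Longrightarrow> length (om_type i) = 6"
proof -
  have "\<forall>L\<in>set (finite_types @ infinite_types). length L = 6"
    by (simp add: finite_types_def infinite_types_def)
  moreover assume "i < 20"
  then have "om_type i \<in> set (finite_types @ infinite_types)"
    unfolding om_type_def by (intro nth_mem) (simp add: length_types)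
  ultimately show ?thesis by blast
qed

lemma om_class_member:
  assumes "(int_om (labeling (om_type i)), X) \<in> om_isomorphism"
  shows "X \<in> om_class i"
  using assms by (simp add: om_class_def)

lemma om_class_disjoint:
  assumes "X \<in> om_class i" "X \<in> om_class j" "i < 20" "j < 20" shows "i = j"
proof -
  have inv: "om_invariant X = of_int (list_invariant (om_type n))" if "X \<in> om_class n" "n < 20" for n
    using that om_invariant_iso om_invariant_labeling[OF length_om_type] by (fastforce simp: om_class_def)
  have "map list_invariant (finite_types @ infinite_types) ! i = map list_invariant (finite_types @ infinite_types) ! j"
    using inv[OF assms(1,3)] inv[OF assms(2,4)] assms(3,4) by (simp add: om_type_def length_types del: map_append)
  moreover have "distinct (map list_invariant (finite_types @ infinite_types))"
    by (simp add: finite_type_invariants infinite_type_invariants)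
  ultimately show ?thesis using assms(3,4) by (subst (asm) nth_eq_iff_index_eq) (simp_all add: length_types)
qed

lemma polytope_type:
  assumes P: "P \<in> size6_width1_polytopes" and X: "X \<in> point_oms P"
  obtains i where "i < 20" "X \<in> om_class i" "i < 12 \<Longrightarrow> lat_equiv (lattice_points P) (set (om_type i))"
proof -
  define A where "A = lattice_points P"
  have adm: "admissible A" using size6_width1_admissible(1)[OF P] by (simp add: A_def)
  then have card: "card A = 6" by (simp add: admissible_def)
  obtain q where q: "bij_betw q UNIV A" "X = int_om q" using X unfolding point_oms_iff A_def by blast
  from admissible_classified[OF adm] show thesis
    unfolding classified_def
  proof (elim disjE bexE exE conjE)
    fix L assume L: "L \<in> set finite_types" "lat_equiv A (set L)"
    then obtain i where i: "i < 12" "L = om_type i" by (metis in_set_conv_nth length_types(1) om_type_simps(1))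
    then have "X \<in> om_class i"
      using labeling_transfer[OF L(2) _ card q(1)] length_om_type[of i] q(2) by (intro om_class_member) simp
    then show thesis using that[of i] i L(2) by (simp add: A_def)
  next
    fix L L' assume L: "L \<in> set infinite_types" "length L' = 6" "lat_equiv A (set L')" "signs L' = signs L"
    then obtain i where i: "i < 8" "L = om_type (i + 12)" by (metis in_set_conv_nth length_types(2) om_type_simps(2))
    then have "int_om (labeling L') = int_om (labeling (om_type (i + 12)))"
      using int_om_signs[OF L(2) _ L(4)] length_om_type[of "i + 12"] by simp
    then have "X \<in> om_class (i + 12)"
      using labeling_transfer[OF L(3,2) card q(1)] q(2) by (intro om_class_member) simp
    then show thesis using that[of "i + 12"] i by simp
  qed
qed

lemma realize_signs:
  assumes L: "length L = 6" "signs L = signs (om_type i)" "admissible (set L)" and i: "i < 20"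
  shows "pt_hull (set L) \<in> size6_width1_polytopes" "int_om (labeling L) \<in> point_oms (pt_hull (set L))"
    "int_om (labeling L) \<in> om_class i" "lattice_points (pt_hull (set L)) = set L"
proof -
  show "pt_hull (set L) \<in> size6_width1_polytopes" by (rule admissible_size6_width1[OF L(3)])
  show pts: "lattice_points (pt_hull (set L)) = set L"
    using lattice_points_pt_hull L(3) by (simp add: admissible_def)
  have "distinct L" using L by (intro card_distinct) (simp add: admissible_def)
  then show "int_om (labeling L) \<in> point_oms (pt_hull (set L))"
    unfolding point_oms_iff pts using bij_labeling[OF L(1)] by blast
  show "int_om (labeling L) \<in> om_class i"
    by (rule om_class_member) (simp add: int_om_signs[OF L(1) length_om_type[OF i] L(2)] om_refl)
qed

lemma large_members:
  assumes "i < 8" "n \<ge> 4"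
  obtains L where "length L = 6" "signs L = signs (om_type (i + 12))" "admissible (set L)"
    "\<exists>a\<in>set L. \<exists>b\<in>set L. \<exists>c\<in>set L. \<exists>d\<in>set L. n \<le> \<bar>det4 a b c d\<bar>"
  using unbounded_families[OF assms(2)] assms(1) unfolding om_type_simps(2) by blast

lemma class_realized:
  assumes "i < 20" obtains P X where "P \<in> size6_width1_polytopes" "X \<in> point_oms P" "X \<in> om_class i"
proof -
  have "\<exists>L. length L = 6 \<and> signs L = signs (om_type i) \<and> admissible (set L)"
  proof (cases "i < 12")
    case True
    then show ?thesis using admissible_finite_types length_om_type[OF assms] om_type_simps(1) by metis
  next
    case False
    then have "i - 12 < 8" "i = (i - 12) + 12" using assms by auto
    then show ?thesis using large_members[of "i - 12" 4] by (metis order_refl)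
  qed
  then obtain L where "length L = 6" "signs L = signs (om_type i)" "admissible (set L)" by blast
  from realize_signs[OF this assms] show thesis using that by blast
qed

lemma size6_width1_oms_eq: "size6_width1_oms = om_class ` {..<20}"
proof -
  have eq: "om_isomorphism `` {X} = om_class i" if "X \<in> om_class i" for X i
    using that equiv_class_eq[OF equiv_om] by (auto simp: om_class_def)
  show ?thesis
  proof
    show "size6_width1_oms \<subseteq> om_class ` {..<20}"
    proof
      fix M assume "M \<in> size6_width1_oms"
      then obtain P X where PX: "P \<in> size6_width1_polytopes" "X \<in> point_oms P" "M = om_isomorphism `` {X}"
        by (auto simp: size6_width1_oms_def quotient_def)
      obtain i where "i < 20" "X \<in> om_class i" using polytope_type[OF PX(1,2)] by blast
      then show "M \<in> om_class ` {..<20}" using eq PX(3) by auto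
    qed
    show "om_class ` {..<20} \<subseteq> size6_width1_oms"
    proof
      fix M assume "M \<in> om_class ` {..<20}"
      then obtain i where i: "i < 20" "M = om_class i" by auto
      obtain P X where PX: "P \<in> size6_width1_polytopes" "X \<in> point_oms P" "X \<in> om_class i" using class_realized[OF i(1)] .
      then have "om_isomorphism `` {X} \<in> size6_width1_oms" unfolding size6_width1_oms_def by (intro quotientI) blast
      then show "M \<in> size6_width1_oms" using eq[OF PX(3)] i(2) by simp
    qed
  qed
qed

lemma inj_om_class: "inj_on om_class {..<20}"
proof (rule inj_onI)
  fix i j :: nat assume ij: "i \<in> {..<20}" "j \<in> {..<20}" "om_class i = om_class j"
  have "int_om (labeling (om_type i)) \<in> om_class i" by (simp add: om_class_def om_refl)
  then show "i = j" using om_class_disjoint ij by auto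
qed

lemma card_Z_classes_finite:
  assumes "i < 12" shows "card (Z_classes_with_om (om_class i)) = 1"
proof -
  have i: "i < 20" using assms by simp
  define \<P> where "\<P> = {P \<in> size6_width1_polytopes. \<exists>X\<in>point_oms P. X \<in> om_class i}"
  have std: "(P, pt_hull (set (om_type i))) \<in> Z_equivalence" if h: "P \<in> \<P>" for P
  proof -
    obtain X where P: "P \<in> size6_width1_polytopes" and X: "X \<in> point_oms P" "X \<in> om_class i" using h by (auto simp: \<P>_def)
    obtain j where j: "j < 20" "X \<in> om_class j" "j < 12 \<Longrightarrow> lat_equiv (lattice_points P) (set (om_type j))"
      using polytope_type[OF P X(1)] by blast
    have "j = i" using om_class_disjoint[OF j(2) X(2) j(1) i] .
    then have "lat_equiv (lattice_points P) (set (om_type i))" using j(3) assms by simp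
    from lat_equiv_Z_equivalence[OF this] show ?thesis using size6_width1_admissible(2)[OF P] by simp
  qed
  obtain P where P: "P \<in> \<P>" using class_realized[OF i] unfolding \<P>_def by blast
  have "\<P> // Z_equivalence = {Z_equivalence `` {pt_hull (set (om_type i))}}"
    using P equiv_class_eq[OF equiv_Z std] by (auto simp: quotient_def)
  then show ?thesis by (simp add: Z_classes_with_om_def \<P>_def)
qed

text \<open>Finitely many classes would have finitely many determinants of quadruples, up to sign.\<close>
lemma infinite_Z_classes:
  assumes i: "12 \<le> i" "i < 20" shows "infinite (Z_classes_with_om (om_class i))"
proof
  define \<P> where "\<P> = {P \<in> size6_width1_polytopes. \<exists>X\<in>point_oms P. X \<in> om_class i}"
  define vols where "vols P = (\<lambda>(a,b,c,d). \<bar>det4 a b c d\<bar>) ` (lattice_points P \<times> lattice_points P \<times> lattice_points P \<times> lattice_points P)" for P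
  assume "finite (Z_classes_with_om (om_class i))"
  then have finq: "finite (\<P> // Z_equivalence)" by (simp add: Z_classes_with_om_def \<P>_def)
  define rep where "rep K = (SOME P. P \<in> \<P> \<and> K = Z_equivalence `` {P})" for K
  have rep: "rep K \<in> \<P>" "K = Z_equivalence `` {rep K}" if "K \<in> \<P> // Z_equivalence" for K
  proof -
    have "\<exists>P. P \<in> \<P> \<and> K = Z_equivalence `` {P}" using that by (auto simp: quotient_def)
    then have "rep K \<in> \<P> \<and> K = Z_equivalence `` {rep K}" unfolding rep_def by (rule someI_ex)
    then show "rep K \<in> \<P>" "K = Z_equivalence `` {rep K}" by simp_all
  qed
  have "finite (vols P)" if "P \<in> \<P>" for P
  proof -
    have "card (lattice_points P) = 6"
      using size6_width1_admissible(1) that by (auto simp: \<P>_def admissible_def)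
    then have "finite (lattice_points P)" by (intro card_ge_0_finite) simp
    then show ?thesis by (simp add: vols_def)
  qed
  then have "finite (\<Union>K\<in>\<P> // Z_equivalence. vols (rep K))" using finq rep by blast
  then obtain N where N: "\<And>v. v \<in> (\<Union>K\<in>\<P> // Z_equivalence. vols (rep K)) \<Longrightarrow> v \<le> N"
    by (meson bdd_above.E bdd_above_finite)
  have i': "i - 12 < 8" "(i - 12) + 12 = i" using i by auto
  obtain L where L: "length L = 6" "signs L = signs (om_type i)" "admissible (set L)"
    and vol: "\<exists>a\<in>set L. \<exists>b\<in>set L. \<exists>c\<in>set L. \<exists>d\<in>set L. max 4 (N + 1) \<le> \<bar>det4 a b c d\<bar>"
    using large_members[OF i'(1), of "max 4 (N + 1)"] unfolding i'(2) by (metis max.cobounded1)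
  define P where "P = pt_hull (set L)"
  have P: "P \<in> \<P>" and pts: "lattice_points P = set L"
    using realize_signs[OF L i(2)] unfolding \<P>_def P_def by blast+
  define K where "K = Z_equivalence `` {P}"
  have K: "K \<in> \<P> // Z_equivalence" unfolding K_def using P by (rule quotientI)
  have "P \<in> K" unfolding K_def using equiv_Z by (auto simp: equiv_def refl_on_def)
  then have "(rep K, P) \<in> Z_equivalence" using rep(2)[OF K] by blast
  then have "lat_equiv (lattice_points (rep K)) (set L)" unfolding pts[symmetric] by (rule Z_equivalence_lattice_points)
  then obtain T where T: "lat_aut T" "T ` lattice_points (rep K) = set L" by (auto simp: lat_equiv_def)
  obtain s where s: "s = 1 \<or> s = -1" "\<And>u v w x. det4 (T u) (T v) (T w) (T x) = s * det4 u v w x"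
    using lat_aut_det4[OF T(1)] by blast
  obtain a b c d where abcd: "a \<in> lattice_points (rep K)" "b \<in> lattice_points (rep K)" "c \<in> lattice_points (rep K)"
    "d \<in> lattice_points (rep K)" "max 4 (N + 1) \<le> \<bar>det4 (T a) (T b) (T c) (T d)\<bar>"
    using vol unfolding T(2)[symmetric] by blast
  have "\<bar>det4 a b c d\<bar> \<in> vols (rep K)" unfolding vols_def using abcd(1-4) by force
  then have "\<bar>det4 a b c d\<bar> \<le> N" using N K by blast
  moreover have "\<bar>det4 (T a) (T b) (T c) (T d)\<bar> = \<bar>det4 a b c d\<bar>" using s by (auto simp: abs_mult)
  ultimately show False using abcd(5) by simp
qed

theorem mainTheorem3:
  shows "card size6_width1_oms = 20 \<and>
    card {M \<in> size6_width1_oms. infinite (Z_classes_with_om M)} = 8 \<and>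
    card {M \<in> size6_width1_oms. finite (Z_classes_with_om M)} = 12 \<and>
    (\<forall>M \<in> size6_width1_oms. finite (Z_classes_with_om M) \<longrightarrow> card (Z_classes_with_om M) = 1)"
proof -
  have one: "card (Z_classes_with_om (om_class i)) = 1" if "i < 12" for i
    using that by (rule card_Z_classes_finite)
  then have fin: "finite (Z_classes_with_om (om_class i))" if "i < 12" for i
    using that by (intro card_ge_0_finite) simp
  have split: "finite (Z_classes_with_om (om_class i)) \<longleftrightarrow> i < 12" if "i < 20" for i
    using fin infinite_Z_classes[of i] that by (meson not_less)
  have card_image: "card (om_class ` I) = card I" if "I \<subseteq> {..<20}" for I
    using inj_on_subset[OF inj_om_class that] by (rule card_image)
  have "{M \<in> size6_width1_oms. infinite (Z_classes_with_om M)} = om_class ` {12..<20}"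
    unfolding size6_width1_oms_eq using split by force
  moreover have "{M \<in> size6_width1_oms. finite (Z_classes_with_om M)} = om_class ` {..<12}"
    unfolding size6_width1_oms_eq using split by force
  moreover have "card (om_class ` {12..<20}) = 8" "card (om_class ` {..<12}) = 12" "card (om_class ` {..<20}) = 20"
    by (subst card_image; auto)+
  moreover have "\<forall>M \<in> size6_width1_oms. finite (Z_classes_with_om M) \<longrightarrow> card (Z_classes_with_om M) = 1"
    unfolding size6_width1_oms_eq using split one by auto
  ultimately show ?thesis using size6_width1_oms_eq by simp
qed

end
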